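(* Let $x > e^{60}$ be half an odd integer and suppose that $T \in (50, x)$ is a real number that is not the ordinate (imaginary part) of any zero of $\zeta(s)$. Then $$\left| \psi(x) - \left( x - \sum_{|\Im \rho| < T} \frac{x^{\rho}}{\rho} \right) \right| < \frac{2 x \log^2 x}{T},$$ where the sum runs over the nontrivial zeros $\rho$ of the Riemann zeta-function with $|\Im \rho| < T$.
   Context: $\zeta(s)$ is the Riemann zeta-function; its nontrivial zeros are those in the critical strip $0 < \Re s < 1$, and sums over zeros count each zero with multiplicity. The von Mangoldt function $\Lambda(n)$ equals $\log p$ if $n = p^m$ with $p$ prime and $m$ a positive integer, and $0$ otherwise. $\psi(x) = \sum_{n \leq x} \Lambda(n)$. "Half an odd integer" means $x = k/2$ with $k$ an odd integer. $\log$ is the natural logarithm and $\log^2 x = (\log x)^2$. *)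

theory Defs
  imports "HOL-Complex_Analysis.Complex_Analysis" "HOL-Number_Theory.Prime_Powers"
begin

section \<open>Analytic continuation of the zeta series\<close>

definition zeta_series :: "complex \<Rightarrow> complex" where
  "zeta_series s = (\<Sum>n. 1 / of_nat (Suc n) powr s)"

text \<open>
  The continuation is obtained by induction on \<open>m\<close>: expanding \<open>(n + 1)\<^sup>1\<^sup>-\<^sup>s\<close> in powers of \<open>1 / n\<close> up
  to order \<open>m\<close> and summing over \<open>n\<close> expresses \<open>(s - 1) \<zeta>(s)\<close> through the values
  \<open>(w - 1) \<zeta>(w)\<close> at \<open>w = s + 1, \<dots>, s + m - 1\<close> and a series that is holomorphic for
  \<open>Re s > 1 - m\<close>.
\<close>

definition zeta_rem :: "nat \<Rightarrow> nat \<Rightarrow> complex \<Rightarrow> complex" where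
  "zeta_rem m n s = (of_nat (Suc n)) powr (1 - s) -
     (\<Sum>j\<le>m. ((1 - s) gchoose j) * of_nat n powr (1 - s - of_nat j))"

lemma norm_of_nat_powr: "n > 0 \<Longrightarrow> cmod (of_nat n powr s) = real n powr Re s"
  by (simp add: norm_powr_real_powr)

lemma zeta_rem_bound:
  assumes "n > 0" "cmod s \<le> B"
  shows "cmod (zeta_rem m n s) \<le>
    (B + 1 + real m) ^ Suc m * 2 powr (B + real m + 2) / fact m * real n powr (- Re s - real m)"
proof -
  define a where "a = 1 - s"
  define c where "c = (\<lambda>j. (a gchoose j) * fact j)"
  define f where "f = (\<lambda>j z. c j * (1 + z) powr (a - of_nat j))"
  define S where "S = (of_real ` {0..1::real} :: complex set)"
  define C where "C = (B + 1 + real m) ^ Suc m * 2 powr (B + real m + 2)"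
  have B: "B \<ge> 0" using assms(2) norm_ge_zero order_trans by blast
  have na: "cmod a \<le> B + 1"
    unfolding a_def using assms(2) norm_triangle_ineq4[of 1 s] by simp
  have cS: "c (Suc j) = c j * (a - of_nat j)" for j
    unfolding c_def gbinomial_mult_fact' by (simp add: prod.atLeast0_lessThan_Suc)
  have nc: "cmod (c (Suc m)) \<le> (B + 1 + real m) ^ Suc m"
  proof -
    have "cmod (c (Suc m)) = (\<Prod>i = 0..<Suc m. cmod (a - of_nat i))"
      unfolding c_def gbinomial_mult_fact' by (rule prod_norm [symmetric])
    also have "\<dots> \<le> (\<Prod>i = 0..<Suc m. B + 1 + real m)"
    proof (rule prod_mono, safe)
      fix i assume "i \<in> {0..<Suc m}"
      then show "cmod (a - of_nat i) \<le> B + 1 + real m"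
        using na norm_triangle_ineq4[of a "of_nat i"] by simp
    qed simp
    finally show ?thesis by simp
  qed
  have "cmod (f 0 (of_real (1 / n)) - (\<Sum>j\<le>m. f j 0 * (of_real (1 / n) - 0) ^ j / fact j))
      \<le> C * cmod (of_real (1 / n) - 0) ^ Suc m / fact m"
  proof (rule complex_Taylor)
    show "convex S"
      unfolding S_def by (intro convex_linear_image bounded_linear.linear bounded_linear_of_real) auto
    show "0 \<in> S" unfolding S_def by (auto intro!: image_eqI[of _ _ 0])
    show "complex_of_real (1 / n) \<in> S"
      using assms(1) unfolding S_def by (intro imageI) auto
    show "(f j has_field_derivative f (Suc j) z) (at z within S)" if "z \<in> S" for j z
    proof -
      have "1 + z \<notin> \<real>\<^sub>\<le>\<^sub>0"
        using that unfolding S_def by (auto simp: complex_nonpos_Reals_iff)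
      then show ?thesis
        unfolding f_def
        by (auto intro!: derivative_eq_intros simp: cS algebra_simps)
    qed
    show "cmod (f (Suc m) z) \<le> C" if zS: "z \<in> S" for z
    proof -
      obtain x where x: "z = of_real x" "0 \<le> x" "x \<le> 1" using zS unfolding S_def by auto
      have eq: "1 + complex_of_real x = of_real (1 + x)" by simp
      have "cmod ((1 + z) powr (a - of_nat (Suc m))) = (1 + x) powr (Re a - Suc m)"
        unfolding x eq using x by (subst norm_powr_real_powr) auto
      also have "\<dots> \<le> (1 + x) powr (B + real m + 2)"
        using x na abs_Re_le_cmod[of a] by (intro powr_mono) auto
      also have "\<dots> \<le> 2 powr (B + real m + 2)"
        using x B by (intro powr_mono2) auto
      finally have "cmod ((1 + z) powr (a - of_nat (Suc m))) \<le> 2 powr (B + real m + 2)" .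
      with nc show ?thesis
        unfolding f_def C_def norm_mult using B by (intro mult_mono) auto
    qed
  qed
  then have T: "cmod (f 0 (of_real (1 / n)) - (\<Sum>j\<le>m. f j 0 * (of_real (1 / n)) ^ j / fact j))
      \<le> C * (1 / real n) ^ Suc m / fact m"
    by (simp add: norm_divide power_divide)
  have n0: "complex_of_nat n \<noteq> 0" using assms(1) by simp
  have e1: "of_nat n powr a * f 0 (of_real (1 / n)) = of_nat (Suc n) powr a"
  proof -
    have "complex_of_nat (Suc n) = of_real (real n) * of_real (1 + 1 / n)"
      using assms(1) by (simp add: field_simps)
    also have "\<dots> powr a = of_real (real n) powr a * of_real (1 + 1 / n) powr a"
      by (rule powr_times_real) auto
    finally show ?thesis by (simp add: f_def c_def)
  qed
  have e2: "of_nat n powr a * (f j 0 * (of_real (1 / n)) ^ j / fact j)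
      = (a gchoose j) * of_nat n powr (a - of_nat j)" for j
    using n0 by (simp add: f_def c_def powr_diff powr_nat power_divide)
  have rem: "zeta_rem m n s = of_nat n powr a *
      (f 0 (of_real (1 / n)) - (\<Sum>j\<le>m. f j 0 * (of_real (1 / n)) ^ j / fact j))"
    unfolding zeta_rem_def a_def[symmetric] right_diff_distrib e1 sum_distrib_left e2 ..
  have swap: "u * (C * v / w) = C / w * (u * v)" for u v w :: real
    by simp
  have "cmod (zeta_rem m n s) \<le> real n powr Re a * (C * (1 / real n) ^ Suc m / fact m)"
    using mult_left_mono[OF T, of "real n powr Re a"]
    by (simp only: rem norm_mult norm_of_nat_powr[OF assms(1)] powr_ge_zero simp_thms)
  also have "\<dots> = C / fact m * (real n powr Re a * (1 / real n) ^ Suc m)"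
    by (rule swap)
  also have "(1 / real n) ^ Suc m = real n powr (- real (Suc m))"
    using assms(1) by (simp only: powr_minus powr_realpow of_nat_0_less_iff power_one_over inverse_eq_divide)
  also have "real n powr Re a * real n powr (- real (Suc m)) = real n powr (- Re s - real m)"
    unfolding powr_add[symmetric] by (simp add: a_def algebra_simps)
  finally show ?thesis unfolding C_def by simp
qed

lemma summable_Suc_powr:
  assumes "e < -1"
  shows "summable (\<lambda>n. real (Suc n) powr e)"
  using assms by (subst summable_Suc_iff) (simp add: summable_real_powr_iff)

lemma zeta_rem_series:
  shows zeta_rem_holomorphic: "(\<lambda>s. \<Sum>n. zeta_rem m (Suc n) s) holomorphic_on {s. Re s > 1 - real m}"
    and zeta_rem_summable: "Re s > 1 - real m \<Longrightarrow> summable (\<lambda>n. zeta_rem m (Suc n) s)"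
proof -
  define S where "S = {s. Re s > 1 - real m}"
  have S: "open S" unfolding S_def by (rule open_halfspace_Re_gt)
  have *: "\<exists>d M. 0 < d \<and> cball x d \<subseteq> S \<and> summable M \<and>
      (\<forall>n. \<forall>s\<in>cball x d. cmod (zeta_rem m (Suc n) s) \<le> M n)" if x: "x \<in> S" for x
  proof -
    define d where "d = (Re x - (1 - real m)) / 2"
    define B where "B = cmod x + d"
    define C where "C = (B + 1 + real m) ^ Suc m * 2 powr (B + real m + 2) / fact m"
    have d: "d > 0" using x by (simp add: S_def d_def)
    then have B: "B \<ge> 0" by (simp add: B_def)
    have re: "Re s \<ge> 1 - real m + d" and nm: "cmod s \<le> B" if "s \<in> cball x d" for s
    proof -
      have "cmod (x - s) \<le> d" using that by (simp add: dist_norm)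
      with abs_Re_le_cmod[of "x - s"] show "Re s \<ge> 1 - real m + d"
        by (simp add: d_def field_simps)
      show "cmod s \<le> B"
        using \<open>cmod (x - s) \<le> d\<close> norm_triangle_sub[of s x] by (simp add: B_def norm_minus_commute)
    qed
    have "summable (\<lambda>n. C * real (Suc n) powr (- 1 - d))"
      using d by (intro summable_mult summable_Suc_powr) simp
    moreover have "cmod (zeta_rem m (Suc n) s) \<le> C * real (Suc n) powr (- 1 - d)"
      if s: "s \<in> cball x d" for n s
    proof -
      have "cmod (zeta_rem m (Suc n) s) \<le> C * real (Suc n) powr (- Re s - real m)"
        using zeta_rem_bound[of "Suc n" s B m] nm[OF s] by (simp only: C_def)
      also have "\<dots> \<le> C * real (Suc n) powr (- 1 - d)"
        using B re[OF s] by (intro mult_left_mono powr_mono) (auto simp: C_def)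
      finally show ?thesis .
    qed
    moreover have "cball x d \<subseteq> S" using re d by (force simp: S_def)
    ultimately show ?thesis using d by blast
  qed
  show "(\<lambda>s. \<Sum>n. zeta_rem m (Suc n) s) holomorphic_on {s. Re s > 1 - real m}"
    unfolding S_def[symmetric]
  proof (rule holomorphic_uniform_sequence[OF S])
    show "(\<lambda>s. \<Sum>i<n. zeta_rem m (Suc i) s) holomorphic_on S" for n
      unfolding zeta_rem_def gbinomial_prod_rev by (intro holomorphic_intros) auto
    show "\<exists>d. 0 < d \<and> cball x d \<subseteq> S \<and>
        uniform_limit (cball x d) (\<lambda>n s. \<Sum>i<n. zeta_rem m (Suc i) s)
          (\<lambda>s. \<Sum>n. zeta_rem m (Suc n) s) sequentially" if "x \<in> S" for x
      using *[OF that] by (metis Weierstrass_m_test)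
  qed
  show "summable (\<lambda>n. zeta_rem m (Suc n) s)" if "Re s > 1 - real m"
  proof -
    from that have "s \<in> S" by (simp add: S_def)
    from *[OF this] obtain d M where dM: "0 < d \<and> cball s d \<subseteq> S \<and> summable M \<and>
      (\<forall>n. \<forall>t\<in>cball s d. cmod (zeta_rem m (Suc n) t) \<le> M n)" by (elim exE) (rule that)
    then have M: "summable M" and "s \<in> cball s d" by auto
    have "cmod (zeta_rem m (Suc n) s) \<le> M n" for n
      using dM \<open>s \<in> cball s d\<close> by blast
    then show ?thesis by (rule summable_comparison_test'[OF M])
  qed
qed

lemma zeta_series_sums:
  assumes "Re s > 1"
  shows "(\<lambda>n. of_nat (Suc n) powr (- s)) sums zeta_series s"
proof -
  have "summable (\<lambda>n. complex_of_nat (Suc n) powr (- s))"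
  proof (rule summable_comparison_test')
    show "summable (\<lambda>n. real (Suc n) powr (- Re s))"
      using assms by (intro summable_Suc_powr) simp
    show "cmod (complex_of_nat (Suc n) powr (- s)) \<le> real (Suc n) powr (- Re s)" for n
      by (subst norm_of_nat_powr) auto
  qed
  then show ?thesis
    by (simp add: zeta_series_def powr_minus_divide summable_sums del: of_nat_Suc)
qed

lemma zeta_series_recurrence:
  assumes "Re s > 1" "m > 0"
  shows "(s - 1) * zeta_series s = 1 + (\<Sum>n. zeta_rem m (Suc n) s) -
     (\<Sum>j\<in>{2..m}. ((1 - s) gchoose (j - 1)) / of_nat j *
        ((s + of_nat j - 1 - 1) * zeta_series (s + of_nat j - 1)))"
proof -
  let ?g = "\<lambda>j. ((1 - s) gchoose j) * zeta_series (s + of_nat j - 1)"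
  let ?p = "\<lambda>n. of_nat (Suc n) powr (1 - s) :: complex"
  have lim: "?p \<longlonglongrightarrow> 0"
  proof (rule Lim_null_comparison)
    have "((\<lambda>x. real x powr (1 - Re s)) \<longlongrightarrow> 0) sequentially"
      using assms(1) by (intro tendsto_neg_powr filterlim_real_sequentially) auto
    then show "(\<lambda>n. real (Suc n) powr (1 - Re s)) \<longlonglongrightarrow> 0" by (rule LIMSEQ_Suc)
    show "\<forall>\<^sub>F n in sequentially. cmod (?p n) \<le> real (Suc n) powr (1 - Re s)"
      by (intro always_eventually allI) (subst norm_of_nat_powr, auto)
  qed
  have "(\<lambda>n. ?p (Suc n) - ?p n) sums (0 - ?p 0)"
    by (rule telescope_sums[OF lim])
  then have tel: "(\<lambda>n. ?p (Suc n) - ?p n) sums (- 1)" by simp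
  have g: "(\<lambda>n. ((1 - s) gchoose j) * of_nat (Suc n) powr (1 - s - of_nat j)) sums ?g j"
    if "j \<ge> 1" for j
  proof -
    have "- (s + of_nat j - 1) = 1 - s - of_nat j" by simp
    moreover have "Re (s + of_nat j - 1) > 1" using that assms(1) by simp
    ultimately have "(\<lambda>n. of_nat (Suc n) powr (1 - s - of_nat j)) sums zeta_series (s + of_nat j - 1)"
      using zeta_series_sums[of "s + of_nat j - 1"] by (simp only:)
    then show ?thesis by (rule sums_mult)
  qed
  have rem: "zeta_rem m (Suc n) s = (?p (Suc n) - ?p n) -
      (\<Sum>j\<in>{1..m}. ((1 - s) gchoose j) * of_nat (Suc n) powr (1 - s - of_nat j))" for n
  proof -
    have "{..m} = insert 0 {1..m}" by auto
    then show ?thesis unfolding zeta_rem_def by (simp del: of_nat_Suc)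
  qed
  have "(\<lambda>n. zeta_rem m (Suc n) s) sums (- 1 - (\<Sum>j\<in>{1..m}. ?g j))"
    unfolding rem by (intro sums_diff tel sums_sum g) auto
  then have A: "(\<Sum>n. zeta_rem m (Suc n) s) = - 1 - (\<Sum>j\<in>{1..m}. ?g j)"
    by (rule sums_unique[symmetric])
  have "{1..m} = insert 1 {2..m}" using assms(2) by auto
  then have "(\<Sum>j\<in>{1..m}. ?g j) = (1 - s) * zeta_series s + (\<Sum>j\<in>{2..m}. ?g j)"
    by simp
  moreover have "?g j = - (((1 - s) gchoose (j - 1)) / of_nat j *
        ((s + of_nat j - 1 - 1) * zeta_series (s + of_nat j - 1)))" if j2: "j \<in> {2..m}" for j
  proof -
    obtain i where j: "j = Suc i" using j2 by (cases j) auto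
    have "of_nat (Suc i) * ((1 - s) gchoose Suc i) = (1 - s - of_nat i) * ((1 - s) gchoose i)"
      unfolding gbinomial_absorption gbinomial_absorb_comp ..
    moreover have "v = - (u / k * (s + l - 1))" if "k * v = (1 - s - l) * u" "k \<noteq> 0" for u v k l
    proof -
      have "v = (1 - s - l) * u / k" using that by (simp add: eq_divide_eq mult_ac)
      also have "(1 - s - l) * u = - (u * (s + l - 1))" by (simp add: algebra_simps)
      finally show ?thesis by simp
    qed
    ultimately have "(1 - s) gchoose Suc i = - (((1 - s) gchoose i) / of_nat (Suc i) * (s + of_nat i - 1))"
      using of_nat_neq_0 by blast
    moreover have "s + of_nat j - 1 - 1 = s + of_nat i - 1" unfolding j by simp
    ultimately show ?thesis unfolding j by simp
  qed
  ultimately have "(\<Sum>j\<in>{1..m}. ?g j) = (1 - s) * zeta_series s -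
     (\<Sum>j\<in>{2..m}. ((1 - s) gchoose (j - 1)) / of_nat j *
        ((s + of_nat j - 1 - 1) * zeta_series (s + of_nat j - 1)))"
    by (simp add: sum_negf)
  with A have "(\<Sum>n. zeta_rem m (Suc n) s) = - 1 - ((1 - s) * zeta_series s -
     (\<Sum>j\<in>{2..m}. ((1 - s) gchoose (j - 1)) / of_nat j *
        ((s + of_nat j - 1 - 1) * zeta_series (s + of_nat j - 1))))"
    (is "?A = - 1 - ((1 - s) * ?z - ?S)") by simp
  moreover have "(s - 1) * z = 1 + (- 1 - ((1 - s) * z - S)) - S" for z S :: complex
    by (simp add: algebra_simps)
  ultimately show ?thesis by simp
qed

lemma zeta_continuation_halfplane:
  "\<exists>f. f holomorphic_on {s. Re s > 1 - real (Suc m)} \<and>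
       (\<forall>s. Re s > 1 \<longrightarrow> f s = (s - 1) * zeta_series s)"
proof (induction m)
  case 0
  show ?case
  proof (intro exI conjI allI impI)
    show "(\<lambda>s. 1 + (\<Sum>n. zeta_rem 1 (Suc n) s)) holomorphic_on {s. Re s > 1 - real (Suc 0)}"
      using zeta_rem_holomorphic[of 1] by (intro holomorphic_intros) simp
    show "1 + (\<Sum>n. zeta_rem 1 (Suc n) s) = (s - 1) * zeta_series s" if "Re s > 1" for s
      using zeta_series_recurrence[of s 1] that by simp
  qed
next
  case (Suc m)
  then obtain f where f: "f holomorphic_on {s. Re s > 1 - real (Suc m)}"
    and fs: "\<And>s. Re s > 1 \<Longrightarrow> f s = (s - 1) * zeta_series s" by blast
  let ?m = "Suc (Suc m)"
  let ?f = "\<lambda>s. 1 + (\<Sum>n. zeta_rem ?m (Suc n) s) -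
     (\<Sum>j\<in>{2..?m}. ((1 - s) gchoose (j - 1)) / of_nat j * f (s + of_nat j - 1))"
  show ?case
  proof (intro exI conjI allI impI)
    have "(\<lambda>s. f (s + of_nat j - 1)) holomorphic_on {s. Re s > 1 - real ?m}" if "j \<ge> 2" for j
    proof -
      have "f \<circ> (\<lambda>s. s + of_nat j - 1) holomorphic_on {s. Re s > 1 - real ?m}"
      proof (rule holomorphic_on_compose_gen[OF _ f])
        show "(\<lambda>s. s + of_nat j - 1) holomorphic_on {s. Re s > 1 - real ?m}"
          by (intro holomorphic_intros)
      qed (use that in auto)
      then show ?thesis by (simp add: o_def)
    qed
    then show "?f holomorphic_on {s. Re s > 1 - real ?m}"
      unfolding gbinomial_prod_rev by (intro holomorphic_intros zeta_rem_holomorphic) auto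
    show "?f s = (s - 1) * zeta_series s" if "Re s > 1" for s
    proof -
      have "(\<Sum>j\<in>{2..?m}. ((1 - s) gchoose (j - 1)) / of_nat j * f (s + of_nat j - 1)) =
        (\<Sum>j\<in>{2..?m}. ((1 - s) gchoose (j - 1)) / of_nat j *
          ((s + of_nat j - 1 - 1) * zeta_series (s + of_nat j - 1)))"
        using that by (intro sum.cong refl) (simp add: fs)
      then show ?thesis using zeta_series_recurrence[of s ?m] that by simp
    qed
  qed
qed

lemma zeta_continuation_entire:
  "\<exists>F. F holomorphic_on UNIV \<and> (\<forall>s. Re s > 1 \<longrightarrow> F s = (s - 1) * zeta_series s)"
proof -
  define H where "H = (\<lambda>m. {s. Re s > 1 - real (Suc m)})"
  obtain f where f: "\<And>m. f m holomorphic_on H m"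
    "\<And>m s. Re s > 1 \<Longrightarrow> f m s = (s - 1) * zeta_series s"
    using zeta_continuation_halfplane unfolding H_def by metis
  have opH: "open (H m)" for m unfolding H_def by (rule open_halfspace_Re_gt)
  have mono: "H m \<subseteq> H n" if "m \<le> n" for m n using that by (auto simp: H_def)
  have eq: "f m s = f n s" if "m \<le> n" "s \<in> H m" for m n s
  proof (rule analytic_continuation_open[of "{s. Re s > 1}" "H m" "f m" "f n"])
    show "open {s. Re s > 1}" by (rule open_halfspace_Re_gt)
    show "{s. Re s > 1} \<noteq> {}" by (auto intro: exI[of _ 2])
    show "connected (H m)" unfolding H_def by (intro convex_connected convex_halfspace_Re_gt)
    show "f n holomorphic_on H m" using f(1) mono[OF that(1)] holomorphic_on_subset by blast
  qed (use that f opH in \<open>auto simp: H_def\<close>)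
  define k where "k = (\<lambda>s. nat \<lceil>\<bar>Re s\<bar>\<rceil> + 1)"
  define F where "F = (\<lambda>s. f (k s) s)"
  have k: "s \<in> H (k s)" for s
    unfolding H_def k_def by simp linarith
  have F: "F s = f m s" if "s \<in> H m" for s m
    using eq[of m "k s" s] eq[of "k s" m s] that k[of s] unfolding F_def by (metis nat_le_linear)
  have "F holomorphic_on H m" for m
    using f(1)[of m] F by (metis holomorphic_cong)
  then have "F holomorphic_on (\<Union>m. H m)"
    by (intro holomorphic_on_UN_open opH)
  moreover have "(\<Union>m. H m) = UNIV" using k by auto
  ultimately show ?thesis
    using f(2) by (auto simp: F_def)
qed

text \<open>
  The value at the pole \<open>s = 1\<close> is fixed to \<open>0\<close>, as is customary for a total function.
\<close>

lemma riemann_zeta_ex1: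
  "\<exists>!f. f holomorphic_on - {1} \<and>
        (\<forall>s. Re s > 1 \<longrightarrow> f s = (\<Sum>n. 1 / of_nat (Suc n) powr s)) \<and> f 1 = 0"
proof -
  obtain F where F: "F holomorphic_on UNIV" "\<And>s. Re s > 1 \<Longrightarrow> F s = (s - 1) * zeta_series s"
    using zeta_continuation_entire by blast
  define Z where "Z = (\<lambda>s. F s / (s - 1))"
  have Z1: "Z holomorphic_on - {1}"
    unfolding Z_def using holomorphic_on_subset[OF F(1)] by (intro holomorphic_intros) auto
  have Z2: "Z s = (\<Sum>n. 1 / of_nat (Suc n) powr s)" if "Re s > 1" for s
  proof -
    have "s \<noteq> 1" using that by auto
    then show ?thesis using F(2)[OF that] by (simp add: Z_def zeta_series_def)
  qed
  have Z3: "Z 1 = 0" by (simp add: Z_def)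
  note Z = Z1 Z2 Z3
  have unique: "f s = g s"
    if "f holomorphic_on - {1}" "g holomorphic_on - {1}" "f 1 = 0" "g 1 = 0"
      "\<forall>s. Re s > 1 \<longrightarrow> f s = g s" for f g :: "complex \<Rightarrow> complex" and s
  proof (cases "s = 1")
    case False
    show ?thesis
    proof (rule analytic_continuation_open[of "{s. Re s > 1}" "- {1}" f g])
      show "open {s. Re s > 1}" by (rule open_halfspace_Re_gt)
      show "{s. Re s > 1} \<noteq> {}" by (auto intro: exI[of _ 2])
      show "connected (- {1::complex})" by (simp add: connected_punctured_universe)
    qed (use that False in auto)
  qed (use that in auto)
  show ?thesis
  proof (intro ex1I[of _ Z] conjI allI impI ext)
    fix g s
    assume "g holomorphic_on - {1} \<and>
      (\<forall>s. Re s > 1 \<longrightarrow> g s = (\<Sum>n. 1 / of_nat (Suc n) powr s)) \<and> g 1 = 0"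
    then show "g s = Z s" using Z unique[of g Z s] by auto
  qed (use Z in auto)
qed

definition riemann_zeta :: "complex \<Rightarrow> complex" where
  "riemann_zeta = (THE f. f holomorphic_on - {1} \<and>
     (\<forall>s. Re s > 1 \<longrightarrow> f s = (\<Sum>n. 1 / of_nat (Suc n) powr s)) \<and> f 1 = 0)"

lemma riemann_zeta_holomorphic: "riemann_zeta holomorphic_on - {1}"
  and riemann_zeta_series: "Re s > 1 \<Longrightarrow> riemann_zeta s = (\<Sum>n. 1 / of_nat (Suc n) powr s)"
  and riemann_zeta_1: "riemann_zeta 1 = 0"
  using theI'[OF riemann_zeta_ex1] unfolding riemann_zeta_def[symmetric] by blast+


section \<open>Nontrivial zeros and the Chebyshev function\<close>

definition nontrivial_zeros :: "complex set" where
  "nontrivial_zeros = {\<rho>. riemann_zeta \<rho> = 0 \<and> 0 < Re \<rho> \<and> Re \<rho> < 1}"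

definition chebyshev_psi :: "real \<Rightarrow> real" where
  "chebyshev_psi x = (\<Sum>n | 1 \<le> n \<and> real n \<le> x. mangoldt n)"

lemma finite_nontrivial_zeros: "finite {\<rho>\<in>nontrivial_zeros. \<bar>Im \<rho>\<bar> < T}"
proof -
  obtain F where F: "F holomorphic_on UNIV" "\<And>s. Re s > 1 \<Longrightarrow> F s = (s - 1) * zeta_series s"
    using zeta_continuation_entire by blast
  have eq: "F s = (s - 1) * riemann_zeta s" if "s \<noteq> 1" for s
  proof (rule analytic_continuation_open[of "{s. Re s > 1}" "- {1}" F "\<lambda>s. (s - 1) * riemann_zeta s"])
    show "open {s. Re s > 1}" by (rule open_halfspace_Re_gt)
    show "{s. Re s > 1} \<noteq> {}" by (auto intro: exI[of _ 2])
    show "connected (- {1::complex})" by (simp add: connected_punctured_universe)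
    show "F holomorphic_on - {1}" using F(1) by (rule holomorphic_on_subset) simp
    show "(\<lambda>s. (s - 1) * riemann_zeta s) holomorphic_on - {1}"
      by (intro holomorphic_intros riemann_zeta_holomorphic)
    show "F s = (s - 1) * riemann_zeta s" if "s \<in> {s. Re s > 1}" for s
      using that F(2)[of s] riemann_zeta_series[of s] by (simp add: zeta_series_def)
  qed (use that in auto)
  have real: "\<exists>r\<ge>1. zeta_series (of_real t) = of_real r" if "t > 1" for t
  proof -
    have r: "1 / complex_of_nat (Suc n) powr of_real t = of_real (real (Suc n) powr (- t))" for n
      by (simp add: powr_of_real[symmetric] powr_minus_divide del: of_nat_Suc)
    have sm: "summable (\<lambda>n. real (Suc n) powr (- t))"
      using that by (intro summable_Suc_powr) simp
    then have "zeta_series (of_real t) = of_real (\<Sum>n. real (Suc n) powr (- t))"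
      unfolding zeta_series_def r by (rule suminf_of_real[symmetric])
    moreover have "(\<Sum>n. real (Suc n) powr (- t)) \<ge> 1"
      using sum_le_suminf[OF sm, of "{0}"] by simp
    ultimately show ?thesis by blast
  qed
  have "\<not> F constant_on UNIV"
  proof
    assume "F constant_on UNIV"
    then have const: "F s = F 2" for s unfolding constant_on_def by auto
    obtain c where c: "c \<ge> 1" "zeta_series 2 = of_real c"
      using real[of 2] by auto
    then obtain r where r: "r \<ge> 1" "zeta_series (of_real (c + 2)) = of_real r"
      using real[of "c + 2"] by auto
    have "F (of_real (c + 2)) = of_real ((c + 1) * r)"
      using F(2)[of "of_real (c + 2)"] r(2) c(1) by simp
    moreover have "F 2 = of_real c" using F(2)[of 2] c(2) by simp
    ultimately have "complex_of_real ((c + 1) * r) = of_real c" using const by metis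
    then have "(c + 1) * r = c" using of_real_eq_iff by blast
    moreover have "(c + 1) * r \<ge> (c + 1) * 1" using r(1) c(1) by (intro mult_left_mono) auto
    ultimately show False by simp
  qed
  then have "finite {z\<in>cbox (Complex 0 (- T)) (Complex 1 T). F z = 0}"
    by (intro holomorphic_compact_finite_zeros[OF F(1)]) auto
  then show ?thesis
  proof (rule rev_finite_subset)
    have "F \<rho> = 0" if "riemann_zeta \<rho> = 0" "Re \<rho> < 1" for \<rho>
      using that eq[of \<rho>] by (cases "\<rho> = 1") auto
    then show "{\<rho>\<in>nontrivial_zeros. \<bar>Im \<rho>\<bar> < T} \<subseteq>
        {z\<in>cbox (Complex 0 (- T)) (Complex 1 T). F z = 0}"
      by (auto simp: nontrivial_zeros_def in_cbox_complex_iff)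
  qed
qed

end

theory Submission
  imports Defs "HOL-Real_Asymp.Real_Asymp"
begin

text \<open>
  Write \<open>F(s) = (s - 1) \<zeta>(s)\<close> and \<open>L = ln x\<close>. The truncated Perron formula on \<open>Re s = 1 + 1/L\<close>
  recovers \<open>\<psi>(x)\<close> from \<open>-\<zeta>'/\<zeta> = 1/(s - 1) - F'/F\<close> up to \<open>O(x L\<^sup>2 / T)\<close>. The contour is closed on
  the line \<open>Re s = -1/4\<close>, at a height \<open>U\<close> between \<open>T\<close> and \<open>T + 1\<close> that the pigeonhole principle
  keeps at distance \<open>1 / O(L)\<close> from all ordinates of zeros. On the horizontal sides \<open>F'/F\<close> is
  \<open>O(L\<^sup>2)\<close> by Landau's method: Jensen's inequality counts the zeros in a disc about \<open>2 + it\<close>, and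
  Borel-Caratheodory bounds what remains of \<open>F'/F\<close> once they are divided out. The functional
  equation keeps \<open>-1 < Re s \<le> 0\<close> free of zeros, so the left side contributes only
  \<open>O(x powr (-1/4) L\<^sup>2)\<close>. Going back from \<open>U\<close> to \<open>T\<close> costs \<open>O(L)\<close> zeros of size at most \<open>x / T\<close> each.
\<close>

section \<open>The entire function \<open>(s - 1) \<zeta>(s)\<close> by Euler--Maclaurin summation\<close>

text \<open>The target is the constant 2, so every estimate carries its constant. In the unit
  \<open>x * L^2 / T\<close> and after division by \<open>2 * pi\<close> all errors together come to
  less than 1.7; the bound \<open>L \<ge> 60\<close> turns each term of order
  \<open>x * L / T\<close> into a small multiple of that unit. One place decides the numbers. On the
  part of a horizontal side where \<open>x powr Re s\<close> has size \<open>x\<close>, a bound for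
  \<open>F'/F\<close> that charges every zero of the disc at the pigeonhole distance would by itself
  exceed the target. The side is therefore cut at \<open>Re s = 3/4\<close>: to the right only zeros
  that can really be close are charged, to the left the factor \<open>x powr (- 1/4)\<close> pays
  for the crude bound. The discs about \<open>2 + it\<close> have radius 2.9 and reach
  \<open>Re s = -9/10\<close>, which is why a formula on \<open>Re s > -1\<close> and the absence of
  zeros in \<open>-1 < Re s \<le> 0\<close> are needed and nothing further left. An entire function
  is needed because for small \<open>t\<close>, met on the left side of the contour, these discs
  contain the point 1.\<close>

text \<open>The value at 1 is the limit of \<open>(s - 1) \<zeta>(s)\<close>; the product itself
  would give 0, since \<open>riemann_zeta 1 = 0\<close> by convention.\<close>

definition zeta1 :: "complex \<Rightarrow> complex" where
  "zeta1 s = (if s = 1 then 1 else (s - 1) * riemann_zeta s)"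

text \<open>
  The error of the trapezoidal rule for \<open>(s - 1) x powr (-s)\<close> on \<open>[n, n + 1]\<close>; it is \<open>O(n powr (- Re s - 2))\<close>, which carries
  the series for \<open>(s - 1) \<zeta>(s)\<close> over to \<open>Re s > -1\<close>.
\<close>

definition em_term :: "nat \<Rightarrow> complex \<Rightarrow> complex" where
  "em_term n s = (s - 1) * (of_nat n powr (- s) + of_nat (Suc n) powr (- s)) / 2
     + of_nat (Suc n) powr (1 - s) - of_nat n powr (1 - s)"

text \<open>Let the right end of the interval move: the error on \<open>[n, n + u]\<close> vanishes
  at \<open>u = 0\<close> together with its first derivative, so Taylor's formula leaves only the
  second derivative \<open>(s - 1) s (s + 1) u / 2 (n + u) powr (- s - 2)\<close>. The hypothesis on
  \<open>Re s\<close> makes the modulus of that power non-increasing in \<open>u\<close>.\<close>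

lemma em_term_bound:
  assumes n: "n > 0" and s: "Re s \<ge> -2"
  shows "cmod (em_term n s) \<le> cmod (s - 1) * cmod s * cmod (s + 1) / 2 * real n powr (- Re s - 2)"
proof -
  define N :: complex where "N = of_nat n"
  define S where "S = (of_real ` {0..1::real} :: complex set)"
  define f where "f = (\<lambda>i u. if i = 0 then
        (s - 1) * (N powr (- s) + (N + u) powr (- s)) * u / 2 + (N + u) powr (1 - s) - N powr (1 - s)
      else if i = (1::nat) then
        (s - 1) * (N powr (- s) - (N + u) powr (- s)) / 2 - (s - 1) * s * u / 2 * (N + u) powr (- s - 1)
      else (s - 1) * s * (s + 1) * u / 2 * (N + u) powr (- s - 2))"
  define B where "B = cmod (s - 1) * cmod s * cmod (s + 1) / 2 * real n powr (- Re s - 2)"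
  have "cmod (f 0 1 - (\<Sum>i\<le>1. f i 0 * (1 - 0) ^ i / fact i)) \<le> B * cmod (1 - 0) ^ Suc 1 / fact 1"
  proof (rule complex_Taylor)
    show "convex S"
      unfolding S_def by (intro convex_linear_image bounded_linear.linear bounded_linear_of_real) auto
    show "0 \<in> S" unfolding S_def by (auto intro!: image_eqI[of _ _ 0])
    show "1 \<in> S" unfolding S_def by (auto intro!: image_eqI[of _ _ 1])
    show "(f i has_field_derivative f (Suc i) u) (at u within S)" if uS: "u \<in> S" and i1: "i \<le> 1" for i u
    proof -
      have nn: "N + u \<notin> \<real>\<^sub>\<le>\<^sub>0"
        using uS n unfolding S_def N_def by (auto simp: complex_nonpos_Reals_iff)
      have *: "((\<lambda>u. (N + u) powr a) has_field_derivative a * (N + u) powr (a - 1)) (at u within S)" for a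
        using nn by (auto intro!: derivative_eq_intros)
      consider "i = 0" | "i = 1" using i1 by linarith
      then show ?thesis
      proof cases
        case 1
        have "((\<lambda>u. (s - 1) * (N powr (- s) + (N + u) powr (- s)) * u / 2 + (N + u) powr (1 - s) - N powr (1 - s))
          has_field_derivative
            ((s - 1) * ((- s) * (N + u) powr (- s - 1)) * u / 2 + (s - 1) * (N powr (- s) + (N + u) powr (- s)) / 2
              + (1 - s) * (N + u) powr (1 - s - 1) - 0)) (at u within S)"
          by (rule * DERIV_cdivide derivative_eq_intros refl)+ (simp add: field_simps)
        then show ?thesis unfolding 1 f_def by (simp add: field_simps)
      next
        case 2
        have "((\<lambda>u. (s - 1) * (N powr (- s) - (N + u) powr (- s)) / 2 - (s - 1) * s * u / 2 * (N + u) powr (- s - 1))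
          has_field_derivative ((s - 1) * s * (s + 1) * u / 2 * (N + u) powr (- s - 2))) (at u within S)"
          by (rule * DERIV_cdivide derivative_eq_intros refl)+ (simp add: field_simps)
        then show ?thesis unfolding 2 f_def by simp
      qed
    qed
    show "cmod (f (Suc 1) u) \<le> B" if uS: "u \<in> S" for u
    proof -
      obtain x where x: "u = of_real x" "0 \<le> x" "x \<le> 1" using uS unfolding S_def by auto
      have eq: "N + complex_of_real x = of_real (real n + x)" by (simp add: N_def)
      have "cmod ((N + u) powr (- s - 2)) = (real n + x) powr (- Re s - 2)"
        unfolding x eq using x n by (subst norm_powr_real_powr) auto
      also have "\<dots> \<le> real n powr (- Re s - 2)"
        using x n s by (intro powr_mono2') auto
      finally have 1: "cmod ((N + u) powr (- s - 2)) \<le> real n powr (- Re s - 2)" .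
      have "cmod (f (Suc 1) u) = cmod (s - 1) * cmod s * cmod (s + 1) / 2 * (x * cmod ((N + u) powr (- s - 2)))"
        using x by (simp add: f_def norm_mult)
      also have "\<dots> \<le> cmod (s - 1) * cmod s * cmod (s + 1) / 2 * (1 * real n powr (- Re s - 2))"
        using 1 x by (intro mult_left_mono mult_mono) auto
      finally show ?thesis by (simp add: B_def)
    qed
  qed
  moreover have "f 0 1 = em_term n s" by (simp add: f_def em_term_def N_def add.commute)
  moreover have "(\<Sum>i\<le>1. f i 0 * (1 - 0) ^ i / fact i) = 0" by (simp add: f_def)
  ultimately show ?thesis unfolding B_def by simp
qed

lemma sum_em_term:
  "(\<Sum>n<N. em_term (Suc n) s) = (s - 1) * ((\<Sum>n<N. of_nat (Suc n) powr (- s)) - 1 / 2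
      + of_nat (Suc N) powr (- s) / 2) + of_nat (Suc N) powr (1 - s) - 1"
proof (induction N)
  case (Suc N)
  show ?case
    unfolding sum.lessThan_Suc Suc.IH unfolding em_term_def
    by (simp add: algebra_simps add_divide_distrib diff_divide_distrib del: of_nat_Suc)
qed (simp add: field_simps)

lemma of_nat_powr_tendsto_0:
  assumes "Re a < 0"
  shows "(\<lambda>n. of_nat (Suc n) powr a :: complex) \<longlonglongrightarrow> 0"
proof (rule Lim_null_comparison)
  have "((\<lambda>x. real x powr (Re a)) \<longlongrightarrow> 0) sequentially"
    using assms(1) by (intro tendsto_neg_powr filterlim_real_sequentially) auto
  then show "(\<lambda>n. real (Suc n) powr Re a) \<longlonglongrightarrow> 0" by (rule LIMSEQ_Suc)
  show "\<forall>\<^sub>F n in sequentially. cmod (of_nat (Suc n) powr a) \<le> real (Suc n) powr (Re a)"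
    by (intro always_eventually allI) (subst norm_of_nat_powr, auto)
qed

lemma em_term_series:
  shows em_term_holomorphic: "(\<lambda>s. \<Sum>n. em_term (Suc n) s) holomorphic_on {s. Re s > -1}"
    and em_term_summable: "Re s > -1 \<Longrightarrow> summable (\<lambda>n. em_term (Suc n) s)"
proof -
  define S where "S = {s. Re s > -1}"
  have S: "open S" unfolding S_def by (rule open_halfspace_Re_gt)
  have *: "\<exists>d M. 0 < d \<and> cball x d \<subseteq> S \<and> summable M \<and>
      (\<forall>n. \<forall>s\<in>cball x d. cmod (em_term (Suc n) s) \<le> M n)" if x: "x \<in> S" for x
  proof -
    define d where "d = (Re x + 1) / 2"
    define B where "B = cmod x + d + 1"
    define C where "C = B * B * B / 2"
    have d: "d > 0" using x by (simp add: S_def d_def)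
    then have B: "B \<ge> 0" by (simp add: B_def)
    have re: "Re s \<ge> -1 + d" and nm: "cmod s \<le> B" "cmod (s - 1) \<le> B" "cmod (s + 1) \<le> B" if "s \<in> cball x d" for s
    proof -
      have "cmod (x - s) \<le> d" using that by (simp add: dist_norm)
      with abs_Re_le_cmod[of "x - s"] show "Re s \<ge> -1 + d"
        by (simp add: d_def field_simps)
      have "cmod s \<le> cmod x + d"
        using \<open>cmod (x - s) \<le> d\<close> norm_triangle_sub[of s x] by (simp add: norm_minus_commute)
      with norm_triangle_ineq4[of s 1] norm_triangle_ineq[of s 1]
      show "cmod s \<le> B" "cmod (s - 1) \<le> B" "cmod (s + 1) \<le> B" by (simp_all add: B_def)
    qed
    have "summable (\<lambda>n. C * real (Suc n) powr (- 1 - d))"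
      using d by (intro summable_mult summable_Suc_powr) simp
    moreover have "cmod (em_term (Suc n) s) \<le> C * real (Suc n) powr (- 1 - d)"
      if s: "s \<in> cball x d" for n s
    proof -
      have "cmod (em_term (Suc n) s) \<le> cmod (s - 1) * cmod s * cmod (s + 1) / 2 * real (Suc n) powr (- Re s - 2)"
        using re[OF s] d by (intro em_term_bound) auto
      also have "\<dots> \<le> C * real (Suc n) powr (- Re s - 2)"
        unfolding C_def using nm[OF s] B by (intro mult_right_mono divide_right_mono mult_mono) auto
      also have "\<dots> \<le> C * real (Suc n) powr (- 1 - d)"
        using B re[OF s] by (intro mult_left_mono powr_mono) (auto simp: C_def)
      finally show ?thesis .
    qed
    moreover have "cball x d \<subseteq> S" using re d by (force simp: S_def)
    ultimately show ?thesis using d by blast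
  qed
  show "(\<lambda>s. \<Sum>n. em_term (Suc n) s) holomorphic_on {s. Re s > -1}"
    unfolding S_def[symmetric]
  proof (rule holomorphic_uniform_sequence[OF S])
    show "(\<lambda>s. \<Sum>i<n. em_term (Suc i) s) holomorphic_on S" for n
      unfolding em_term_def by (intro holomorphic_intros) auto
    show "\<exists>d. 0 < d \<and> cball x d \<subseteq> S \<and>
        uniform_limit (cball x d) (\<lambda>n s. \<Sum>i<n. em_term (Suc i) s)
          (\<lambda>s. \<Sum>n. em_term (Suc n) s) sequentially" if "x \<in> S" for x
      using *[OF that] by (metis Weierstrass_m_test)
  qed
  show "summable (\<lambda>n. em_term (Suc n) s)" if "Re s > -1"
  proof -
    from that have "s \<in> S" by (simp add: S_def)
    from *[OF this] obtain d M where dM: "0 < d \<and> cball s d \<subseteq> S \<and> summable M \<and>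
      (\<forall>n. \<forall>t\<in>cball s d. cmod (em_term (Suc n) t) \<le> M n)" by (elim exE) (rule that)
    then have M: "summable M" and "s \<in> cball s d" by auto
    have "cmod (em_term (Suc n) s) \<le> M n" for n
      using dM \<open>s \<in> cball s d\<close> by blast
    then show ?thesis by (rule summable_comparison_test'[OF M])
  qed
qed

lemma em_term_sums_Re_gt_1:
  assumes "Re s > 1"
  shows "(\<lambda>n. em_term (Suc n) s) sums ((s - 1) * (zeta_series s - 1 / 2) - 1)"
proof -
  have "(\<lambda>N. (s - 1) * ((\<Sum>n<N. of_nat (Suc n) powr (- s)) - 1 / 2
      + of_nat (Suc N) powr (- s) / 2) + of_nat (Suc N) powr (1 - s) - 1)
      \<longlonglongrightarrow> (s - 1) * (zeta_series s - 1 / 2 + 0 / 2) + 0 - 1"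
    using zeta_series_sums[OF assms] assms unfolding sums_def
    by (intro tendsto_intros of_nat_powr_tendsto_0) auto
  then show ?thesis unfolding sums_def sum_em_term by simp
qed

lemma zeta1_holomorphic_UNIV: "zeta1 holomorphic_on UNIV"
  and zeta1_em: "Re s > -1 \<Longrightarrow> (\<lambda>n. em_term (Suc n) s) sums (zeta1 s - 1 - (s - 1) / 2)"
proof -
  obtain F where F: "F holomorphic_on UNIV" "\<And>s. Re s > 1 \<Longrightarrow> F s = (s - 1) * zeta_series s"
    using zeta_continuation_entire by blast
  have eq: "F s = (s - 1) * riemann_zeta s" if "s \<noteq> 1" for s
  proof (rule analytic_continuation_open[of "{s. Re s > 1}" "- {1}" F "\<lambda>s. (s - 1) * riemann_zeta s"])
    show "open {s. Re s > 1}" by (rule open_halfspace_Re_gt)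
    show "{s. Re s > 1} \<noteq> {}" by (auto intro: exI[of _ 2])
    show "connected (- {1::complex})" by (simp add: connected_punctured_universe)
    show "F holomorphic_on - {1}" using F(1) by (rule holomorphic_on_subset) simp
    show "(\<lambda>s. (s - 1) * riemann_zeta s) holomorphic_on - {1}"
      by (intro holomorphic_intros riemann_zeta_holomorphic)
    show "F s = (s - 1) * riemann_zeta s" if "s \<in> {s. Re s > 1}" for s
      using that F(2)[of s] riemann_zeta_series[of s] by (simp add: zeta_series_def)
  qed (use that in auto)
  have E: "F s = (\<Sum>n. em_term (Suc n) s) + 1 + (s - 1) / 2" if "Re s > -1" for s
  proof (rule analytic_continuation_open[of "{s. Re s > 1}" "{s. Re s > -1}" F "\<lambda>s. (\<Sum>n. em_term (Suc n) s) + 1 + (s - 1) / 2"])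
    show "open {s. Re s > 1}" "open {s. Re s > - 1}" by (rule open_halfspace_Re_gt)+
    show "{s. Re s > 1} \<noteq> {}" by (auto intro: exI[of _ 2])
    show "connected {s. Re s > - 1}" by (intro convex_connected convex_halfspace_Re_gt)
    show "F holomorphic_on {s. Re s > - 1}" using F(1) by (rule holomorphic_on_subset) simp
    show "(\<lambda>s. (\<Sum>n. em_term (Suc n) s) + 1 + (s - 1) / 2) holomorphic_on {s. Re s > - 1}"
      by (intro holomorphic_intros em_term_holomorphic) auto
    show "F s = (\<Sum>n. em_term (Suc n) s) + 1 + (s - 1) / 2" if "s \<in> {s. Re s > 1}" for s
      using that sums_unique[OF em_term_sums_Re_gt_1[of s]] F(2)[of s]
      by (simp add: algebra_simps diff_divide_distrib)
  qed (use that in auto)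
  \<comment> \<open>The series thus fixes the value of the entire function at 1, where the product
    with \<open>riemann_zeta\<close> says nothing.\<close>
  have "em_term (Suc n) 1 = 0" for n by (simp add: em_term_def del: of_nat_Suc)
  then have "F 1 = 1" using E[of 1] by simp
  then have zF: "zeta1 = F" using eq by (auto simp: zeta1_def)
  show "zeta1 holomorphic_on UNIV" using F zF by simp
  show "Re s > -1 \<Longrightarrow> (\<lambda>n. em_term (Suc n) s) sums (zeta1 s - 1 - (s - 1) / 2)"
    using E[of s] summable_sums[OF em_term_summable[of s]] zF by simp
qed

lemma zeta1_holomorphic [holomorphic_intros]:
  "f holomorphic_on A \<Longrightarrow> (\<lambda>s. zeta1 (f s)) holomorphic_on A"
  using holomorphic_on_compose_gen[OF _ zeta1_holomorphic_UNIV, of f A] by (auto simp: o_def)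

lemma zeta1_1 [simp]: "zeta1 1 = 1" by (simp add: zeta1_def)

text \<open>At \<open>s = 0\<close> the trapezoidal rule is applied to a constant and is exact, so
  every term of the series vanishes. The value enters the residue of the integrand at 0.\<close>

lemma zeta1_0 [simp]: "zeta1 0 = 1 / 2"
proof -
  have "em_term (Suc n) 0 = 0" for n by (simp add: em_term_def del: of_nat_Suc) simp
  then have "(\<lambda>n. em_term (Suc n) 0) sums 0" by simp
  then have "zeta1 0 - 1 - (0 - 1) / 2 = 0" using zeta1_em[of 0] sums_unique2 by fastforce
  then show ?thesis by simp
qed

lemma cnj_of_nat_powr: "cnj (of_nat n powr a) = of_nat n powr (cnj a)"
  by (cases "n = 0") (simp_all add: powr_def exp_cnj Ln_of_nat)

lemma cnj_em_term: "cnj (em_term (Suc n) s) = em_term (Suc n) (cnj s)"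
  unfolding em_term_def complex_cnj_add complex_cnj_diff complex_cnj_mult complex_cnj_divide
    cnj_of_nat_powr by (simp del: of_nat_Suc)

text \<open>Makes the zeros symmetric about the real axis, so that an ordinate kept away from the
  zeros near \<open>T\<close> is also good near \<open>-T\<close>.\<close>

lemma zeta1_cnj:
  assumes "Re s > -1" shows "zeta1 (cnj s) = cnj (zeta1 s)"
proof -
  have "(\<lambda>n. em_term (Suc n) (cnj s)) sums (zeta1 (cnj s) - 1 - (cnj s - 1) / 2)"
    using assms by (intro zeta1_em) auto
  moreover have "(\<lambda>n. em_term (Suc n) (cnj s)) sums cnj (zeta1 s - 1 - (s - 1) / 2)"
    using zeta1_em[OF assms] unfolding cnj_em_term[symmetric] sums_cnj .
  ultimately have "zeta1 (cnj s) - 1 - (cnj s - 1) / 2 = cnj (zeta1 s - 1 - (s - 1) / 2)"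
    by (rule sums_unique2)
  then show ?thesis by simp
qed

section \<open>Explicit upper and lower bounds for \<open>zeta1\<close>\<close>

text \<open>Integral test: by the mean value theorem each term is at most the drop of the
  antiderivative \<open>g\<close> over the unit interval to its left, and these drops
  telescope.\<close>

lemma powr_tail_sum_le:
  assumes "p > 1" "a > 0"
  shows "(\<Sum>n. real (n + a + 1) powr (- p)) \<le> real a powr (1 - p) / (p - 1)"
proof -
  define g where "g = (\<lambda>n. real (n + a) powr (1 - p) / (p - 1))"
  have gl: "g \<longlonglongrightarrow> 0" unfolding g_def using assms by real_asymp
  have s: "(\<lambda>n. g n - g (Suc n)) sums (g 0 - 0)" by (rule telescope_sums'[OF gl])
  have le: "real (n + a + 1) powr (- p) \<le> g n - g (Suc n)" for n
  proof -
    define b where "b = real (n + a)"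
    have b: "b > 0" using assms by (simp add: b_def)
    have D: "((\<lambda>z. z powr (1 - p) / (p - 1)) has_real_derivative - (z powr (- p))) (at z)" if "z > 0" for z
    proof -
      have "((\<lambda>z. z powr (1 - p) / (p - 1)) has_real_derivative (1 - p) * z powr (1 - p - 1) / (p - 1)) (at z)"
        using that by (intro DERIV_cdivide has_real_derivative_powr)
      moreover have "(1 - p) * w / (p - 1) = - w" for w
        using assms by (simp add: divide_simps) (simp add: algebra_simps)
      ultimately show ?thesis by simp
    qed
    have "\<exists>z>b. z < b + 1 \<and> (b + 1) powr (1 - p) / (p - 1) - b powr (1 - p) / (p - 1) = (b + 1 - b) * (- (z powr (- p)))"
      using b by (intro MVT2 D) auto
    then obtain z where z: "z > b" "z < b + 1"
      "b powr (1 - p) / (p - 1) - (b + 1) powr (1 - p) / (p - 1) = z powr (- p)" by (auto simp: algebra_simps)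
    have "(b + 1) powr (- p) \<le> z powr (- p)" using z b assms by (intro powr_mono2') auto
    then show ?thesis using z(3) by (simp add: g_def b_def add.commute algebra_simps)
  qed
  have "summable (\<lambda>n. real (n + a + 1) powr (- p))"
    by (rule summable_comparison_test'[OF sums_summable[OF s]]) (use le in auto)
  then have "(\<Sum>n. real (n + a + 1) powr (- p)) \<le> (\<Sum>n. g n - g (Suc n))"
    by (intro suminf_le le sums_summable[OF s])
  then show ?thesis using sums_unique[OF s] by (simp add: g_def)
qed

lemma powr_sum_le:
  assumes "p > 1"
  shows "(\<Sum>n. real (Suc n) powr (- p)) \<le> p / (p - 1)"
proof -
  have "summable (\<lambda>n. real (Suc n) powr (- p))" using assms by (intro summable_Suc_powr) simp
  from suminf_split_head[OF this] have "(\<Sum>n. real (Suc n) powr (- p)) = 1 + (\<Sum>n. real (n + 1 + 1) powr (- p))"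
    by (simp add: add.commute)
  also have "\<dots> \<le> 1 + real 1 powr (1 - p) / (p - 1)"
    using powr_tail_sum_le[OF assms, of 1] by simp
  finally show ?thesis using assms by (simp add: field_simps)
qed

text \<open>The termwise bounds of the Euler-Maclaurin series are summed. The parameter
  \<open>p\<close> trades the width of the half-plane against the factor
  \<open>p / (p - 1)\<close>.\<close>

lemma zeta1_bound:
  assumes "Re s \<ge> p - 2" "p > 1"
  shows "cmod (zeta1 s) \<le> 1 + cmod (s - 1) / 2 + cmod (s - 1) * cmod s * cmod (s + 1) / 2 * (p / (p - 1))"
proof -
  let ?C = "cmod (s - 1) * cmod s * cmod (s + 1) / 2"
  have sm: "summable (\<lambda>n. ?C * real (Suc n) powr (- p))"
    using assms by (intro summable_mult summable_Suc_powr) simp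
  have le: "cmod (em_term (Suc n) s) \<le> ?C * real (Suc n) powr (- p)" for n
  proof -
    have "cmod (em_term (Suc n) s) \<le> ?C * real (Suc n) powr (- Re s - 2)"
      using assms by (intro em_term_bound) auto
    also have "\<dots> \<le> ?C * real (Suc n) powr (- p)"
      using assms by (intro mult_left_mono powr_mono) auto
    finally show ?thesis .
  qed
  have "(\<Sum>n. em_term (Suc n) s) = zeta1 s - 1 - (s - 1) / 2"
    using zeta1_em[of s] assms by (simp add: sums_iff)
  then have "cmod (zeta1 s - 1 - (s - 1) / 2) \<le> (\<Sum>n. ?C * real (Suc n) powr (- p))"
    using norm_suminf_le[OF le sm] by metis
  also have "\<dots> = ?C * (\<Sum>n. real (Suc n) powr (- p))"
    using assms by (intro suminf_mult summable_Suc_powr) simp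
  also have "\<dots> \<le> ?C * (p / (p - 1))"
    using assms by (intro mult_left_mono powr_sum_le) auto
  finally have "cmod (zeta1 s - 1 - (s - 1) / 2) \<le> ?C * (p / (p - 1))" .
  moreover have "cmod (zeta1 s) \<le> cmod (zeta1 s - 1 - (s - 1) / 2) + cmod (1 + (s - 1) / 2)"
    using norm_triangle_ineq[of "zeta1 s - 1 - (s - 1) / 2" "1 + (s - 1) / 2"] by (simp add: algebra_simps)
  moreover have "cmod (1 + (s - 1) / 2) \<le> 1 + cmod (s - 1) / 2"
    using norm_triangle_ineq[of 1 "(s - 1) / 2"] by (simp add: norm_divide)
  ultimately show ?thesis by linarith
qed

lemma riemann_zeta_sums:
  assumes "Re s > 1" shows "(\<lambda>n. of_nat (Suc n) powr (- s)) sums riemann_zeta s"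
  using zeta_series_sums[OF assms] riemann_zeta_series[OF assms] by (simp add: zeta_series_def)

lemma zeta1_eq: "s \<noteq> 1 \<Longrightarrow> zeta1 s = (s - 1) * riemann_zeta s"
  by (simp add: zeta1_def)

text \<open>The first term 1 outweighs the second, of modulus 1/4, and the tail, of modulus at most
  1/2.\<close>

lemma norm_zeta_2: "cmod (riemann_zeta (Complex 2 t)) \<ge> 1 / 4"
proof -
  let ?f = "\<lambda>n. of_nat (Suc n) powr (- Complex 2 t) :: complex"
  have s: "?f sums riemann_zeta (Complex 2 t)" by (rule riemann_zeta_sums) simp
  have nf: "norm (?f n) = real (Suc n) powr (- 2)" for n by (subst norm_of_nat_powr) auto
  have "(\<lambda>n. ?f (n + 2)) sums (riemann_zeta (Complex 2 t) - (\<Sum>i<2. ?f i))"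
    using s by (rule sums_split_initial_segment)
  then have "riemann_zeta (Complex 2 t) = 1 + ?f 1 + (\<Sum>n. ?f (n + 2))"
    by (simp add: sums_iff eval_nat_numeral)
  moreover have "cmod (\<Sum>n. ?f (n + 2)) \<le> (\<Sum>n. real (n + 2 + 1) powr (- 2))"
  proof (rule norm_suminf_le)
    show "summable (\<lambda>n. real (n + 2 + 1) powr (- 2))"
      using summable_ignore_initial_segment[OF summable_Suc_powr[of "-2"], of 2] by simp
  qed (use nf[of "_ + 2"] in \<open>simp add: add_ac\<close>)
  moreover have "(\<Sum>n. real (n + 2 + 1) powr (- 2)) \<le> 1 / 2"
    using powr_tail_sum_le[of 2 2] by (simp add: powr_minus)
  moreover have "cmod (?f 1) = 1 / 4" using nf[of 1] by (simp add: powr_minus)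
  moreover have "cmod 1 \<le> cmod (1 + ?f 1 + (\<Sum>n. ?f (n + 2))) + (cmod (?f 1) + cmod (\<Sum>n. ?f (n + 2)))"
    using norm_triangle_ineq4[of "1 + ?f 1 + (\<Sum>n. ?f (n + 2))" "?f 1 + (\<Sum>n. ?f (n + 2))"]
      norm_triangle_ineq[of "?f 1" "(\<Sum>n. ?f (n + 2))"] by (simp add: algebra_simps)
  ultimately show ?thesis by simp
qed

text \<open>The form \<open>\<bar>t\<bar> + 6\<close> matches the upper bound on the disc, where one
  power of it is to cancel. The 36 is 9, from comparing with \<open>cmod (s - 1)\<close>, times 4,
  from \<open>norm_zeta_2\<close>.\<close>

lemma norm_zeta1_2: "cmod (zeta1 (Complex 2 t)) \<ge> (\<bar>t\<bar> + 6) / 36"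
proof -
  have ne: "Complex 2 t \<noteq> 1" by (auto simp: complex_eq_iff)
  have "(\<bar>t\<bar> + 6)\<^sup>2 \<le> (9 * cmod (Complex 2 t - 1))\<^sup>2"
  proof -
    have "(9 * cmod (Complex 2 t - 1))\<^sup>2 = 81 * (1 + t\<^sup>2)"
      by (simp add: power_mult_distrib cmod_power2)
    moreover have "(\<bar>t\<bar> + 6)\<^sup>2 \<le> 81 * (1 + t\<^sup>2)"
    proof -
      have "0 \<le> (\<bar>t\<bar> - 1)\<^sup>2 * 6" by simp
      then have "12 * \<bar>t\<bar> \<le> 6 + 6 * t\<^sup>2" by (simp add: power2_eq_square algebra_simps)
      moreover have "(\<bar>t\<bar> + 6)\<^sup>2 = t\<^sup>2 + 12 * \<bar>t\<bar> + 36" by (simp add: power2_eq_square algebra_simps)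
      moreover have "0 \<le> t\<^sup>2" by simp
      ultimately show ?thesis by (simp only: distrib_left)
    qed
    ultimately show ?thesis by simp
  qed
  then have "\<bar>t\<bar> + 6 \<le> 9 * cmod (Complex 2 t - 1)" by (rule power2_le_imp_le) simp
  then have "(\<bar>t\<bar> + 6) / 9 * (1 / 4) \<le> cmod (Complex 2 t - 1) * cmod (riemann_zeta (Complex 2 t))"
    using norm_zeta_2 by (intro mult_mono) auto
  then show ?thesis using ne by (simp add: zeta1_eq norm_mult)
qed

text \<open>Radius 29/10 keeps the disc in \<open>Re s \<ge> -9/10\<close>, so
  \<open>p = 11/10\<close> is allowed and \<open>p / (p - 1) = 11\<close>. The resulting bound is
  cubic in \<open>\<bar>t\<bar> + 6\<close>; the lower bound at the centre absorbs one power, and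
  the exponent 2 that remains governs all later zero counts.\<close>

lemma zeta1_disc_bound:
  assumes "cmod (s - Complex 2 t) \<le> 29 / 10"
  shows "cmod (zeta1 s) \<le> 216 * (\<bar>t\<bar> + 6)\<^sup>2 * cmod (zeta1 (Complex 2 t))"
proof -
  define \<tau> where "\<tau> = \<bar>t\<bar> + 6"
  have "cmod (Complex 2 t) \<le> \<bar>t\<bar> + 2" using cmod_le[of "Complex 2 t"] by simp
  then have 1: "cmod s \<le> \<tau> - 1" using norm_triangle_sub[of s "Complex 2 t"] assms by (simp add: \<tau>_def)
  have 2: "cmod (s - 1) \<le> \<tau>" "cmod (s + 1) \<le> \<tau>"
    using 1 norm_triangle_ineq4[of s 1] norm_triangle_ineq[of s 1] by simp_all
  have re: "Re s \<ge> 11 / 10 - 2" using assms abs_Re_le_cmod[of "s - Complex 2 t"] by simp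
  have \<tau>: "\<tau> \<ge> 6" by (simp add: \<tau>_def)
  have "cmod (zeta1 s) \<le> 1 + cmod (s - 1) / 2 + cmod (s - 1) * cmod s * cmod (s + 1) / 2 * ((11/10) / (11/10 - 1))"
    using re by (intro zeta1_bound) auto
  also have "\<dots> \<le> 1 + \<tau> / 2 + \<tau> * \<tau> * \<tau> / 2 * ((11/10) / (11/10 - 1))"
    using 1 2 \<tau> by (intro add_mono mult_mono divide_right_mono) auto
  also have "\<dots> \<le> 6 * \<tau> ^ 3"
  proof -
    have "6 * 6 \<le> \<tau> * \<tau>" using \<tau> by (intro mult_mono) auto
    then have "36 * \<tau> \<le> \<tau> * \<tau> * \<tau>" using \<tau> by (simp add: mult_right_mono)
    moreover have "\<tau> ^ 3 = \<tau> * \<tau> * \<tau>" by (simp add: power3_eq_cube)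
    moreover have "(11/10) / (11/10 - 1) = (11::real)" by simp
    moreover have "1 + \<tau> / 2 + v * 11 / 2 \<le> 6 * v" if "36 * \<tau> \<le> v" for v
      using that \<tau> by simp
    ultimately show ?thesis by simp
  qed
  also have "6 * \<tau> ^ 3 = 216 * \<tau>\<^sup>2 * (\<tau> / 36)" by (simp add: power3_eq_cube power2_eq_square)
  also have "\<dots> \<le> 216 * \<tau>\<^sup>2 * cmod (zeta1 (Complex 2 t))"
    using norm_zeta1_2[of t] by (intro mult_left_mono) (auto simp: \<tau>_def)
  finally show ?thesis by (simp add: \<tau>_def)
qed

section \<open>Zeros and logarithmic derivatives in discs\<close>

lemma has_field_derivative_prod_power:
  fixes p :: "'i \<Rightarrow> complex \<Rightarrow> complex"
  assumes "finite Z" "\<And>i. i \<in> Z \<Longrightarrow> (p i has_field_derivative p' i) (at z)" "\<And>i. i \<in> Z \<Longrightarrow> p i z \<noteq> 0"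
  shows "((\<lambda>z. \<Prod>i\<in>Z. p i z ^ m i) has_field_derivative
           (\<Prod>i\<in>Z. p i z ^ m i) * (\<Sum>i\<in>Z. of_nat (m i) * p' i / p i z)) (at z)"
  using assms
proof (induction Z rule: finite_induct)
  case (insert j Z)
  let ?P = "\<lambda>z. \<Prod>i\<in>Z. p i z ^ m i" and ?S = "\<Sum>i\<in>Z. of_nat (m i) * p' i / p i z"
  have nz: "p j z \<noteq> 0" using insert.prems by auto
  have "((\<lambda>z. p j z ^ m j) has_field_derivative of_nat (m j) * (p' j * p j z ^ (m j - Suc 0))) (at z)"
    using insert.prems(1)[of j] by (intro DERIV_power) auto
  moreover have "of_nat (m j) * (p' j * p j z ^ (m j - Suc 0)) = p j z ^ m j * (of_nat (m j) * p' j / p j z)"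
    using nz by (cases "m j") (auto simp: field_simps)
  ultimately have "((\<lambda>z. p j z ^ m j) has_field_derivative p j z ^ m j * (of_nat (m j) * p' j / p j z)) (at z)"
    by simp
  moreover have "(?P has_field_derivative ?P z * ?S) (at z)" using insert by auto
  ultimately have "((\<lambda>z. p j z ^ m j * ?P z) has_field_derivative
      (p j z ^ m j * (of_nat (m j) * p' j / p j z)) * ?P z + (?P z * ?S) * p j z ^ m j) (at z)"
    by (rule DERIV_mult)
  then show ?case using insert.hyps by (simp add: algebra_simps)
qed simp

text \<open>The map \<open>H / (2 A - H)\<close> sends the half-plane \<open>Re H < A\<close> into
  the unit disc and 0 to 0, so Schwarz's lemma bounds \<open>H\<close> itself by
  \<open>2 A d / (R - d)\<close> on the disc of radius \<open>d\<close>. Cauchy's inequality on a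
  circle of radius \<open>(R - r) / 2\<close>, which stays within \<open>(R + r) / 2\<close> of the
  centre, then bounds the derivative.\<close>

lemma Borel_Caratheodory_deriv:
  fixes H :: "complex \<Rightarrow> complex"
  assumes H: "H holomorphic_on ball c R" and "H c = 0" and A: "A > 0"
    and Re: "\<And>z. z \<in> ball c R \<Longrightarrow> Re (H z) < A"
    and r: "0 \<le> r" "r < R" and z: "cmod (z - c) \<le> r"
  shows "cmod (deriv H z) \<le> 4 * A * (R + r) / (R - r)\<^sup>2"
proof -
  define w where "w = (\<lambda>\<zeta>. H (c + of_real R * \<zeta>) / (2 * of_real A - H (c + of_real R * \<zeta>)))"
  have R: "R > 0" using r by simp
  have inb: "c + of_real R * \<zeta> \<in> ball c R" if "cmod \<zeta> < 1" for \<zeta>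
    using that R by (simp add: dist_norm norm_mult)
  have nz: "2 * of_real A - H y \<noteq> 0" if "y \<in> ball c R" for y
    using Re[OF that] A by (auto simp: complex_eq_iff)
  have lt: "cmod (H y) < cmod (2 * of_real A - H y)" if "y \<in> ball c R" for y
  proof -
    have "(cmod (2 * of_real A - H y))\<^sup>2 - (cmod (H y))\<^sup>2 = 4 * A * (A - Re (H y))"
      by (simp only: cmod_power2) (simp add: power2_eq_square algebra_simps)
    also have "\<dots> > 0" using Re[OF that] A by simp
    finally have "(cmod (H y))\<^sup>2 < (cmod (2 * of_real A - H y))\<^sup>2" by simp
    then show ?thesis by (rule power_less_imp_less_base) simp
  qed
  have bd: "cmod (H y) \<le> 2 * A * d / (R - d)" if "cmod (y - c) \<le> d" "d < R" for y d
  proof -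
    define \<zeta> where "\<zeta> = (y - c) / of_real R"
    have y: "y = c + of_real R * \<zeta>" using R by (simp add: \<zeta>_def)
    have \<zeta>: "cmod \<zeta> = cmod (y - c) / R" using R by (simp add: \<zeta>_def norm_divide)
    have \<zeta>1: "cmod \<zeta> < 1" using that R by (simp add: \<zeta>)
    have "cmod (w \<zeta>) \<le> cmod \<zeta>"
    proof (rule Schwarz_Lemma)
      have "(\<lambda>\<zeta>. H (c + of_real R * \<zeta>)) holomorphic_on ball 0 1"
        by (rule holomorphic_on_compose_gen[OF _ H, unfolded o_def])
           (use inb in \<open>auto intro!: holomorphic_intros\<close>)
      then show "w holomorphic_on ball 0 1"
        unfolding w_def using nz inb by (intro holomorphic_intros) auto
      show "w 0 = 0" using assms by (simp add: w_def)
      show "cmod (w x) < 1" if "cmod x < 1" for x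
        using lt[OF inb[OF that]] by (auto simp: w_def norm_divide divide_simps)
      show "cmod \<zeta> < 1" by fact
    qed
    then have "cmod (H y) \<le> cmod \<zeta> * cmod (2 * of_real A - H y)"
      using lt[OF inb[OF \<zeta>1]] unfolding y by (auto simp: w_def norm_divide divide_simps split: if_splits)
    also have "\<dots> \<le> cmod \<zeta> * (2 * A + cmod (H y))"
      using A norm_triangle_ineq4[of "2 * of_real A" "H y"] by (intro mult_left_mono) (auto simp: norm_mult)
    also have "\<dots> \<le> d / R * (2 * A + cmod (H y))"
      using that A R by (intro mult_right_mono) (auto simp: \<zeta> divide_right_mono)
    finally show ?thesis using that R by (simp add: field_simps)
  qed
  define \<delta> where "\<delta> = (R - r) / 2"
  have \<delta>: "\<delta> > 0" using r by (simp add: \<delta>_def)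
  have sub: "cball z \<delta> \<subseteq> ball c R"
  proof
    fix y assume "y \<in> cball z \<delta>"
    then have "cmod (y - z) \<le> \<delta>" by (simp add: dist_norm norm_minus_commute)
    then have "cmod (y - c) \<le> \<delta> + r" using norm_triangle_ineq[of "y - z" "z - c"] z by simp
    then show "y \<in> ball c R" using r by (simp add: dist_norm norm_minus_commute \<delta>_def field_simps)
  qed
  have "norm ((deriv ^^ 1) H z) \<le> fact 1 * (2 * A * ((R + r) / 2) / (R - (R + r) / 2)) / \<delta> ^ 1"
  proof (rule Cauchy_inequality)
    show "H holomorphic_on ball z \<delta>" using H sub by (meson ball_subset_cball holomorphic_on_subset subset_trans)
    show "continuous_on (cball z \<delta>) H"
      using H sub by (meson holomorphic_on_imp_continuous_on holomorphic_on_subset)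
    show "0 < \<delta>" by fact
    fix y assume "norm (z - y) = \<delta>"
    then have "cmod (y - c) \<le> \<delta> + r" using norm_triangle_ineq[of "y - z" "z - c"] z by (simp add: norm_minus_commute)
    also have "\<dots> = (R + r) / 2" by (simp add: \<delta>_def field_simps)
    finally show "cmod (H y) \<le> 2 * A * ((R + r) / 2) / (R - (R + r) / 2)"
      using r by (intro bd) auto
  qed
  also have "fact 1 * (2 * A * ((R + r) / 2) / (R - (R + r) / 2)) / \<delta> ^ 1 = 4 * A * (R + r) / (R - r)\<^sup>2"
  proof -
    have "R - (R + r) / 2 = (R - r) / 2" by (simp add: field_simps)
    then show ?thesis unfolding \<delta>_def by (simp only:) (simp add: power2_eq_square)
  qed
  finally show ?thesis by simp
qed

definition zeros_in :: "(complex \<Rightarrow> complex) \<Rightarrow> complex \<Rightarrow> real \<Rightarrow> complex set" where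
  "zeros_in f c r = {\<rho>. cmod (\<rho> - c) \<le> r \<and> f \<rho> = 0}"

lemma finite_zeros_in:
  assumes "f holomorphic_on UNIV" "f c \<noteq> 0"
  shows "finite (zeros_in f c r)"
proof -
  have eq: "zeros_in f c r = {z \<in> cball c r. f z = 0}"
    by (auto simp: zeros_in_def dist_norm norm_minus_commute)
  show ?thesis
  proof (cases "f constant_on UNIV")
    case True
    then have "f z \<noteq> 0" for z using assms(2) by (auto simp: constant_on_def)
    then show ?thesis by (auto simp: zeros_in_def)
  next
    case False
    show ?thesis unfolding eq
      by (rule holomorphic_compact_finite_zeros[OF assms(1)]) (use False in auto)
  qed
qed

text \<open>All zeros in the open disc of radius \<open>R\<close> are divided out; the factors of
  those outside the closed disc of radius \<open>r\<close> are then given back to \<open>g\<close>.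
  Hence \<open>g\<close> is zero-free only on the smaller disc.\<close>

lemma zero_factorization:
  assumes f: "f holomorphic_on UNIV" "f c \<noteq> 0" and "r < R" "0 \<le> r"
  obtains g where "g holomorphic_on ball c R"
    "\<And>z. z \<in> ball c R \<Longrightarrow> f z = (\<Prod>\<rho>\<in>zeros_in f c r. (z - \<rho>) ^ nat (zorder f \<rho>)) * g z"
    "\<And>z. z \<in> cball c r \<Longrightarrow> g z \<noteq> 0"
proof -
  define Z where "Z = {z \<in> ball c R. f z = 0}"
  define m where "m = (\<lambda>\<rho>. nat (zorder f \<rho>))"
  have fin: "finite Z"
    by (rule finite_subset[OF _ finite_zeros_in[OF f, of R]])
       (auto simp: Z_def zeros_in_def dist_norm norm_minus_commute)
  have zp: "(if f z = 0 then zorder f z > 0 else zorder f z = 0)" for z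
    using zorder_exist_zero[OF f(1) open_UNIV connected_UNIV UNIV_I bexI[of _ c], of z] f(2) by auto
  define P where "P = (\<lambda>z. \<Prod>\<rho>\<in>Z. (z - \<rho>) ^ m \<rho>)"
  have Phol: "P holomorphic_on A" for A unfolding P_def by (intro holomorphic_intros)
  have P0: "P z = 0 \<longleftrightarrow> f z = 0" if "z \<in> ball c R" for z
    using fin zp[of z] that by (auto simp: P_def m_def Z_def split: if_splits)
  have Pz: "zorder P z = zorder f z" if "z \<in> ball c R" for z
  proof (rule zorder_eqI[of UNIV _ "\<lambda>w. \<Prod>\<rho>\<in>Z - {z}. (w - \<rho>) ^ m \<rho>"])
    show "(\<lambda>w. \<Prod>\<rho>\<in>Z - {z}. (w - \<rho>) ^ m \<rho>) holomorphic_on UNIV" by (intro holomorphic_intros)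
    show "(\<Prod>\<rho>\<in>Z - {z}. (z - \<rho>) ^ m \<rho>) \<noteq> 0" using fin by auto
    show "P w = (\<Prod>\<rho>\<in>Z - {z}. (w - \<rho>) ^ m \<rho>) * (w - z) powi (zorder f z)" if "w \<noteq> z" for w
    proof (cases "z \<in> Z")
      case True
      then have "zorder f z > 0" using zp[of z] by (auto simp: Z_def)
      then have "(w - z) powi (zorder f z) = (w - z) ^ m z" by (simp add: m_def power_int_def)
      then show ?thesis unfolding P_def using prod.remove[OF fin True, of "\<lambda>\<rho>. (w - \<rho>) ^ m \<rho>"] by simp
    next
      case False
      then have "zorder f z = 0" using zp[of z] \<open>z \<in> ball c R\<close> by (auto simp: Z_def)
      with False show ?thesis by (simp add: P_def)
    qed
  qed auto
  obtain h where h: "h holomorphic_on ball c R" "\<And>z. z \<in> ball c R \<Longrightarrow> h z \<noteq> 0"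
    "\<And>z. z \<in> ball c R \<Longrightarrow> f z = h z * P z"
    using holomorphic_zorder_factorization[OF holomorphic_on_subset[OF f(1) subset_UNIV] open_ball connected_ball Phol P0 Pz]
    by blast
  define Z1 where "Z1 = zeros_in f c r"
  have Z1: "Z1 \<subseteq> Z" using assms by (auto simp: Z1_def Z_def zeros_in_def dist_norm norm_minus_commute)
  show ?thesis
  proof
    show "(\<lambda>z. (\<Prod>\<rho>\<in>Z - Z1. (z - \<rho>) ^ m \<rho>) * h z) holomorphic_on ball c R"
      using h by (intro holomorphic_intros)
    show "f z = (\<Prod>\<rho>\<in>zeros_in f c r. (z - \<rho>) ^ nat (zorder f \<rho>)) * ((\<Prod>\<rho>\<in>Z - Z1. (z - \<rho>) ^ m \<rho>) * h z)"
      if "z \<in> ball c R" for z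
      using h(3)[OF that] prod.subset_diff[OF Z1 fin, of "\<lambda>\<rho>. (z - \<rho>) ^ m \<rho>"]
      unfolding P_def by (simp add: Z1_def m_def mult_ac)
    show "(\<Prod>\<rho>\<in>Z - Z1. (z - \<rho>) ^ m \<rho>) * h z \<noteq> 0" if "z \<in> cball c r" for z
    proof -
      have "z \<notin> Z - Z1" using that by (auto simp: Z1_def Z_def zeros_in_def dist_norm norm_minus_commute)
      moreover have "h z \<noteq> 0" using that assms by (intro h(2)) auto
      ultimately show ?thesis using fin by auto
    qed
  qed
qed

text \<open>Normalised by the value at the centre, \<open>A\<close> is the only quantity that the
  zero count and the logarithmic derivative depend on. The strict inequality becomes the strict
  bound on the real part in Borel-Caratheodory.\<close>

locale growth_disc =
  fixes f :: "complex \<Rightarrow> complex" and c :: complex and R A :: real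
  assumes hol: "f holomorphic_on UNIV" and nz: "f c \<noteq> 0" and R: "R > 0"
    and growth: "\<And>z. cmod (z - c) = R \<Longrightarrow> cmod (f z) < exp A * cmod (f c)"
begin

text \<open>
  Replacing each factor \<open>z - \<rho>\<close> of \<open>f\<close> by \<open>(R\<^sup>2 - cnj (\<rho> - c) (z - c)) / R\<close> removes the zeros in the
  smaller disc without changing \<open>|f|\<close> on the circle \<open>|z - c| = R\<close>.
\<close>

lemma blaschke:
  assumes r: "0 < r" "r < R"
  defines "Z \<equiv> zeros_in f c r" and "m \<equiv> \<lambda>\<rho>. nat (zorder f \<rho>)"
  obtains k where "k holomorphic_on cball c R"
    "\<And>z. z \<in> cball c r \<Longrightarrow> k z \<noteq> 0"
    "\<And>z. z \<in> cball c R \<Longrightarrow> cmod (k z) < exp A * cmod (f c)"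
    "cmod (k c) = cmod (f c) * (\<Prod>\<rho>\<in>Z. (R / cmod (\<rho> - c)) ^ m \<rho>)"
    "\<And>z. cmod (z - c) < r \<Longrightarrow> f z \<noteq> 0 \<Longrightarrow> deriv k z / k z =
      deriv f z / f z - (\<Sum>\<rho>\<in>Z. of_nat (m \<rho>) / (z - \<rho>)) - (\<Sum>\<rho>\<in>Z. of_nat (m \<rho>) * cnj (\<rho> - c) / (of_real (R\<^sup>2) - cnj (\<rho> - c) * (z - c)))"
proof -
  have finZ: "finite Z" unfolding Z_def by (rule finite_zeros_in[OF hol nz])
  \<comment> \<open>Radius \<open>R + 1\<close> makes the factorization valid on a neighbourhood of
    the closed disc of radius \<open>R\<close>.\<close>
  obtain g where g: "g holomorphic_on ball c (R + 1)"
    "\<And>z. z \<in> ball c (R + 1) \<Longrightarrow> f z = (\<Prod>\<rho>\<in>Z. (z - \<rho>) ^ m \<rho>) * g z"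
    "\<And>z. z \<in> cball c r \<Longrightarrow> g z \<noteq> 0"
    using zero_factorization[OF hol nz, of r "R + 1"] r unfolding Z_def m_def by auto
  define b where "b = (\<lambda>\<rho> z. (of_real (R\<^sup>2) - cnj (\<rho> - c) * (z - c)) / of_real R)"
  define k where "k = (\<lambda>z. g z * (\<Prod>\<rho>\<in>Z. b \<rho> z ^ m \<rho>))"
  have Zr: "cmod (\<rho> - c) \<le> r" if "\<rho> \<in> Z" for \<rho> using that by (simp add: Z_def zeros_in_def)
  have Zc: "\<rho> \<noteq> c" if "\<rho> \<in> Z" for \<rho> using that nz by (auto simp: Z_def zeros_in_def)
  \<comment> \<open>The new factor vanishes only at the reflection of \<open>\<rho>\<close> in the
    circle, which lies outside the closed disc because
    \<open>cmod (\<rho> - c) \<le> r < R\<close>.\<close>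
  have bnz: "of_real (R\<^sup>2) - cnj (\<rho> - c) * (z - c) \<noteq> 0" if "\<rho> \<in> Z" "cmod (z - c) \<le> R" for \<rho> z
  proof
    assume "of_real (R\<^sup>2) - cnj (\<rho> - c) * (z - c) = 0"
    then have "cmod (of_real (R\<^sup>2)) = cmod (cnj (\<rho> - c) * (z - c))" by simp
    then have "R\<^sup>2 = cmod (\<rho> - c) * cmod (z - c)" by (simp add: norm_mult norm_power del: complex_cnj_diff)
    also have "\<dots> \<le> r * R" using Zr[OF that(1)] that r by (intro mult_mono) auto
    also have "\<dots> < R * R" using r by simp
    finally show False by (simp add: power2_eq_square)
  qed
  have bb: "b \<rho> z \<noteq> 0" if "\<rho> \<in> Z" "cmod (z - c) \<le> R" for \<rho> z
    using bnz[OF that] R by (simp add: b_def)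
  have kb: "k holomorphic_on ball c (R + 1)"
    unfolding k_def b_def using R by (intro holomorphic_intros g) auto
  have kR: "k holomorphic_on cball c R"
    using kb by (rule holomorphic_on_subset) auto
  have sphere: "cmod (k z) = cmod (f z)" if z: "cmod (z - c) = R" for z
  proof -
    have "cmod (b \<rho> z) = cmod (z - \<rho>)" for \<rho>
    proof -
      have "of_real (R\<^sup>2) = (z - c) * cnj (z - c)" using z by (simp only: complex_norm_square[symmetric])
      then have "b \<rho> z = (z - c) * cnj (z - \<rho>) / of_real R" by (simp add: b_def algebra_simps)
      then show ?thesis using z R by (simp add: norm_mult norm_divide del: complex_cnj_diff)
    qed
    then have "cmod (k z) = cmod ((\<Prod>\<rho>\<in>Z. (z - \<rho>) ^ m \<rho>) * g z)"
      by (simp add: k_def norm_mult norm_power flip: prod_norm)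
    then show ?thesis using g(2)[of z] z by (simp add: dist_norm norm_minus_commute)
  qed
  show ?thesis
  proof (rule that[of k])
    show "k holomorphic_on cball c R" by fact
    show "k z \<noteq> 0" if "z \<in> cball c r" for z
      using that g(3)[OF that] bb[of _ z] r finZ by (auto simp: k_def dist_norm norm_minus_commute)
    show "cmod (k z) < exp A * cmod (f c)" if z: "z \<in> cball c R" for z
    proof -
      \<comment> \<open>Growth is known on the circle only. The maximum principle carries it inside,
        and comparing with a point \<open>w\<close> where the maximum is attained keeps the
        inequality strict.\<close>
      have "compact (sphere c R)" "sphere c R \<noteq> {}" using R by auto
      moreover have "continuous_on (sphere c R) (\<lambda>z. cmod (k z))"
        using kR by (intro continuous_intros holomorphic_on_imp_continuous_on)
           (auto intro: holomorphic_on_subset)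
      ultimately obtain w where w: "w \<in> sphere c R" "\<And>z. z \<in> sphere c R \<Longrightarrow> cmod (k z) \<le> cmod (k w)"
        using continuous_attains_sup[of "sphere c R" "\<lambda>z. cmod (k z)"] by blast
      have "cmod (k z) \<le> cmod (k w)"
      proof (rule maximum_modulus_frontier[of k "cball c R"])
        show "k holomorphic_on interior (cball c R)" using kR by (rule holomorphic_on_subset) auto
        show "continuous_on (closure (cball c R)) k" using kR holomorphic_on_imp_continuous_on by auto
        show "cmod (k z) \<le> cmod (k w)" if "z \<in> frontier (cball c R)" for z
          using that R w(2)[of z] by (simp add: frontier_cball)
      qed (use z in auto)
      also have "\<dots> < exp A * cmod (f c)"
        using w(1) sphere[of w] growth[of w] by (simp add: dist_norm norm_minus_commute)
      finally show ?thesis .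
    qed
    show "cmod (k c) = cmod (f c) * (\<Prod>\<rho>\<in>Z. (R / cmod (\<rho> - c)) ^ m \<rho>)"
    proof -
      have "cmod (k c) = cmod (g c) * (\<Prod>\<rho>\<in>Z. R ^ m \<rho>)"
        using R by (simp add: k_def b_def norm_mult norm_power power2_eq_square flip: prod_norm)
      moreover have "cmod (f c) = cmod (g c) * (\<Prod>\<rho>\<in>Z. cmod (\<rho> - c) ^ m \<rho>)"
        using g(2)[of c] R by (simp add: norm_mult norm_power norm_minus_commute flip: prod_norm)
      moreover have "(\<Prod>\<rho>\<in>Z. cmod (\<rho> - c) ^ m \<rho>) * (\<Prod>\<rho>\<in>Z. (R / cmod (\<rho> - c)) ^ m \<rho>) = (\<Prod>\<rho>\<in>Z. R ^ m \<rho>)"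
        unfolding prod.distrib[symmetric] using Zc by (intro prod.cong) (auto simp flip: power_mult_distrib)
      ultimately show ?thesis by (simp add: mult.assoc)
    qed
    show "deriv k z / k z = deriv f z / f z - (\<Sum>\<rho>\<in>Z. of_nat (m \<rho>) / (z - \<rho>)) -
        (\<Sum>\<rho>\<in>Z. of_nat (m \<rho>) * cnj (\<rho> - c) / (of_real (R\<^sup>2) - cnj (\<rho> - c) * (z - c)))"
      if z: "cmod (z - c) < r" "f z \<noteq> 0" for z
    proof -
      define P where "P = (\<lambda>z. \<Prod>\<rho>\<in>Z. (z - \<rho>) ^ m \<rho>)"
      define B where "B = (\<lambda>z. \<Prod>\<rho>\<in>Z. b \<rho> z ^ m \<rho>)"
      define S1 where "S1 = (\<Sum>\<rho>\<in>Z. of_nat (m \<rho>) * 1 / (z - \<rho>))"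
      define S2 where "S2 = (\<Sum>\<rho>\<in>Z. of_nat (m \<rho>) * (- cnj (\<rho> - c) / of_real R) / b \<rho> z)"
      have zb: "z \<in> ball c (R + 1)" using z r by (simp add: dist_norm norm_minus_commute)
      have gz: "g z \<noteq> 0" using z g(2)[OF zb] by auto
      have Pz: "P z \<noteq> 0" using z g(2)[OF zb] by (auto simp: P_def)
      have Bz: "B z \<noteq> 0" using bb[of _ z] z r finZ by (auto simp: B_def)
      have zZ: "z - \<rho> \<noteq> 0" if "\<rho> \<in> Z" for \<rho> using that z by (auto simp: Z_def zeros_in_def)
      have dP: "(P has_field_derivative P z * S1) (at z)"
        unfolding P_def S1_def using zZ
        by (intro has_field_derivative_prod_power finZ) (auto intro!: derivative_eq_intros)
      have dB: "(B has_field_derivative B z * S2) (at z)"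
        unfolding B_def S2_def using bb[of _ z] z r R
        by (intro has_field_derivative_prod_power finZ) (auto simp: b_def intro!: derivative_eq_intros)
      have dg: "(g has_field_derivative deriv g z) (at z)"
        using g(1) zb by (intro holomorphic_derivI) auto
      have "((\<lambda>z. P z * g z) has_field_derivative (P z * S1 * g z + deriv g z * P z)) (at z)"
        by (rule DERIV_mult[OF dP dg])
      then have "(f has_field_derivative (P z * S1 * g z + deriv g z * P z)) (at z)"
        by (rule has_field_derivative_transform_within_open[OF _ _ zb]) (use g(2) in \<open>auto simp: P_def\<close>)
      then have df: "deriv f z = P z * S1 * g z + deriv g z * P z" by (rule DERIV_imp_deriv)
      have "((\<lambda>z. g z * B z) has_field_derivative (deriv g z * B z + B z * S2 * g z)) (at z)"
        by (rule DERIV_mult[OF dg dB])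
      then have dk: "deriv k z = deriv g z * B z + B z * S2 * g z"
        unfolding k_def B_def by (rule DERIV_imp_deriv)
      have fz: "f z = P z * g z" using g(2)[OF zb] by (simp add: P_def)
      have kz: "k z = g z * B z" by (simp add: k_def B_def)
      have "deriv k z / k z = deriv f z / f z - S1 + S2"
        unfolding dk df fz kz using gz Pz Bz by (simp add: field_simps)
      moreover have "S2 = - (\<Sum>\<rho>\<in>Z. of_nat (m \<rho>) * cnj (\<rho> - c) / (of_real (R\<^sup>2) - cnj (\<rho> - c) * (z - c)))"
        unfolding S2_def b_def sum_negf[symmetric] using R by (intro sum.cong refl) (simp del: complex_cnj_diff)
      ultimately show ?thesis by (simp add: S1_def)
    qed
  qed
qed

text \<open>Jensen's inequality: at the centre the modified function is larger than \<open>f\<close>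
  by a factor \<open>R / cmod (\<rho> - c)\<close>, at least \<open>R / r\<close>, for each zero,
  yet it is still bounded by \<open>exp A * cmod (f c)\<close>.\<close>

lemma zero_count:
  assumes r: "0 < r" "r < R"
  shows "(\<Sum>\<rho>\<in>zeros_in f c r. real (nat (zorder f \<rho>))) * ln (R / r) \<le> A"
proof -
  let ?Z = "zeros_in f c r" and ?m = "\<lambda>\<rho>. nat (zorder f \<rho>)"
  obtain k where k: "k holomorphic_on cball c R" "\<And>z. z \<in> cball c r \<Longrightarrow> k z \<noteq> 0"
    "\<And>z. z \<in> cball c R \<Longrightarrow> cmod (k z) < exp A * cmod (f c)"
    "cmod (k c) = cmod (f c) * (\<Prod>\<rho>\<in>?Z. (R / cmod (\<rho> - c)) ^ ?m \<rho>)"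
    and k5: "\<And>z. cmod (z - c) < r \<Longrightarrow> f z \<noteq> 0 \<Longrightarrow> deriv k z / k z =
      deriv f z / f z - (\<Sum>\<rho>\<in>?Z. of_nat (?m \<rho>) / (z - \<rho>)) - (\<Sum>\<rho>\<in>?Z. of_nat (?m \<rho>) * cnj (\<rho> - c) / (of_real (R\<^sup>2) - cnj (\<rho> - c) * (z - c)))"
    by (rule blaschke[OF r], rule that)
  have "(\<Prod>\<rho>\<in>?Z. (R / r) ^ ?m \<rho>) \<le> (\<Prod>\<rho>\<in>?Z. (R / cmod (\<rho> - c)) ^ ?m \<rho>)"
  proof (rule prod_mono, safe)
    fix \<rho> assume \<rho>: "\<rho> \<in> ?Z"
    then have "cmod (\<rho> - c) > 0" using nz by (auto simp: zeros_in_def)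
    then show "(R / r) ^ ?m \<rho> \<le> (R / cmod (\<rho> - c)) ^ ?m \<rho>"
      using \<rho> r by (intro power_mono divide_left_mono) (auto simp: zeros_in_def)
  qed (use r in auto)
  also have "\<dots> = cmod (k c) / cmod (f c)" using k(4) nz by simp
  also have "\<dots> \<le> exp A" using k(3)[of c] R nz by (simp add: field_simps)
  finally have "(R / r) ^ (\<Sum>\<rho>\<in>?Z. ?m \<rho>) \<le> exp A" by (simp add: power_sum)
  then have "ln ((R / r) ^ (\<Sum>\<rho>\<in>?Z. ?m \<rho>)) \<le> ln (exp A)"
    using r by (intro ln_mono) auto
  then show ?thesis using r by (simp add: ln_realpow)
qed

text \<open>Landau's method: the modified function \<open>k\<close> has no zeros within
  \<open>r1\<close>, so it has a logarithm there, and Borel-Caratheodory bounds \<open>k'/k\<close>.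
  Passing back to \<open>f\<close> costs \<open>1 / cmod (z - \<rho>)\<close> for each removed
  factor and at most \<open>r1 / (R\<^sup>2 - r1 * r)\<close> for each factor that replaced
  it.\<close>

lemma logderiv_bound:
  assumes r: "0 \<le> r" "r < r1" "r1 < R" and z: "cmod (z - c) \<le> r" and fz: "f z \<noteq> 0"
  shows "cmod (deriv f z / f z) \<le> 4 * A * (r1 + r) / (r1 - r)\<^sup>2 +
    (\<Sum>\<rho>\<in>zeros_in f c r1. real (nat (zorder f \<rho>)) * (1 / cmod (z - \<rho>) + r1 / (R\<^sup>2 - r1 * r)))"
proof -
  let ?Z = "zeros_in f c r1" and ?m = "\<lambda>\<rho>. nat (zorder f \<rho>)"
  have r1: "0 < r1" using r by simp
  let ?S1 = "\<Sum>\<rho>\<in>?Z. of_nat (?m \<rho>) / (z - \<rho>)"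
  let ?S2 = "\<Sum>\<rho>\<in>?Z. of_nat (?m \<rho>) * cnj (\<rho> - c) / (of_real (R\<^sup>2) - cnj (\<rho> - c) * (z - c))"
  obtain k where k: "k holomorphic_on cball c R" "\<And>z. z \<in> cball c r1 \<Longrightarrow> k z \<noteq> 0"
    "\<And>z. z \<in> cball c R \<Longrightarrow> cmod (k z) < exp A * cmod (f c)"
    "cmod (k c) = cmod (f c) * (\<Prod>\<rho>\<in>?Z. (R / cmod (\<rho> - c)) ^ ?m \<rho>)"
    and k5: "\<And>z. cmod (z - c) < r1 \<Longrightarrow> f z \<noteq> 0 \<Longrightarrow> deriv k z / k z =
      deriv f z / f z - (\<Sum>\<rho>\<in>?Z. of_nat (?m \<rho>) / (z - \<rho>)) - (\<Sum>\<rho>\<in>?Z. of_nat (?m \<rho>) * cnj (\<rho> - c) / (of_real (R\<^sup>2) - cnj (\<rho> - c) * (z - c)))"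
    by (rule blaschke[OF r1 r(3)], rule that)
  \<comment> \<open>This is what lets the growth relative to \<open>f c\<close> count as growth
    relative to \<open>k c\<close>, so that the logarithm, normalised to 0 at the centre, has real
    part below \<open>A\<close>.\<close>
  have kc: "cmod (f c) \<le> cmod (k c)"
  proof -
    have "(\<Prod>\<rho>\<in>?Z. (R / cmod (\<rho> - c)) ^ ?m \<rho>) \<ge> 1"
    proof (rule prod_ge_1)
      fix \<rho> assume \<rho>: "\<rho> \<in> ?Z"
      then have "cmod (\<rho> - c) > 0" using nz by (auto simp: zeros_in_def)
      then show "1 \<le> (R / cmod (\<rho> - c)) ^ ?m \<rho>"
        using \<rho> r by (intro one_le_power) (auto simp: zeros_in_def divide_simps)
    qed
    then show ?thesis unfolding k(4) using mult_left_mono[of 1 _ "cmod (f c)"] by simp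
  qed
  have kb: "k holomorphic_on ball c r1" using k(1) r by (auto intro: holomorphic_on_subset)
  have knz: "k z \<noteq> 0" if "z \<in> ball c r1" for z using k(2)[of z] that by auto
  have "(\<lambda>z. deriv k z / k z) holomorphic_on ball c r1"
    using knz kb by (intro holomorphic_intros) auto
  then obtain H0 where H0: "\<And>z. z \<in> ball c r1 \<Longrightarrow> (H0 has_field_derivative deriv k z / k z) (at z)"
    using holomorphic_convex_primitive'[of "ball c r1" "\<lambda>z. deriv k z / k z"]
    by (metis at_within_open convex_ball open_ball)
  define H where "H = (\<lambda>z. H0 z - H0 c)"
  have H: "(H has_field_derivative deriv k z / k z) (at z)" if "z \<in> ball c r1" for z
    unfolding H_def using H0[OF that] by (auto intro!: derivative_eq_intros)
  have kH: "k z = k c * exp (H z)" if zb: "z \<in> ball c r1" for z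
  proof -
    have "\<exists>d. \<forall>z\<in>ball c r1. k z * exp (- H z) = d"
    proof (rule has_field_derivative_zero_constant)
      fix w assume w: "w \<in> ball c r1"
      have "(k has_field_derivative deriv k w) (at w)"
        using kb w by (intro holomorphic_derivI) auto
      then have "((\<lambda>z. k z * exp (- H z)) has_field_derivative
          deriv k w * exp (- H w) + k w * (exp (- H w) * (- (deriv k w / k w)))) (at w)"
        using H[OF w] by (auto intro!: derivative_eq_intros)
      then show "((\<lambda>z. k z * exp (- H z)) has_field_derivative 0) (at w within ball c r1)"
        using knz[OF w] by (simp add: has_field_derivative_at_within)
    qed auto
    then obtain d where d: "\<And>z. z \<in> ball c r1 \<Longrightarrow> k z * exp (- H z) = d" by blast
    have "d = k c" using d[of c] r1 by (simp add: H_def)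
    with d[OF zb] show ?thesis by (simp add: exp_minus field_simps)
  qed
  have ReH: "Re (H w) < A" if w: "w \<in> ball c r1" for w
  proof -
    have "cmod (k c) * exp (Re (H w)) = cmod (k w)" by (simp add: kH[OF w] norm_mult)
    also have "\<dots> < exp A * cmod (f c)" using w r by (intro k(3)) auto
    also have "\<dots> \<le> exp A * cmod (k c)" using kc by simp
    finally have "exp (Re (H w)) < exp A"
      using k(2)[of c] r1 by (simp add: mult.commute)
    then show ?thesis by simp
  qed
  have A0: "A > 0" using ReH[of c] r1 by (simp add: H_def)
  have zb: "z \<in> ball c r1" using z r by (simp add: dist_norm norm_minus_commute)
  have "cmod (deriv H z) \<le> 4 * A * (r1 + r) / (r1 - r)\<^sup>2"
  proof (rule Borel_Caratheodory_deriv)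
    show "H holomorphic_on ball c r1" unfolding holomorphic_on_open[OF open_ball] using H by blast
  qed (use ReH A0 r z in \<open>auto simp: H_def\<close>)
  moreover have "deriv H z = deriv k z / k z" by (rule DERIV_imp_deriv[OF H[OF zb]])
  ultimately have 1: "cmod (deriv f z / f z - ?S1 - ?S2) \<le> 4 * A * (r1 + r) / (r1 - r)\<^sup>2"
    using k5[of z] z r fz by simp
  have 2: "cmod ?S1 \<le> (\<Sum>\<rho>\<in>?Z. real (?m \<rho>) * (1 / cmod (z - \<rho>)))"
    by (rule sum_norm_le) (simp add: norm_divide)
  have 3: "cmod ?S2 \<le> (\<Sum>\<rho>\<in>?Z. real (?m \<rho>) * (r1 / (R\<^sup>2 - r1 * r)))"
  proof (rule sum_norm_le)
    fix \<rho> assume "\<rho> \<in> ?Z"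
    then have \<rho>: "cmod (\<rho> - c) \<le> r1" by (simp add: zeros_in_def)
    have "r1 * r \<le> r1 * r1" "r1 * r1 < R * R" using r by (auto intro: mult_left_mono mult_strict_mono)
    then have pos: "R\<^sup>2 - r1 * r > 0" by (simp add: power2_eq_square)
    have "cmod (cnj (\<rho> - c) * (z - c)) \<le> r1 * r"
      unfolding norm_mult complex_mod_cnj using \<rho> z r by (intro mult_mono) auto
    then have "R\<^sup>2 - r1 * r \<le> cmod (of_real (R\<^sup>2) - cnj (\<rho> - c) * (z - c))"
      using norm_triangle_ineq2[of "of_real (R\<^sup>2)" "cnj (\<rho> - c) * (z - c)"] by (simp add: norm_power)
    then have "cmod (\<rho> - c) / cmod (of_real (R\<^sup>2) - cnj (\<rho> - c) * (z - c)) \<le> r1 / (R\<^sup>2 - r1 * r)"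
      using pos \<rho> r by (intro frac_le) auto
    then show "cmod (of_nat (?m \<rho>) * cnj (\<rho> - c) / (of_real (R\<^sup>2) - cnj (\<rho> - c) * (z - c)))
        \<le> real (?m \<rho>) * (r1 / (R\<^sup>2 - r1 * r))"
      unfolding norm_mult norm_divide complex_mod_cnj norm_of_nat times_divide_eq_right[symmetric]
      by (rule mult_left_mono) simp
  qed
  have "cmod (deriv f z / f z) \<le> cmod (deriv f z / f z - ?S1 - ?S2) + (cmod ?S1 + cmod ?S2)"
    using norm_triangle_ineq[of "deriv f z / f z - ?S1 - ?S2" "?S1 + ?S2"] norm_triangle_ineq[of ?S1 ?S2] by simp
  also have "\<dots> \<le> 4 * A * (r1 + r) / (r1 - r)\<^sup>2 + (\<Sum>\<rho>\<in>?Z. real (?m \<rho>) * (1 / cmod (z - \<rho>) + r1 / (R\<^sup>2 - r1 * r)))"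
    using 1 2 3 by (simp add: distrib_left sum.distrib)
  finally show ?thesis .
qed

end

section \<open>Contour integrals and the Perron kernel\<close>

text \<open>Supremum times length would lose a logarithm: on horizontal sides the factor
  \<open>1 / ln x\<close> gained by integrating \<open>x powr \<sigma>\<close>, on the left side the
  difference between \<open>ln U\<close> and \<open>U\<close>.\<close>

lemma contour_integral_linepath_bound_antideriv:
  fixes f :: "complex \<Rightarrow> complex" and G g :: "real \<Rightarrow> real"
  assumes cont: "continuous_on (closed_segment a b) f"
    and G: "\<And>t. t \<in> {0..1} \<Longrightarrow> (G has_real_derivative g t) (at t within {0..1})"
    and le: "\<And>t. t \<in> {0..1} \<Longrightarrow> cmod (f (linepath a b t)) * cmod (b - a) \<le> g t"
  shows "cmod (contour_integral (linepath a b) f) \<le> G 1 - G 0"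
proof -
  have gi: "(g has_integral G 1 - G 0) {0..1}"
    using G by (intro fundamental_theorem_of_calculus) (auto simp: has_real_derivative_iff_has_vector_derivative[symmetric])
  have "(f has_contour_integral contour_integral (linepath a b) f) (linepath a b)"
    by (intro has_contour_integral_integral contour_integrable_continuous_linepath cont)
  then have fi: "((\<lambda>t. f (linepath a b t) * (b - a)) has_integral contour_integral (linepath a b) f) {0..1}"
    by (simp add: has_contour_integral_linepath)
  have "norm (integral {0..1} (\<lambda>t. f (linepath a b t) * (b - a))) \<le> integral {0..1} g"
    using fi gi le by (intro integral_norm_bound_integral) (auto simp: norm_mult)
  then show ?thesis unfolding integral_unique[OF fi] integral_unique[OF gi] .
qed

lemma contour_integral_horizontal_bound:
  assumes cont: "continuous_on (closed_segment (Complex a t) (Complex b t)) f"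
    and "a \<le> b" "y > 0" "y \<noteq> 1"
    and le: "\<And>\<sigma>. \<sigma> \<in> {a..b} \<Longrightarrow> cmod (f (Complex \<sigma> t)) \<le> C * y powr \<sigma>"
  shows "cmod (contour_integral (linepath (Complex a t) (Complex b t)) f) \<le> C * ((y powr b - y powr a) / ln y)"
proof -
  have ly: "ln y \<noteq> 0" using assms by simp
  have "cmod (contour_integral (linepath (Complex a t) (Complex b t)) f)
      \<le> C * y powr (a + 1 * (b - a)) / ln y - C * y powr (a + 0 * (b - a)) / ln y"
  proof (rule contour_integral_linepath_bound_antideriv[OF cont,
      where G = "\<lambda>t. C * y powr (a + t * (b - a)) / ln y" and g = "\<lambda>t. C * y powr (a + t * (b - a)) * (b - a)"])
    fix u :: real assume u: "u \<in> {0..1}"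
    show "((\<lambda>t. C * y powr (a + t * (b - a)) / ln y) has_real_derivative C * y powr (a + u * (b - a)) * (b - a)) (at u within {0..1})"
    proof -
      have "y powr z = exp (z * ln y)" for z using assms by (simp add: powr_def)
      then show ?thesis using ly by (auto intro!: derivative_eq_intros)
    qed
    have "linepath (Complex a t) (Complex b t) u = Complex (a + u * (b - a)) t"
      by (simp add: linepath_def complex_eq_iff algebra_simps)
    moreover have "a + u * (b - a) \<in> {a..b}" using u assms mult_left_le_one_le[of "b - a" u] by auto
    moreover have "Complex b t - Complex a t = of_real (b - a)" by (simp add: complex_eq_iff)
    then have "cmod (Complex b t - Complex a t) = b - a" using assms by (simp only: norm_of_real)
    ultimately show "cmod (f (linepath (Complex a t) (Complex b t) u)) * cmod (Complex b t - Complex a t)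
        \<le> C * y powr (a + u * (b - a)) * (b - a)"
      using le assms(2) by (simp add: mult_right_mono)
  qed
  then show ?thesis by (simp add: right_diff_distrib diff_divide_distrib)
qed

lemma contour_integral_rectpath:
  assumes cont: "continuous_on (path_image (rectpath (Complex a s) (Complex b t))) f" and "a \<le> b" "s \<le> t"
  shows "contour_integral (rectpath (Complex a s) (Complex b t)) f =
     contour_integral (linepath (Complex a s) (Complex b s)) f + contour_integral (linepath (Complex b s) (Complex b t)) f
     - contour_integral (linepath (Complex a t) (Complex b t)) f - contour_integral (linepath (Complex a s) (Complex a t)) f"
proof -
  have seg: "f contour_integrable_on linepath p q"
    if "closed_segment p q \<subseteq> path_image (rectpath (Complex a s) (Complex b t))" for p q
    using continuous_on_subset[OF cont that] by (rule contour_integrable_continuous_linepath)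
  have pi: "path_image (rectpath (Complex a s) (Complex b t)) = closed_segment (Complex a s) (Complex b s) \<union>
     closed_segment (Complex b s) (Complex b t) \<union> closed_segment (Complex b t) (Complex a t) \<union> closed_segment (Complex a t) (Complex a s)"
    by (simp add: rectpath_def Let_def path_image_join Un_assoc)
  have i: "f contour_integrable_on linepath (Complex a s) (Complex b s)" "f contour_integrable_on linepath (Complex b s) (Complex b t)"
    "f contour_integrable_on linepath (Complex b t) (Complex a t)" "f contour_integrable_on linepath (Complex a t) (Complex a s)"
    by (intro seg; auto simp: pi)+
  have c: "continuous_on (closed_segment (Complex a t) (Complex b t)) f" "continuous_on (closed_segment (Complex a s) (Complex a t)) f"
    using continuous_on_subset[OF cont] by (auto simp: pi closed_segment_commute)
  show ?thesis using i
    by (simp add: rectpath_def Let_def contour_integrable_joinI valid_path_join contour_integral_join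
      contour_integral_reverse_linepath[OF c(1)] contour_integral_reverse_linepath[OF c(2)])
qed

lemma norm_of_real_powr: "x > 0 \<Longrightarrow> cmod (of_real x powr s) = x powr Re s"
  by (simp add: norm_powr_real_powr)

lemma contour_integral_vertical_crude:
  assumes cont: "continuous_on (closed_segment (Complex c s) (Complex c t)) f" and "s \<le> t" "B \<ge> 0"
    and le: "\<And>u. u \<in> {s..t} \<Longrightarrow> cmod (f (Complex c u)) \<le> B"
  shows "cmod (contour_integral (linepath (Complex c s) (Complex c t)) f) \<le> B * (t - s)"
proof -
  have "Complex c t - Complex c s = \<i> * of_real (t - s)" by (simp add: complex_eq_iff)
  then have "cmod (Complex c t - Complex c s) = t - s" using assms by (simp add: norm_mult del: of_real_diff)
  moreover have "cmod (contour_integral (linepath (Complex c s) (Complex c t)) f) \<le> B * cmod (Complex c t - Complex c s)"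
  proof (rule contour_integral_bound_linepath)
    show "f contour_integrable_on linepath (Complex c s) (Complex c t)"
      using cont by (rule contour_integrable_continuous_linepath)
    fix x assume "x \<in> closed_segment (Complex c s) (Complex c t)"
    then have "x = Complex c (Im x)" "Im x \<in> {s..t}"
      using assms(2) by (auto simp: closed_segment_same_Re closed_segment_eq_real_ivl complex_eq_iff)
    then show "cmod (f x) \<le> B" using le by metis
  qed (use assms in auto)
  ultimately show ?thesis by simp
qed

text \<open>For \<open>y > 1\<close> the line is closed far to the left and encloses the pole at 0
  with residue 1; for \<open>y < 1\<close> it is closed far to the right and encloses nothing. The
  far side tends to 0 in the limit, and each horizontal side contributes at most
  \<open>y powr c / (T * \<bar>ln y\<bar>)\<close>.\<close>

lemma perron_bound:
  assumes y: "y > 0" "y \<noteq> 1" and c: "c > 0" and T: "T > 0"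
  shows "cmod (contour_integral (linepath (Complex c (-T)) (Complex c T)) (\<lambda>s. of_real y powr s / s)
            - 2 * of_real pi * \<i> * (if y > 1 then 1 else 0)) \<le> 2 * (y powr c / (T * \<bar>ln y\<bar>))"
    (is "cmod (?V - ?P) \<le> _")
proof -
  let ?f = "\<lambda>s::complex. of_real y powr s / s"
  have hol: "?f holomorphic_on A" if "0 \<notin> A" for A
    using that y by (intro holomorphic_intros) auto
  have contf: "continuous_on A ?f" if "0 \<notin> A" for A
    using hol[OF that] by (rule holomorphic_on_imp_continuous_on)
  have ly: "ln y \<noteq> 0" using y by simp
  have hor: "cmod (contour_integral (linepath (Complex a t) (Complex b t)) ?f) \<le> 1 / T * ((y powr b - y powr a) / ln y)"
    if "a \<le> b" "\<bar>t\<bar> = T" for a b t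
  proof (rule contour_integral_horizontal_bound)
    show "continuous_on (closed_segment (Complex a t) (Complex b t)) ?f"
      using that T by (intro contf) (auto simp: closed_segment_same_Im complex_eq_iff)
    show "cmod (?f (Complex \<sigma> t)) \<le> 1 / T * y powr \<sigma>" for \<sigma>
    proof -
      have "cmod (Complex \<sigma> t) \<ge> T" using abs_Im_le_cmod[of "Complex \<sigma> t"] that by simp
      then have "y powr \<sigma> / cmod (Complex \<sigma> t) \<le> y powr \<sigma> / T"
        using T by (intro divide_left_mono mult_pos_pos) auto
      then show ?thesis using y by (simp add: norm_divide norm_of_real_powr)
    qed
  qed (use that y in auto)
  have ver: "cmod (contour_integral (linepath (Complex a (-T)) (Complex a T)) ?f) \<le> y powr a / \<bar>a\<bar> * (2 * T)"
    if "a \<noteq> 0" for a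
  proof -
    have "cmod (contour_integral (linepath (Complex a (-T)) (Complex a T)) ?f) \<le> y powr a / \<bar>a\<bar> * (T - (- T))"
    proof (rule contour_integral_vertical_crude)
      show "continuous_on (closed_segment (Complex a (-T)) (Complex a T)) ?f"
        using that by (intro contf) (auto simp: closed_segment_same_Re complex_eq_iff)
      show "cmod (?f (Complex a u)) \<le> y powr a / \<bar>a\<bar>" for u
      proof -
        have "cmod (Complex a u) \<ge> \<bar>a\<bar>" using abs_Re_le_cmod[of "Complex a u"] by simp
        then have "y powr a / cmod (Complex a u) \<le> y powr a / \<bar>a\<bar>"
          using that by (intro divide_left_mono mult_pos_pos) auto
        then show ?thesis using y by (simp add: norm_divide norm_of_real_powr)
      qed
    qed (use T in auto)
    then show ?thesis by simp
  qed
  show ?thesis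
  proof (cases "y > 1")
    case True
    have lim: "(\<lambda>n. 2 * (y powr c / (T * ln y)) + y powr (- real (Suc n)) / real (Suc n) * (2 * T))
      \<longlonglongrightarrow> 2 * (y powr c / (T * ln y)) + 0"
      using True by (intro tendsto_add tendsto_const) real_asymp
    have "cmod (?V - ?P) \<le> 2 * (y powr c / (T * ln y)) + y powr (- real (Suc n)) / real (Suc n) * (2 * T)" for n
    proof -
      define U where "U = real (Suc n)"
      have U: "U > 0" by (simp add: U_def)
      let ?R = "rectpath (Complex (-U) (-T)) (Complex c T)"
      let ?B = "contour_integral (linepath (Complex (-U) (-T)) (Complex c (-T))) ?f"
      let ?Tp = "contour_integral (linepath (Complex (-U) T) (Complex c T)) ?f"
      let ?L = "contour_integral (linepath (Complex (-U) (-T)) (Complex (-U) T)) ?f"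
      have z: "0 \<notin> path_image ?R" using U c T by (simp add: path_image_rectpath)
      have "((\<lambda>w. of_real y powr w / (w - 0)) has_contour_integral
          (2 * of_real pi * \<i> * winding_number ?R 0 * of_real y powr 0)) ?R"
        using Cauchy_integral_formula_convex_simple[of UNIV "\<lambda>w. of_real y powr w" 0 ?R] y z
        by (auto simp: holomorphic_intros)
      moreover have "winding_number ?R 0 = 1"
        using U c T by (intro winding_number_rectpath) (auto simp: in_box_complex_iff)
      ultimately have "contour_integral ?R ?f = 2 * of_real pi * \<i>"
        using y by (simp add: contour_integral_unique)
      then have "2 * of_real pi * \<i> = ?B + ?V - ?Tp - ?L"
        using contour_integral_rectpath[OF contf[OF z]] U c T by simp
      then have "?V - ?P = ?Tp - ?B + ?L" using True by (simp add: algebra_simps)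
      then have "cmod (?V - ?P) \<le> cmod ?Tp + cmod ?B + cmod ?L"
        using norm_triangle_ineq[of "?Tp - ?B" ?L] norm_triangle_ineq4[of ?Tp ?B] by simp
      also have "\<dots> \<le> 1 / T * ((y powr c - y powr (-U)) / ln y) + 1 / T * ((y powr c - y powr (-U)) / ln y) + y powr (-U) / U * (2 * T)"
        using hor[of "-U" c T] hor[of "-U" c "-T"] ver[of "-U"] U c T by (intro add_mono) auto
      also have "\<dots> \<le> 1 / T * (y powr c / ln y) + 1 / T * (y powr c / ln y) + y powr (-U) / U * (2 * T)"
        using True T U by (intro add_mono mult_left_mono divide_right_mono) auto
      finally show ?thesis by (simp add: U_def)
    qed
    then have "cmod (?V - ?P) \<le> 2 * (y powr c / (T * ln y)) + 0"
      by (intro LIMSEQ_le_const[OF lim]) auto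
    then show ?thesis using True by simp
  next
    case False
    then have y1: "y < 1" using y by simp
    have lim: "(\<lambda>n. 2 * (y powr c / (T * - ln y)) + y powr (c + real (Suc n)) / (c + real (Suc n)) * (2 * T))
      \<longlonglongrightarrow> 2 * (y powr c / (T * - ln y)) + 0"
      using y1 y c by (intro tendsto_add tendsto_const) real_asymp
    have "cmod (?V - ?P) \<le> 2 * (y powr c / (T * - ln y)) + y powr (c + real (Suc n)) / (c + real (Suc n)) * (2 * T)" for n
    proof -
      define U where "U = c + real (Suc n)"
      have U: "U > c" by (simp add: U_def)
      let ?R = "rectpath (Complex c (-T)) (Complex U T)"
      let ?B = "contour_integral (linepath (Complex c (-T)) (Complex U (-T))) ?f"
      let ?Tp = "contour_integral (linepath (Complex c T) (Complex U T)) ?f"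
      let ?L = "contour_integral (linepath (Complex U (-T)) (Complex U T)) ?f"
      have z: "0 \<notin> path_image ?R" using U c T by (simp add: path_image_rectpath)
      have "(?f has_contour_integral 0) ?R"
        by (rule Cauchy_theorem_convex_simple[OF hol[of "{s. Re s > 0}"] convex_halfspace_Re_gt])
           (use U c T in \<open>auto simp: path_image_rectpath\<close>)
      then have "0 = ?B + ?L - ?Tp - ?V"
        using contour_integral_rectpath[OF contf[OF z]] U T by (simp add: contour_integral_unique)
      then have "?V - ?P = ?B - ?Tp + ?L" using False by (simp add: algebra_simps)
      then have "cmod (?V - ?P) \<le> cmod ?B + cmod ?Tp + cmod ?L"
        using norm_triangle_ineq[of "?B - ?Tp" ?L] norm_triangle_ineq4[of ?B ?Tp] by simp
      also have "\<dots> \<le> 1 / T * ((y powr U - y powr c) / ln y) + 1 / T * ((y powr U - y powr c) / ln y) + y powr U / U * (2 * T)"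
        using hor[of c U T] hor[of c U "-T"] ver[of U] U c T by (intro add_mono) auto
      also have "(y powr U - y powr c) / ln y = (y powr c - y powr U) / - ln y" using ly by (simp add: field_simps)
      also have "1 / T * ((y powr c - y powr U) / - ln y) + 1 / T * ((y powr c - y powr U) / - ln y) + y powr U / U * (2 * T)
         \<le> 1 / T * (y powr c / - ln y) + 1 / T * (y powr c / - ln y) + y powr U / U * (2 * T)"
        using y1 y T U c by (intro add_mono mult_left_mono divide_right_mono) auto
      finally show ?thesis by (simp add: U_def)
    qed
    then have "cmod (?V - ?P) \<le> 2 * (y powr c / (T * - ln y)) + 0"
      by (intro LIMSEQ_le_const[OF lim]) auto
    then show ?thesis using y1 y by (simp add: abs_if)
  qed
qed

section \<open>The functional equation\<close>

text \<open>Lebesgue integrability is recorded with the value, since termwise integration and Fubini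
  are applied later. For continuous functions \<open>has_pos_integral_HK\<close> passes to the gauge
  integral, where substitutions are carried out.\<close>

definition has_pos_integral :: "(real \<Rightarrow> complex) \<Rightarrow> complex \<Rightarrow> bool" where
  "has_pos_integral f I \<longleftrightarrow> set_integrable lborel {0<..} f \<and> (LINT x:{0<..}|lborel. f x) = I"

lemma has_pos_integral_cong:
  assumes "\<And>x. x > 0 \<Longrightarrow> f x = g x"
  shows "has_pos_integral f I \<longleftrightarrow> has_pos_integral g I"
proof -
  have "(\<lambda>x. indicator {0<..} x *\<^sub>R f x) = (\<lambda>x. indicator {0<..} x *\<^sub>R g x)"
    using assms by (intro ext) (auto simp: indicator_def)
  then show ?thesis by (simp add: has_pos_integral_def set_integrable_def set_lebesgue_integral_def)
qed

lemma has_pos_integral_add: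
  "has_pos_integral f I \<Longrightarrow> has_pos_integral g J \<Longrightarrow> has_pos_integral (\<lambda>x. f x + g x) (I + J)"
  by (auto simp: has_pos_integral_def)

lemma has_pos_integral_cmult:
  "has_pos_integral f I \<Longrightarrow> has_pos_integral (\<lambda>x. c * f x) (c * I)"
  by (auto simp: has_pos_integral_def)

lemma has_pos_integral_HK:
  assumes c: "continuous_on {0<..} f"
  shows "has_pos_integral f I \<longleftrightarrow> f absolutely_integrable_on {0<..} \<and> integral {0<..} f = I"
proof -
  have m: "(\<lambda>x. indicator {0<..} x *\<^sub>R f x) \<in> borel_measurable lborel"
    using borel_measurable_continuous_on_indicator[OF _ c] by simp
  have "f absolutely_integrable_on {0<..} \<longleftrightarrow> set_integrable lborel {0<..} f"
    unfolding set_integrable_def by (rule integrable_completion[OF m])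
  then show ?thesis unfolding has_pos_integral_def using set_borel_integral_eq_integral(2)[of "{0<..}" f] by auto
qed

lemma has_pos_integral_scale:
  assumes c: "continuous_on {0<..} f" and a: "a > 0" and f: "has_pos_integral f I"
  shows "has_pos_integral (\<lambda>x. f (a * x)) (I / of_real a)"
proof -
  have im: "(\<lambda>x. a * x) ` {0<..} = {0<..}"
    using a by (auto intro!: image_eqI[of _ _ "_ / a"])
  have "continuous_on {0<..} (\<lambda>x. f (a * x))"
    by (rule continuous_on_compose2[OF c]) (use a in \<open>auto intro!: continuous_intros\<close>)
  moreover have "(\<lambda>x. \<bar>a\<bar> *\<^sub>R f (a * x)) absolutely_integrable_on {0<..} \<and> integral {0<..} (\<lambda>x. \<bar>a\<bar> *\<^sub>R f (a * x)) = I"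
    using f unfolding has_pos_integral_HK[OF c]
    by (subst has_absolute_integral_change_of_variables_real[of "{0<..}" "\<lambda>x. a * x" "\<lambda>_. a" f])
       (use a in \<open>auto intro!: derivative_eq_intros inj_onI simp: im\<close>)
  ultimately have "has_pos_integral (\<lambda>x. \<bar>a\<bar> *\<^sub>R f (a * x)) I"
    by (subst has_pos_integral_HK) (auto intro!: continuous_intros)
  from has_pos_integral_cmult[OF this, of "1 / of_real a"] show ?thesis
    using a by (simp add: scaleR_conv_of_real)
qed

lemma continuous_on_of_real_powr [continuous_intros]:
  "continuous_on {0<..} (\<lambda>x. of_real x powr s :: complex)"
  by (intro continuous_intros) (auto simp: complex_nonpos_Reals_iff)

lemma has_pos_integral_Gamma:
  assumes z: "Re z > 0" and a: "a > 0"
  shows "has_pos_integral (\<lambda>x. of_real x powr (z - 1) * of_real (exp (- a * x))) (Gamma z * of_real a powr (- z))"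
proof -
  let ?f = "\<lambda>x. of_real x powr (z - 1) * of_real (exp (- x)) :: complex"
  have c: "continuous_on {0<..} ?f" by (intro continuous_intros)
  have eq: "?f = (\<lambda>x. of_real x powr (z - 1) / of_real (exp x))"
    by (simp add: exp_minus field_simps)
  have "has_pos_integral ?f (Gamma z)"
    unfolding has_pos_integral_HK[OF c] unfolding eq
    using absolutely_integrable_Gamma_integral'[OF z] Gamma_integral_complex'[OF z] by (auto simp: integral_unique)
  from has_pos_integral_cmult[OF has_pos_integral_scale[OF c a this], of "of_real a powr (1 - z)"]
  have "has_pos_integral (\<lambda>x. of_real a powr (1 - z) * ?f (a * x)) (Gamma z * of_real a powr (- z))"
    using a by (simp add: powr_diff powr_minus field_simps)
  then show ?thesis
  proof (subst has_pos_integral_cong)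
    fix x :: real assume x: "x > 0"
    have "of_real (a * x) powr (z - 1) = of_real a powr (z - 1) * of_real x powr (z - 1)"
      using a x by (subst of_real_mult, subst powr_times_real) auto
    moreover have "of_real a powr (1 - z) * of_real a powr (z - 1) = (1 :: complex)"
      using a by (simp add: powr_add[symmetric])
    ultimately show "of_real x powr (z - 1) * of_real (exp (- a * x)) = of_real a powr (1 - z) * ?f (a * x)"
      by simp
  qed
qed

text \<open>One power is integrable on \<open>{0<..1}\<close>, the other on
  \<open>{1<..}\<close>.\<close>

lemma set_integrable_pos_bound:
  fixes f :: "real \<Rightarrow> complex"
  assumes c: "continuous_on {0<..} f" and \<alpha>: "\<alpha> > -1" and \<beta>: "\<beta> < -1"
    and le: "\<And>x. x > 0 \<Longrightarrow> cmod (f x) \<le> C * x powr \<alpha>" "\<And>x. x > 0 \<Longrightarrow> cmod (f x) \<le> C * x powr \<beta>"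
  shows "set_integrable lborel {0<..} f"
proof -
  have 1: "set_integrable lborel {0<..1} (\<lambda>x. C * x powr \<alpha>)"
  proof -
    have "(\<lambda>x. x powr \<alpha>) absolutely_integrable_on {0<..1}"
      using integrable_on_powr_from_0'[OF \<alpha>, of 1] by (intro nonnegative_absolutely_integrable_1) auto
    then have "set_integrable lborel {0<..1} (\<lambda>x. x powr \<alpha>)"
      unfolding set_integrable_def by (subst (asm) integrable_completion) auto
    then show ?thesis by simp
  qed
  have 2: "set_integrable lborel {1<..} (\<lambda>x. C * x powr \<beta>)"
  proof -
    have "(\<lambda>x. x powr \<beta>) absolutely_integrable_on {1..}"
      using has_integral_powr_to_inf[OF \<beta>, of 1] by (intro nonnegative_absolutely_integrable_1) auto
    then have "set_integrable lborel {1..} (\<lambda>x. x powr \<beta>)"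
      unfolding set_integrable_def by (subst (asm) integrable_completion) auto
    then have "set_integrable lborel {1<..} (\<lambda>x. x powr \<beta>)"
      by (rule set_integrable_subset) auto
    then show ?thesis by simp
  qed
  have m: "set_borel_measurable lborel A f" if "A \<subseteq> {0<..}" "A \<in> sets borel" for A
    using that continuous_on_subset[OF c that(1)] unfolding set_borel_measurable_def
    by (simp add: borel_measurable_continuous_on_indicator)
  have "set_integrable lborel ({0<..1} \<union> {1<..}) f"
  proof (rule set_integrable_Un)
    show "set_integrable lborel {0<..1} f"
    proof (rule set_integrable_bound[OF 1 m])
      show "AE x in lborel. x \<in> {0<..1} \<longrightarrow> cmod (f x) \<le> norm (C * x powr \<alpha>)"
        by (intro AE_I2 impI order_trans[OF le(1)]) auto
    qed auto
    show "set_integrable lborel {1<..} f"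
    proof (rule set_integrable_bound[OF 2 m])
      show "AE x in lborel. x \<in> {1<..} \<longrightarrow> cmod (f x) \<le> norm (C * x powr \<beta>)"
        by (intro AE_I2 impI order_trans[OF le(2)]) auto
    qed auto
  qed auto
  moreover have "{0<..1} \<union> {1<..} = ({0<..} :: real set)" by auto
  ultimately show ?thesis by simp
qed

lemma has_pos_integral_FTC:
  fixes F f :: "real \<Rightarrow> complex"
  assumes "\<And>x. x > 0 \<Longrightarrow> (F has_vector_derivative f x) (at x)" "continuous_on {0<..} f"
    "set_integrable lborel {0<..} f" "(F \<longlongrightarrow> A) (at_right 0)" "(F \<longlongrightarrow> B) at_top"
  shows "has_pos_integral f (B - A)"
proof -
  have e: "einterval 0 \<infinity> = {0<..}" by (auto simp: einterval_iff)
  have "(LBINT x=0..\<infinity>. f x) = B - A"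
  proof (rule interval_integral_FTC_integrable)
    show "((F \<circ> real_of_ereal) \<longlongrightarrow> A) (at_right 0)"
      unfolding zero_ereal_def ereal_tendsto_simps by fact
    show "((F \<circ> real_of_ereal) \<longlongrightarrow> B) (at_left \<infinity>)"
      unfolding ereal_tendsto_simps by fact
    show "isCont f x" if "0 < ereal x" for x
      using assms(2) that by (simp add: continuous_on_eq_continuous_at)
  qed (use assms e in auto)
  then show ?thesis using assms(3) by (simp add: has_pos_integral_def interval_lebesgue_integral_0_infty)
qed

lemma has_pos_integral_sums:
  assumes f: "\<And>n. has_pos_integral (f n) (I n)"
    and s: "\<And>x. x > 0 \<Longrightarrow> (\<lambda>n. f n x) sums g x" "\<And>x. x > 0 \<Longrightarrow> summable (\<lambda>n. cmod (f n x))"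
    and n: "summable (\<lambda>n. LINT x:{0<..}|lborel. cmod (f n x))"
  shows "I sums (LINT x:{0<..}|lborel. g x)"
proof -
  let ?f = "\<lambda>n x. indicator {0<..} x *\<^sub>R f n x"
  have "(\<lambda>n. integral\<^sup>L lborel (?f n)) sums (\<integral>x. (\<Sum>n. ?f n x) \<partial>lborel)"
  proof (rule sums_integral)
    show "integrable lborel (?f n)" for n using f by (auto simp: has_pos_integral_def set_integrable_def)
    show "AE x in lborel. summable (\<lambda>n. norm (?f n x))"
      using s(2) by (intro AE_I2) (auto simp: indicator_def)
    show "summable (\<lambda>n. \<integral>x. norm (?f n x) \<partial>lborel)"
      using n by (simp add: set_lebesgue_integral_def)
  qed
  moreover have "integral\<^sup>L lborel (?f n) = I n" for n
    using f[of n] by (simp add: has_pos_integral_def set_lebesgue_integral_def)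
  moreover have "(\<integral>x. (\<Sum>n. ?f n x) \<partial>lborel) = (LINT x:{0<..}|lborel. g x)"
    unfolding set_lebesgue_integral_def
    by (intro Bochner_Integration.integral_cong refl) (use s(1) in \<open>auto simp: indicator_def sums_iff\<close>)
  ultimately show ?thesis by simp
qed

text \<open>
  The quotient \<open>em_kernel x / (1 - exp (- x))\<close> equals \<open>(x / 2) coth (x / 2) - 1\<close>. Its Mellin transform
  is computed in two ways: the geometric series in \<open>exp (- x)\<close> gives \<open>\<zeta>(s)\<close>, the partial fraction
  expansion of the cotangent gives \<open>\<zeta>(1 - s)\<close>.
\<close>

definition em_kernel :: "real \<Rightarrow> real" where
  "em_kernel x = x * (1 + exp (- x)) / 2 - (1 - exp (- x))"

definition em_kernel' :: "real \<Rightarrow> real" where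
  "em_kernel' x = (1 - exp (- x) - x * exp (- x)) / 2"

lemma em_kernel_deriv: "(em_kernel has_real_derivative em_kernel' x) (at x)"
  unfolding em_kernel_def[abs_def] em_kernel'_def
  by (auto intro!: derivative_eq_intros simp: field_simps)

lemma em_kernel'_deriv: "(em_kernel' has_real_derivative x * exp (- x) / 2) (at x)"
  unfolding em_kernel'_def[abs_def]
  by (auto intro!: derivative_eq_intros simp: field_simps)

lemma em_kernel'_nonneg: "x \<ge> 0 \<Longrightarrow> em_kernel' x \<ge> 0"
proof -
  assume "x \<ge> 0"
  have "(1 + x) * exp (- x) \<le> exp x * exp (- x)" using exp_ge_add_one_self[of x] by (intro mult_right_mono) auto
  also have "exp x * exp (- x) = 1" by (simp add: exp_minus)
  finally show ?thesis by (simp add: em_kernel'_def algebra_simps)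
qed

text \<open>Against the weight \<open>x powr (s - 2)\<close> the quadratic bound gives convergence
  at 0 for \<open>Re s > -1\<close>, the linear one at infinity for \<open>Re s < 0\<close>. This
  fixes the strip in which the functional equation is first proved.\<close>

lemma em_kernel_bounds:
  assumes x: "x \<ge> 0"
  shows em_kernel_nonneg: "em_kernel x \<ge> 0" and em_kernel_le: "em_kernel x \<le> x" and em_kernel_le2: "em_kernel x \<le> x\<^sup>2"
proof -
  have "em_kernel 0 \<le> em_kernel x"
    by (rule DERIV_nonneg_imp_nondecreasing[OF x]) (rule exI, rule conjI, rule em_kernel_deriv, rule em_kernel'_nonneg)
  then show "em_kernel x \<ge> 0" by (simp add: em_kernel_def)
  have e: "0 < exp (- x)" "exp (- x) \<le> 1" using x by auto
  have "x * (1 + exp (- x)) \<le> x * 2" using x e by (intro mult_left_mono) auto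
  then have "x * (1 + exp (- x)) / 2 \<le> x" by simp
  then show "em_kernel x \<le> x" using e(2) unfolding em_kernel_def by linarith
  have "em_kernel x \<le> x - (1 - exp (- x))" using \<open>x * (1 + exp (- x)) \<le> x * 2\<close> by (simp add: em_kernel_def)
  moreover have "1 - exp (- x) \<ge> x - x\<^sup>2"
  proof (cases "x \<le> 1")
    case True
    have "(1 - x + x\<^sup>2) * exp (x) \<ge> (1 - x + x\<^sup>2) * (1 + x)"
      using True x by (intro mult_left_mono exp_ge_add_one_self) auto
    also have "(1 - x + x\<^sup>2) * (1 + x) = 1 + x ^ 3" by (simp add: power2_eq_square power3_eq_cube algebra_simps)
    finally have "1 + x ^ 3 \<le> (1 - x + x\<^sup>2) * exp x" .
    moreover have "0 \<le> x ^ 3" using x by simp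
    ultimately have "1 \<le> (1 - x + x\<^sup>2) * exp x" by linarith
    then have "1 - x + x\<^sup>2 \<ge> exp (- x)" by (simp add: exp_minus field_simps)
    then show ?thesis by simp
  next
    case False
    then have "x * 1 \<le> x * x" using x by (intro mult_left_mono) auto
    then have "x - x\<^sup>2 \<le> 0" by (simp add: power2_eq_square)
    then show ?thesis using e(2) by linarith
  qed
  ultimately show "em_kernel x \<le> x\<^sup>2" by simp
qed

lemma continuous_em_kernel [continuous_intros]:
  "continuous_on A em_kernel" "continuous_on A em_kernel'"
  using em_kernel_deriv em_kernel'_deriv
  by (meson DERIV_isCont continuous_at_imp_continuous_on)+

text \<open>The real factor is the second derivative of \<open>exp (- a * x) * em_kernel x\<close>.
  Each exponential gives two Gamma integrals, which
  \<open>Gamma (s + 2) = (s + 1) * Gamma (s + 1)\<close> merges into one half of the trapezoidal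
  term.\<close>

lemma has_pos_integral_em_term:
  fixes n :: nat and s :: complex
  assumes s: "Re s > -1"
  defines "a \<equiv> real n" and "b \<equiv> real (Suc n)"
  shows "has_pos_integral (\<lambda>x. of_real x powr s *
      of_real ((a\<^sup>2 * x / 2 - a - a\<^sup>2) * exp (- a * x) + (b\<^sup>2 * x / 2 - b + b\<^sup>2) * exp (- b * x)))
      (Gamma (s + 1) * em_term n s)"
proof -
  have g2: "Gamma (s + 2) = (s + 1) * Gamma (s + 1)"
    using Gamma_plus1[of "s + 1"] s by (auto simp: add.assoc nonpos_Ints_def complex_eq_iff)
  have main: "has_pos_integral (\<lambda>x. of_real x powr s * of_real ((c\<^sup>2 * x / 2 - c + e * c\<^sup>2) * exp (- c * x)))
      (Gamma (s + 1) * ((s - 1) * of_real c powr (- s) / 2 + of_real e * of_real c powr (1 - s)))" if c: "c > 0" for c e :: real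
  proof -
    have 1: "has_pos_integral (\<lambda>x. of_real x powr (s + 2 - 1) * of_real (exp (- c * x))) (Gamma (s + 2) * of_real c powr (- (s + 2)))"
      using s c by (intro has_pos_integral_Gamma) auto
    have 2: "has_pos_integral (\<lambda>x. of_real x powr (s + 1 - 1) * of_real (exp (- c * x))) (Gamma (s + 1) * of_real c powr (- (s + 1)))"
      using s c by (intro has_pos_integral_Gamma) auto
    have 3: "has_pos_integral (\<lambda>x. of_real (c\<^sup>2 / 2) * (of_real x powr (s + 2 - 1) * of_real (exp (- c * x)))
        + of_real (e * c\<^sup>2 - c) * (of_real x powr (s + 1 - 1) * of_real (exp (- c * x))))
       (of_real (c\<^sup>2 / 2) * (Gamma (s + 2) * of_real c powr (- (s + 2))) + of_real (e * c\<^sup>2 - c) * (Gamma (s + 1) * of_real c powr (- (s + 1))))"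
      by (intro has_pos_integral_add has_pos_integral_cmult 1 2)
    have p: "of_real c powr (- (s + 2)) = of_real c powr (- s) / (of_real c)\<^sup>2"
      "of_real c powr (- (s + 1)) = of_real c powr (- s) / of_real c" "of_real c powr (1 - s) = of_real c * of_real c powr (- s)"
      using c powr_add[of "complex_of_real c" "- s" "- 2"] powr_add[of "complex_of_real c" "- s" "- 1"] powr_add[of "complex_of_real c" "1" "-s"]
      by (simp_all add: powr_minus powr_nat' field_simps)
    have v: "of_real (c\<^sup>2 / 2) * (Gamma (s + 2) * of_real c powr (- (s + 2))) + of_real (e * c\<^sup>2 - c) * (Gamma (s + 1) * of_real c powr (- (s + 1)))
       = Gamma (s + 1) * ((s - 1) * of_real c powr (- s) / 2 + of_real e * of_real c powr (1 - s))"
      unfolding g2 p using c by (simp add: field_simps power2_eq_square)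
    show ?thesis
    proof (subst has_pos_integral_cong)
      fix x :: real assume x: "x > 0"
      have "of_real x powr (s + 1) = of_real x * (of_real x powr s :: complex)"
        using x powr_add[of "complex_of_real x" s 1] by simp
      then show "of_real x powr s * of_real ((c\<^sup>2 * x / 2 - c + e * c\<^sup>2) * exp (- c * x)) =
         of_real (c\<^sup>2 / 2) * (of_real x powr (s + 2 - 1) * of_real (exp (- c * x)))
        + of_real (e * c\<^sup>2 - c) * (of_real x powr (s + 1 - 1) * of_real (exp (- c * x)))"
        by (simp add: algebra_simps)
    qed (use 3 v in simp)
  qed
  have B: "has_pos_integral (\<lambda>x. of_real x powr s * of_real ((b\<^sup>2 * x / 2 - b + 1 * b\<^sup>2) * exp (- b * x)))
      (Gamma (s + 1) * ((s - 1) * of_real b powr (- s) / 2 + of_real 1 * of_real b powr (1 - s)))"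
    by (rule main) (simp add: b_def)
  have A: "has_pos_integral (\<lambda>x. of_real x powr s * of_real ((a\<^sup>2 * x / 2 - a + (- 1) * a\<^sup>2) * exp (- a * x)))
      (Gamma (s + 1) * ((s - 1) * of_real a powr (- s) / 2 + of_real (- 1) * of_real a powr (1 - s)))"
  proof (cases "n = 0")
    \<comment> \<open>Here \<open>a = 0\<close> makes the integrand vanish, and
      \<open>0 powr _ = 0\<close> makes the value vanish with it.\<close>
    case True
    then show ?thesis by (simp add: a_def has_pos_integral_def set_integrable_def)
  next
    case False
    then show ?thesis by (intro main) (simp add: a_def)
  qed
  from has_pos_integral_add[OF A B] show ?thesis
  proof (rule back_subst[of "\<lambda>f. has_pos_integral f _", THEN back_subst[of "\<lambda>I. has_pos_integral _ I"]])
    show "Gamma (s + 1) * ((s - 1) * of_real a powr (- s) / 2 + of_real (- 1) * of_real a powr (1 - s)) +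
      Gamma (s + 1) * ((s - 1) * of_real b powr (- s) / 2 + of_real 1 * of_real b powr (1 - s)) = Gamma (s + 1) * em_term n s"
      by (simp add: em_term_def a_def b_def algebra_simps add_divide_distrib diff_divide_distrib del: of_nat_Suc)
  qed (simp add: fun_eq_iff algebra_simps)
qed

text \<open>Two integrations by parts move both derivatives off the kernel; \<open>F\<close>
  collects the boundary terms, which vanish at 0 and at infinity exactly because of the strip. The
  division by \<open>s * (s - 1)\<close> comes from integrating the power twice.\<close>

lemma has_pos_integral_em_kernel:
  assumes s: "-1 < Re s" "Re s < 0"
  shows "has_pos_integral (\<lambda>x. of_real x powr (s - 2) * of_real (exp (- real n * x) * em_kernel x))
           (Gamma (s + 1) * em_term n s / (s * (s - 1)))"
proof -
  define a b where "a = real n" and "b = real (Suc n)"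
  define Q where "Q = (\<lambda>x. exp (- a * x) * em_kernel x)"
  define Q1 where "Q1 = (\<lambda>x. exp (- a * x) * (em_kernel' x - a * em_kernel x))"
  define Q2 where "Q2 = (\<lambda>x. (a\<^sup>2 * x / 2 - a - a\<^sup>2) * exp (- a * x) + (b\<^sup>2 * x / 2 - b + b\<^sup>2) * exp (- b * x))"
  have ab: "a \<ge> 0" "b = a + 1" by (auto simp: a_def b_def)
  have Q: "(Q has_real_derivative Q1 x) (at x)" for x
    unfolding Q_def Q1_def by (auto intro!: derivative_eq_intros em_kernel_deriv simp: algebra_simps)
  have Q1: "(Q1 has_real_derivative Q2 x) (at x)" for x
  proof -
    have "(Q1 has_real_derivative exp (- a * x) * (x * exp (- x) / 2 - 2 * a * em_kernel' x + a\<^sup>2 * em_kernel x)) (at x)"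
      unfolding Q1_def
      by (auto intro!: derivative_eq_intros em_kernel_deriv em_kernel'_deriv simp: algebra_simps power2_eq_square)
    moreover have "exp (- a * x) * (x * exp (- x) / 2 - 2 * a * em_kernel' x + a\<^sup>2 * em_kernel x) = Q2 x"
    proof -
      have "exp (- b * x) = exp (- a * x) * exp (- x)" by (simp add: ab exp_add[symmetric] algebra_simps)
      then show ?thesis
        by (simp add: Q2_def ab em_kernel'_def em_kernel_def algebra_simps power2_eq_square add_divide_distrib diff_divide_distrib)
    qed
    ultimately show ?thesis by simp
  qed
  have s0: "s \<noteq> 0" "s \<noteq> 1" using s by auto
  have contQ: "continuous_on A Q" "continuous_on A Q2" for A
    unfolding Q_def Q2_def by (intro continuous_intros; simp)+
  have le: "exp (- a * x) \<le> 1" if "x > 0" for x using that ab by simp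
  have Qb: "0 \<le> Q x" "Q x \<le> em_kernel x" if "x > 0" for x
    using em_kernel_nonneg[of x] le[OF that] that unfolding Q_def
    by (auto simp del: exp_le_one_iff intro: mult_left_le_one_le)
  have pw: "cmod (of_real x powr z * of_real q) = x powr Re z * \<bar>q\<bar>" if "x > 0" for x q :: real and z :: complex
    using that by (simp add: norm_mult norm_powr_real_powr)
  let ?f = "\<lambda>x. of_real x powr (s - 2) * of_real (Q x)"
  have int1: "set_integrable lborel {0<..} ?f"
  proof (rule set_integrable_pos_bound[where \<alpha> = "Re s" and \<beta> = "Re s - 1" and C = 1])
    show "continuous_on {0<..} ?f" by (intro continuous_intros contQ)
    show "cmod (?f x) \<le> 1 * x powr Re s" if x: "x > 0" for x
    proof -
      have "cmod (?f x) \<le> x powr (Re s - 2) * x\<^sup>2"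
        unfolding pw[OF x] using Qb[OF x] em_kernel_le2[of x] x by (auto intro!: mult_left_mono)
      also have "\<dots> = x powr Re s" using x by (simp add: powr_diff)
      finally show ?thesis by simp
    qed
    show "cmod (?f x) \<le> 1 * x powr (Re s - 1)" if x: "x > 0" for x
    proof -
      have "cmod (?f x) \<le> x powr (Re s - 2) * x"
        unfolding pw[OF x] using Qb[OF x] em_kernel_le[of x] x by (auto intro!: mult_left_mono)
      also have "\<dots> = x powr (Re s - 1)" using x by (simp add: powr_diff power2_eq_square)
      finally show ?thesis by simp
    qed
  qed (use s in auto)
  have J: "has_pos_integral (\<lambda>x. of_real x powr s * of_real (Q2 x)) (Gamma (s + 1) * em_term n s)"
    using has_pos_integral_em_term[of s n] s unfolding Q2_def a_def b_def by simp
  let ?g = "\<lambda>x. (- 1 / (s * (s - 1))) * (of_real x powr s * of_real (Q2 x))"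
  have J': "has_pos_integral ?g ((- 1 / (s * (s - 1))) * (Gamma (s + 1) * em_term n s))"
    by (rule has_pos_integral_cmult[OF J])
  define F where "F = (\<lambda>x. of_real x powr (s - 1) * of_real (Q x) / (s - 1) - of_real x powr s * of_real (Q1 x) / (s * (s - 1)))"
  have F: "(F has_vector_derivative ?f x + ?g x) (at x)" if x: "x > 0" for x
  proof -
    have D: "((\<lambda>x. of_real x powr z) has_vector_derivative z * of_real x powr (z - 1)) (at x)" for z :: complex
    proof -
      have "((\<lambda>w. w powr z) has_field_derivative z * of_real x powr (z - 1)) (at (of_real x :: complex))"
        using x by (intro has_field_derivative_powr) (auto simp: complex_nonpos_Reals_iff)
      from has_vector_derivative_real_field[OF this] show ?thesis by simp
    qed
    have DQ: "((\<lambda>x. of_real (Q x)) has_vector_derivative of_real (Q1 x)) (at x)"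
      "((\<lambda>x. of_real (Q1 x)) has_vector_derivative of_real (Q2 x)) (at x)"
      using Q[of x] Q1[of x] by (auto intro!: has_vector_derivative_of_real simp: has_real_derivative_iff_has_vector_derivative)
    have "(F has_vector_derivative
       (of_real x powr (s - 1) * of_real (Q1 x) + (s - 1) * of_real x powr (s - 1 - 1) * of_real (Q x)) / (s - 1)
       - (of_real x powr s * of_real (Q2 x) + s * of_real x powr (s - 1) * of_real (Q1 x)) / (s * (s - 1))) (at x)"
      unfolding F_def divide_inverse
      by (intro has_vector_derivative_diff has_vector_derivative_mult_left has_vector_derivative_mult D DQ)
    moreover have "(p * q1 + (s - 1) * w * q) / (s - 1) - (v * q2 + s * p * q1) / (s * (s - 1))
        = w * q + (- 1 / (s * (s - 1))) * (v * q2)" for p q1 w q v q2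
      using s0 by (simp add: divide_simps) (simp add: algebra_simps)
    moreover have "s - 1 - 1 = s - 2" by simp
    ultimately show ?thesis by (simp only:)
  qed
  \<comment> \<open>One argument serves both ends. The factor \<open>exp (- a * x) * a\<close> is
    kept in the last limit because \<open>x powr Re s * em_kernel x\<close> alone grows at infinity;
    for \<open>a = 0\<close> that term disappears.\<close>
  have lims: "(F \<longlongrightarrow> 0) G" if ev: "eventually (\<lambda>x. x > 0) G"
    and l: "((\<lambda>x. x powr (Re s - 1) * em_kernel x) \<longlongrightarrow> 0) G" "((\<lambda>x. x powr Re s * em_kernel' x) \<longlongrightarrow> 0) G"
      "((\<lambda>x. x powr Re s * (exp (- a * x) * a * em_kernel x)) \<longlongrightarrow> 0) G" for G
  proof -
    have "((\<lambda>x. of_real x powr (s - 1) * of_real (Q x)) \<longlongrightarrow> 0) G"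
    proof (rule Lim_null_comparison[OF _ l(1)])
      show "\<forall>\<^sub>F x in G. cmod (of_real x powr (s - 1) * of_real (Q x)) \<le> x powr (Re s - 1) * em_kernel x"
        using ev by eventually_elim (use Qb pw in \<open>auto intro!: mult_left_mono\<close>)
    qed
    moreover have "((\<lambda>x. of_real x powr s * of_real (Q1 x)) \<longlongrightarrow> 0) G"
    proof (rule Lim_null_comparison[OF _ tendsto_add_zero[OF l(2,3)]])
      show "\<forall>\<^sub>F x in G. cmod (of_real x powr s * of_real (Q1 x)) \<le> x powr Re s * em_kernel' x + x powr Re s * (exp (- a * x) * a * em_kernel x)"
        using ev
      proof eventually_elim
        case (elim x)
        have "\<bar>Q1 x\<bar> \<le> exp (- a * x) * em_kernel' x + exp (- a * x) * a * em_kernel x"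
          using em_kernel'_nonneg[of x] em_kernel_nonneg[of x] elim ab by (auto simp: Q1_def abs_le_iff algebra_simps)
        also have "exp (- a * x) * em_kernel' x \<le> em_kernel' x"
          using em_kernel'_nonneg[of x] le[OF elim] elim by (intro mult_left_le_one_le) auto
        finally have "\<bar>Q1 x\<bar> \<le> em_kernel' x + exp (- a * x) * a * em_kernel x" by simp
        then show ?case unfolding pw[OF elim] distrib_left[symmetric] by (intro mult_left_mono) auto
      qed
    qed
    ultimately have "(F \<longlongrightarrow> 0 / (s - 1) - 0 / (s * (s - 1))) G"
      unfolding F_def using s0 by (intro tendsto_intros) auto
    then show ?thesis by simp
  qed
  define \<sigma> where "\<sigma> = Re s"
  have \<sigma>: "-1 < \<sigma>" "\<sigma> < 0" using s by (auto simp: \<sigma>_def)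
  have "has_pos_integral (\<lambda>x. ?f x + ?g x) (0 - 0)"
  proof (rule has_pos_integral_FTC[of F])
    show "continuous_on {0<..} (\<lambda>x. ?f x + ?g x)" by (intro continuous_intros contQ)
    show "set_integrable lborel {0<..} (\<lambda>x. ?f x + ?g x)"
      by (intro set_integral_add(1) int1 J'[unfolded has_pos_integral_def, THEN conjunct1])
    show "(F \<longlongrightarrow> 0) (at_right 0)"
    proof (rule lims; (fold \<sigma>_def)?)
      show "eventually (\<lambda>x::real. x > 0) (at_right 0)" by (simp add: eventually_at_right_less)
      show "((\<lambda>x. x powr (\<sigma> - 1) * em_kernel x) \<longlongrightarrow> 0) (at_right 0)"
        unfolding em_kernel_def using \<sigma> by real_asymp
      show "((\<lambda>x. x powr \<sigma> * em_kernel' x) \<longlongrightarrow> 0) (at_right 0)"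
        unfolding em_kernel'_def using \<sigma> by real_asymp
      have "((\<lambda>x. x powr \<sigma> * em_kernel x) \<longlongrightarrow> 0) (at_right 0)"
        unfolding em_kernel_def using \<sigma> by real_asymp
      moreover have "((\<lambda>x. exp (- a * x) * a) \<longlongrightarrow> exp (- a * 0) * a) (at_right 0)"
        by (intro tendsto_intros)
      ultimately have "((\<lambda>x. (exp (- a * x) * a) * (x powr \<sigma> * em_kernel x)) \<longlongrightarrow> exp (- a * 0) * a * 0) (at_right 0)"
        by (rule tendsto_mult[rotated])
      then show "((\<lambda>x. x powr \<sigma> * (exp (- a * x) * a * em_kernel x)) \<longlongrightarrow> 0) (at_right 0)"
        by (simp add: mult_ac)
    qed
    show "(F \<longlongrightarrow> 0) at_top"
    proof (rule lims; (fold \<sigma>_def)?)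
      show "eventually (\<lambda>x::real. x > 0) at_top" by (rule eventually_gt_at_top)
      show "((\<lambda>x. x powr (\<sigma> - 1) * em_kernel x) \<longlongrightarrow> 0) at_top"
        unfolding em_kernel_def using \<sigma> by real_asymp
      show "((\<lambda>x. x powr \<sigma> * em_kernel' x) \<longlongrightarrow> 0) at_top"
        unfolding em_kernel'_def using \<sigma> by real_asymp
      show "((\<lambda>x. x powr \<sigma> * (exp (- a * x) * a * em_kernel x)) \<longlongrightarrow> 0) at_top"
      proof (cases "a = 0")
        case False
        then have "a > 0" using ab by simp
        then show ?thesis unfolding em_kernel_def using \<sigma> by real_asymp
      qed simp
    qed
  qed (use F in auto)
  then have "(LINT x:{0<..}|lborel. ?f x + ?g x) = 0" by (simp add: has_pos_integral_def)
  moreover have "(LINT x:{0<..}|lborel. ?f x + ?g x) = (LINT x:{0<..}|lborel. ?f x) + (LINT x:{0<..}|lborel. ?g x)"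
    using int1 J' by (intro set_integral_add) (auto simp: has_pos_integral_def)
  moreover have "(LINT x:{0<..}|lborel. ?g x) = (- 1 / (s * (s - 1))) * (Gamma (s + 1) * em_term n s)"
    using J' by (simp add: has_pos_integral_def)
  ultimately have "(LINT x:{0<..}|lborel. ?f x) = Gamma (s + 1) * em_term n s / (s * (s - 1))" by simp
  then show ?thesis using int1 by (simp add: has_pos_integral_def Q_def a_def)
qed

lemma set_integral_of_real_eq:
  assumes "has_pos_integral (\<lambda>x. complex_of_real (g x)) I"
  shows "complex_of_real (LINT x:{0<..}|lborel. g x) = I"
  using assms by (simp add: has_pos_integral_def set_integral_complex_of_real)

text \<open>Expand \<open>1 / (1 - exp (- x))\<close> geometrically and integrate termwise; the sum
  over all \<open>n\<close> including 0 is \<open>zeta1 s\<close> without any correction.\<close>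

lemma integral_em_kernel_series:
  assumes s: "-1 < Re s" "Re s < 0"
  shows "(LINT x:{0<..}|lborel. of_real x powr (s - 2) * of_real (em_kernel x / (1 - exp (- x))))
           = Gamma (s + 1) * zeta1 s / (s * (s - 1))"
proof -
  let ?f = "\<lambda>n x. of_real x powr (s - 2) * of_real (exp (- real n * x) * em_kernel x)"
  let ?g = "\<lambda>x. of_real x powr (s - 2) * of_real (em_kernel x / (1 - exp (- x)))"
  let ?I = "\<lambda>n. Gamma (s + 1) * em_term n s / (s * (s - 1))"
  have geo: "(\<lambda>n. exp (- real n * x)) sums (1 / (1 - exp (- x)))" if "x > 0" for x :: real
  proof -
    have "(\<lambda>n. exp (- x) ^ n) sums (1 / (1 - exp (- x)))"
      using that by (intro geometric_sums) auto
    then show ?thesis by (simp add: exp_of_nat_mult[symmetric])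
  qed
  have "?I sums (LINT x:{0<..}|lborel. ?g x)"
  proof (rule has_pos_integral_sums)
    show "has_pos_integral (?f n) (?I n)" for n by (rule has_pos_integral_em_kernel[OF s])
    show "(\<lambda>n. ?f n x) sums ?g x" if x: "x > 0" for x
    proof -
      have "(\<lambda>n. of_real (exp (- real n * x) * em_kernel x) :: complex) sums of_real (1 / (1 - exp (- x)) * em_kernel x)"
        by (intro sums_of_real sums_mult2 geo x)
      then have "(\<lambda>n. of_real x powr (s - 2) * of_real (exp (- real n * x) * em_kernel x)) sums
         (of_real x powr (s - 2) * of_real (1 / (1 - exp (- x)) * em_kernel x))"
        by (rule sums_mult)
      then show ?thesis by simp
    qed
    show "summable (\<lambda>n. cmod (?f n x))" if x: "x > 0" for x
      using sums_summable[OF geo[OF x]] by (simp add: norm_mult summable_mult summable_mult2)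
    show "summable (\<lambda>n. LINT x:{0<..}|lborel. cmod (?f n x))"
    proof -
      \<comment> \<open>Since the kernel is nonnegative, the norm of the integrand at
        \<open>s\<close> is the integrand at the real point \<open>Re s\<close>. The integrals of
        the norms are therefore known in closed form, and summable by
        \<open>em_term_bound\<close>.\<close>
      define \<sigma> where "\<sigma> = Re s"
      let ?\<sigma> = "complex_of_real \<sigma>"
      define c where "c = cmod (Gamma (?\<sigma> + 1) / (?\<sigma> * (?\<sigma> - 1)))"
      have eq: "(LINT x:{0<..}|lborel. cmod (?f n x)) = (LINT x:{0<..}|lborel. x powr (\<sigma> - 2) * (exp (- real n * x) * em_kernel x))" for n
        by (rule set_lebesgue_integral_cong)
           (auto simp: norm_mult norm_powr_real_powr \<sigma>_def em_kernel_nonneg)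
      have "has_pos_integral (\<lambda>x. of_real (x powr (\<sigma> - 2) * (exp (- real n * x) * em_kernel x)))
          (Gamma (?\<sigma> + 1) * em_term n ?\<sigma> / (?\<sigma> * (?\<sigma> - 1)))" for n
      proof (subst has_pos_integral_cong)
        show "has_pos_integral (\<lambda>x. of_real x powr (?\<sigma> - 2) * of_real (exp (- real n * x) * em_kernel x))
          (Gamma (?\<sigma> + 1) * em_term n ?\<sigma> / (?\<sigma> * (?\<sigma> - 1)))"
          by (rule has_pos_integral_em_kernel) (use s in \<open>auto simp: \<sigma>_def\<close>)
      next
        fix x :: real assume "x > 0"
        then show "of_real (x powr (\<sigma> - 2) * (exp (- real n * x) * em_kernel x)) =
          of_real x powr (?\<sigma> - 2) * complex_of_real (exp (- real n * x) * em_kernel x)"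
          using powr_of_real[of x "\<sigma> - 2"] by simp
      qed
      from set_integral_of_real_eq[OF this]
      have val: "complex_of_real (LINT x:{0<..}|lborel. cmod (?f n x)) = Gamma (?\<sigma> + 1) * em_term n ?\<sigma> / (?\<sigma> * (?\<sigma> - 1))" for n
        unfolding eq .
      have nv: "norm (LINT x:{0<..}|lborel. cmod (?f n x)) = c * cmod (em_term n ?\<sigma>)" for n
      proof -
        have "norm (LINT x:{0<..}|lborel. cmod (?f n x)) = cmod (complex_of_real (LINT x:{0<..}|lborel. cmod (?f n x)))"
          by simp
        also have "\<dots> = c * cmod (em_term n ?\<sigma>)" unfolding val by (simp add: c_def norm_mult norm_divide)
        finally show ?thesis .
      qed
      have "summable (\<lambda>n. cmod (em_term (Suc n) ?\<sigma>))"
      proof (rule summable_comparison_test')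
        show "summable (\<lambda>n. cmod (?\<sigma> - 1) * cmod ?\<sigma> * cmod (?\<sigma> + 1) / 2 * real (Suc n) powr (- Re ?\<sigma> - 2))"
          using s by (intro summable_mult summable_Suc_powr) (auto simp: \<sigma>_def)
        show "norm (cmod (em_term (Suc n) ?\<sigma>)) \<le> cmod (?\<sigma> - 1) * cmod ?\<sigma> * cmod (?\<sigma> + 1) / 2 * real (Suc n) powr (- Re ?\<sigma> - 2)" for n
          using em_term_bound[of "Suc n" ?\<sigma>] s by (simp add: \<sigma>_def del: of_nat_Suc)
      qed
      then have "summable (\<lambda>n. cmod (em_term n ?\<sigma>))" by (subst (asm) summable_Suc_iff)
      then have "summable (\<lambda>n. c * cmod (em_term n ?\<sigma>))" by (rule summable_mult)
      then show ?thesis by (rule summable_comparison_test') (use nv in auto)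
    qed
  qed
  moreover have "?I sums (Gamma (s + 1) * zeta1 s / (s * (s - 1)))"
  proof -
    \<comment> \<open>With \<open>0 powr _ = 0\<close> the term of index 0 is
      \<open>1 + (s - 1) / 2\<close>, exactly what the series from index 1 leaves over.\<close>
    have "(\<lambda>n. em_term (Suc n) s) sums (zeta1 s - em_term 0 s)"
      using zeta1_em[of s] s by (simp add: em_term_def[of 0] algebra_simps)
    then have "(\<lambda>n. em_term n s) sums zeta1 s" by (subst (asm) sums_Suc_iff) simp
    then show ?thesis by (intro sums_divide sums_mult)
  qed
  ultimately show ?thesis using sums_unique2 by blast
qed

section \<open>Partial fractions of the cotangent\<close>

text \<open>Logarithmic differentiation of
  \<open>Gamma z * Gamma (1 - z) = pi / sin (pi z)\<close>.\<close>

lemma Digamma_reflection: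
  assumes z: "z \<notin> \<int>"
  shows "Digamma (1 - z) - Digamma z = of_real pi * cot (of_real pi * z :: complex)"
proof -
  have nz: "z \<notin> \<int>\<^sub>\<le>\<^sub>0" "1 - z \<notin> \<int>\<^sub>\<le>\<^sub>0"
    using z nonpos_Ints_subset_Ints Ints_diff[of 1 "1 - z"] by auto
  have s: "sin (of_real pi * z) \<noteq> 0"
    using z by (auto simp: sin_eq_0)
  let ?G = "\<lambda>z::complex. Gamma z * Gamma (1 - z)"
  have "(?G has_field_derivative (Gamma z * Digamma z * Gamma (1 - z) + (- 1) * (Gamma (1 - z) * Digamma (1 - z)) * Gamma z)) (at z)"
    using nz by (auto intro!: derivative_eq_intros)
  moreover have "?G = (\<lambda>z. of_real pi / sin (of_real pi * z))" using Gamma_reflection_complex by auto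
  moreover have "((\<lambda>z. of_real pi / sin (of_real pi * z)) has_field_derivative
     (- (of_real pi * (cos (of_real pi * z) * of_real pi)) / (sin (of_real pi * z))\<^sup>2)) (at z)"
    using s by (auto intro!: derivative_eq_intros simp: power2_eq_square)
  ultimately have "Gamma z * Digamma z * Gamma (1 - z) + (- 1) * (Gamma (1 - z) * Digamma (1 - z)) * Gamma z
     = - (of_real pi * (cos (of_real pi * z) * of_real pi)) / (sin (of_real pi * z))\<^sup>2"
    using DERIV_unique by metis
  then have "(Digamma (1 - z) - Digamma z) * (Gamma z * Gamma (1 - z)) = of_real pi * (cos (of_real pi * z) * of_real pi) / (sin (of_real pi * z))\<^sup>2"
    by (simp add: algebra_simps)
  then have eq: "(Digamma (1 - z) - Digamma z) * (of_real pi / sin (of_real pi * z)) = of_real pi * (cos (of_real pi * z) * of_real pi) / (sin (of_real pi * z))\<^sup>2"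
    by (simp only: Gamma_reflection_complex)
  have "D = p * (C / S)" if "D * (p / S) = p * (C * p) / S\<^sup>2" "p \<noteq> 0" "S \<noteq> 0" for D p C S :: complex
  proof -
    have "D = D * (p / S) * (S / p)" using that(2,3) by simp
    also have "\<dots> = p * (C * p) / S\<^sup>2 * (S / p)" by (simp only: that(1))
    also have "\<dots> = p * (C / S)" using that(2,3) by (simp add: power2_eq_square)
    finally show ?thesis .
  qed
  from this[OF eq] show ?thesis using s by (simp add: cot_def)
qed

text \<open>Insert the limit formula of the digamma function at \<open>1 - z\<close> and at
  \<open>z\<close> into the reflection formula; the logarithms cancel.\<close>

lemma cot_partial_fractions:
  assumes z: "z \<notin> \<int>"
  shows "(\<lambda>n. 2 * z / (z\<^sup>2 - (of_nat (Suc n))\<^sup>2)) sums (of_real pi * cot (of_real pi * z :: complex) - 1 / z)"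
proof -
  have nz: "z \<noteq> 0" "1 - z \<noteq> 0" using z by auto
  have zn: "z + of_nat n \<noteq> 0" "1 - z + of_nat n \<noteq> 0" for n
  proof -
    show "z + of_nat n \<noteq> 0" using z Ints_of_nat Ints_minus add_eq_0_iff2 by metis
    show "1 - z + of_nat n \<noteq> 0"
    proof
      assume "1 - z + of_nat n = 0"
      then have "z = of_nat (Suc n)" by (simp add: algebra_simps)
      then show False using z by (simp only: Ints_of_nat not_True_eq_False)
    qed
  qed
  have A: "(\<lambda>m. (of_real (ln (real m)) - (\<Sum>n<m. inverse (1 - z + of_nat n))) - (of_real (ln (real m)) - (\<Sum>n<m. inverse (z + of_nat n))))
     \<longlonglongrightarrow> Digamma (1 - z) - Digamma z"
    by (intro tendsto_diff Digamma_LIMSEQ nz)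
  have B: "(\<lambda>m. inverse (z + of_nat m)) \<longlonglongrightarrow> 0"
    by (rule filterlim_compose[OF tendsto_inverse_0 tendsto_add_filterlim_at_infinity[OF tendsto_const tendsto_of_nat]])
  have C: "(\<lambda>m. (of_real (ln (real m)) - (\<Sum>n<m. inverse (1 - z + of_nat n))) - (of_real (ln (real m)) - (\<Sum>n<m. inverse (z + of_nat n)))
      + inverse (z + of_nat m) - 1 / z)
     \<longlonglongrightarrow> Digamma (1 - z) - Digamma z + 0 - 1 / z"
    by (rule tendsto_diff[OF tendsto_add[OF A B] tendsto_const])
  \<comment> \<open>The two sums are offset by one: dropping \<open>1 / z\<close> and adding
    \<open>1 / (z + m)\<close>, which tends to 0, pairs \<open>z + n\<close> with
    \<open>z - n\<close>.\<close>
  have S: "(\<Sum>n<m. inverse (z + of_nat n)) - (\<Sum>n<m. inverse (1 - z + of_nat n)) + inverse (z + of_nat m) - 1 / z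
     = (\<Sum>n<m. 2 * z / (z\<^sup>2 - (of_nat (Suc n))\<^sup>2))" for m
  proof (induction m)
    case (Suc m)
    have "inverse (z + of_nat (Suc m)) - inverse (1 - z + of_nat m) = 2 * z / (z\<^sup>2 - (of_nat (Suc m))\<^sup>2)"
    proof -
      have f: "z\<^sup>2 - (of_nat (Suc m))\<^sup>2 = (z + of_nat (Suc m)) * (- (1 - z + of_nat m))"
        by (simp add: power2_eq_square algebra_simps)
      have "inverse u - inverse v = 2 * z / (u * (- v))" if "u \<noteq> 0" "v \<noteq> 0" "u - v = 2 * z" for u v
        unfolding that(3)[symmetric] using that(1,2) by (simp add: field_simps)
      from this[OF zn(1)[of "Suc m"] zn(2)[of m]] show ?thesis unfolding f by simp
    qed
    then show ?case using Suc.IH by (simp add: algebra_simps del: of_nat_Suc)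
  qed (simp add: inverse_eq_divide)
  have "(of_real l - b) - (of_real l - a) + c - d = a - b + c - d" for a b c d :: complex and l :: real by simp
  then have "(of_real (ln (real m)) - (\<Sum>n<m. inverse (1 - z + of_nat n))) - (of_real (ln (real m)) - (\<Sum>n<m. inverse (z + of_nat n)))
      + inverse (z + of_nat m) - 1 / z = (\<Sum>n<m. 2 * z / (z\<^sup>2 - (of_nat (Suc n))\<^sup>2))" for m
    unfolding S[of m, symmetric] .
  with C show ?thesis
    unfolding sums_def by (simp only: Digamma_reflection[OF z] add_0_right)
qed

text \<open>The cotangent expansion multiplied by \<open>z\<close>, at
  \<open>z = \<i> x / (2 pi)\<close>, where \<open>z * pi * cot (pi z)\<close> is
  \<open>(x / 2) coth (x / 2)\<close>.\<close>

lemma em_kernel_partial_fractions: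
  assumes x: "x > 0"
  shows "(\<lambda>n. 2 * x\<^sup>2 / (x\<^sup>2 + (2 * pi * real (Suc n))\<^sup>2)) sums (em_kernel x / (1 - exp (- x)))"
proof -
  define z where "z = \<i> * of_real (x / (2 * pi))"
  have z0: "z \<noteq> 0" using x by (simp add: z_def)
  have "z \<notin> \<int>" using x by (auto simp: z_def elim!: Ints_cases simp: complex_eq_iff)
  from sums_mult[OF cot_partial_fractions[OF this], of z]
  have "(\<lambda>n. z * (2 * z / (z\<^sup>2 - (of_nat (Suc n))\<^sup>2))) sums (z * (of_real pi * cot (of_real pi * z) - 1 / z))" .
  moreover have "z * (2 * z / (z\<^sup>2 - (of_nat (Suc n))\<^sup>2)) = of_real (2 * x\<^sup>2 / (x\<^sup>2 + (2 * pi * real (Suc n))\<^sup>2))" for n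
  proof -
    have z2: "z * z = - of_real (x\<^sup>2 / (2 * pi)\<^sup>2)"
    proof -
      have "z * z = (\<i> * \<i>) * (of_real (x / (2 * pi)) * of_real (x / (2 * pi)))"
        unfolding z_def by (simp only: mult_ac)
      then show ?thesis by (simp add: power2_eq_square)
    qed
    have "z * (2 * z / (z\<^sup>2 - (of_nat (Suc n))\<^sup>2)) = 2 * (z * z) / (z * z - of_nat (Suc n) ^ 2)"
      by (simp add: power2_eq_square)
    also have "\<dots> = of_real (2 * - (x\<^sup>2 / (2 * pi)\<^sup>2) / (- (x\<^sup>2 / (2 * pi)\<^sup>2) - (real (Suc n))\<^sup>2))"
      unfolding z2 by simp
    also have "2 * - (x\<^sup>2 / (2 * pi)\<^sup>2) / (- (x\<^sup>2 / (2 * pi)\<^sup>2) - (real (Suc n))\<^sup>2) = 2 * x\<^sup>2 / (x\<^sup>2 + (2 * pi * real (Suc n))\<^sup>2)"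
    proof -
      have "2 * - (a / p) / (- (a / p) - k) = 2 * a / (a + p * k)" if "a > 0" "p > 0" "k > 0" for a p k :: real
      proof -
        have "- (a / p) - k = - ((a + p * k) / p)" using that by (simp add: field_simps)
        moreover have "a + p * k > 0" using that by (simp add: add_pos_pos)
        ultimately show ?thesis using that by simp
      qed
      from this[of "x\<^sup>2" "(2 * pi)\<^sup>2" "(real (Suc n))\<^sup>2"] show ?thesis using x by (simp add: power_mult_distrib del: of_nat_Suc)
    qed
    finally show ?thesis .
  qed
  moreover have "z * (of_real pi * cot (of_real pi * z) - 1 / z) = of_real (em_kernel x / (1 - exp (- x)))"
  proof -
    have e: "1 - exp (- x) \<noteq> 0" using x by simp
    define q where "q = exp (- x)"
    have pz: "of_real pi * z = \<i> * of_real (x / 2)" by (simp add: z_def)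
    define w where "w = exp (x / 2)"
    have w: "w > 0" "w \<noteq> 1" using x by (auto simp: w_def)
    have q: "q = 1 / w\<^sup>2" by (simp add: q_def w_def exp_minus field_simps power2_eq_square exp_add[symmetric])
    have ex: "exp (\<i> * (\<i> * of_real (x / 2))) = of_real (1 / w)" "exp (- (\<i> * (\<i> * of_real (x / 2)))) = of_real w"
      using exp_of_real[of "x / 2", where 'a = complex] exp_of_real[of "- (x / 2)", where 'a = complex]
      by (simp_all add: w_def exp_minus field_simps)
    have c: "cos (of_real pi * z) = of_real ((1 / w + w) / 2)"
      unfolding pz cos_exp_eq ex by simp
    have s: "sin (of_real pi * z) = \<i> * of_real ((w - 1 / w) / 2)"
      unfolding pz sin_exp_eq ex by (simp add: field_simps)
    have "cot (of_real pi * z) = - \<i> * of_real ((1 / w + w) / (w - 1 / w))"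
    proof -
      have "complex_of_real (p / 2) / (\<i> * of_real (q / 2)) = - \<i> * of_real (p / q)" for p q
      proof -
        have "complex_of_real (p / 2) / (\<i> * of_real (q / 2)) = inverse \<i> * (of_real (p / 2) / of_real (q / 2))"
          by (simp only: divide_inverse inverse_mult_distrib mult_ac)
        also have "complex_of_real (p / 2) / of_real (q / 2) = of_real (p / q)" by simp
        finally show ?thesis by simp
      qed
      then show ?thesis unfolding cot_def c s .
    qed
    also have "(1 / w + w) / (w - 1 / w) = (1 + q) / (1 - q)"
    proof -
      have e1: "w - 1 / w = (w\<^sup>2 - 1) / w" "1 / w + w = (w\<^sup>2 + 1) / w" using w by (simp_all add: field_simps power2_eq_square)
      have e2: "1 - q = (w\<^sup>2 - 1) / w\<^sup>2" "1 + q = (w\<^sup>2 + 1) / w\<^sup>2" using w by (simp_all add: q field_simps)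
      show ?thesis unfolding e1 e2 using w(1) by simp
    qed
    finally have cot: "cot (of_real pi * z) = - \<i> * of_real ((1 + q) / (1 - q))" .
    have zc: "z * (of_real pi * c - 1 / z) = (of_real pi * z) * c - 1" for c
      using z0 by (simp add: right_diff_distrib mult_ac)
    have "z * (of_real pi * cot (of_real pi * z) - 1 / z) = \<i> * of_real (x / 2) * (- \<i> * of_real ((1 + q) / (1 - q))) - 1"
      unfolding zc cot unfolding pz ..
    also have "\<i> * complex_of_real u * (- \<i> * of_real v) - 1 = of_real (u * v - 1)" for u v
      by (simp add: complex_eq_iff)
    finally have "z * (of_real pi * cot (of_real pi * z) - 1 / z) = of_real (x / 2 * ((1 + q) / (1 - q)) - 1)" .
    also have "x / 2 * ((1 + q) / (1 - q)) - 1 = em_kernel x / (1 - exp (- x))"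
      using e unfolding em_kernel_def q_def[symmetric] by (simp add: diff_divide_distrib)
    finally show ?thesis .
  qed
  ultimately have "(\<lambda>n. complex_of_real (2 * x\<^sup>2 / (x\<^sup>2 + (2 * pi * real (Suc n))\<^sup>2))) sums of_real (em_kernel x / (1 - exp (- x)))"
    by (simp only:)
  then show ?thesis by (simp only: sums_of_real_iff)
qed

section \<open>The Mellin transform of \<open>1 / (1 + x^2)\<close>\<close>

text \<open>Euler's integral after substituting \<open>x^2\<close>; it is the inner integral of the
  Fubini argument below.\<close>

lemma has_pos_integral_gauss:
  assumes s: "Re s > -1" and v: "v > 0"
  shows "has_pos_integral (\<lambda>x. of_real x powr s * of_real (exp (- v * x\<^sup>2)))
           (Gamma ((1 + s) / 2) * of_real v powr (- ((1 + s) / 2)) / 2)"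
proof -
  let ?z = "(1 + s) / 2"
  let ?f = "\<lambda>x. of_real x powr (?z - 1) * of_real (exp (- v * x)) :: complex"
  let ?J = "Gamma ?z * of_real v powr (- ?z)"
  have im: "(\<lambda>x::real. x\<^sup>2) ` {0<..} = {0<..}"
  proof (intro equalityI subsetI)
    fix y :: real assume "y \<in> {0<..}"
    then show "y \<in> (\<lambda>x. x\<^sup>2) ` {0<..}" by (intro image_eqI[of _ _ "sqrt y"]) auto
  qed auto
  have c: "continuous_on {0<..} ?f" by (intro continuous_intros)
  have "has_pos_integral ?f ?J" using s v by (intro has_pos_integral_Gamma) auto
  then have "?f absolutely_integrable_on {0<..} \<and> integral {0<..} ?f = ?J"
    unfolding has_pos_integral_HK[OF c] .
  then have "(\<lambda>x. \<bar>2 * x\<bar> *\<^sub>R ?f (x\<^sup>2)) absolutely_integrable_on {0<..} \<and> integral {0<..} (\<lambda>x. \<bar>2 * x\<bar> *\<^sub>R ?f (x\<^sup>2)) = ?J"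
    by (subst has_absolute_integral_change_of_variables_real[of "{0<..}" "\<lambda>x. x\<^sup>2" "\<lambda>x. 2 * x" ?f])
       (auto intro!: derivative_eq_intros inj_onI simp: im)
  moreover have "continuous_on {0<..} (\<lambda>x. \<bar>2 * x\<bar> *\<^sub>R ?f (x\<^sup>2))"
    by (intro continuous_intros continuous_on_compose2[OF continuous_on_of_real_powr, of _ "\<lambda>x. x\<^sup>2"]) auto
  ultimately have "has_pos_integral (\<lambda>x. \<bar>2 * x\<bar> *\<^sub>R ?f (x\<^sup>2)) ?J"
    by (subst has_pos_integral_HK)
  from has_pos_integral_cmult[OF this, of "1 / 2"]
  have "has_pos_integral (\<lambda>x. 1 / 2 * (\<bar>2 * x\<bar> *\<^sub>R ?f (x\<^sup>2))) (?J / 2)" by simp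
  then show ?thesis
  proof (subst has_pos_integral_cong)
    fix x :: real assume x: "x > 0"
    have "of_real (x\<^sup>2) powr (?z - 1) = (of_real x powr 2) powr (?z - 1)"
      using x by (simp add: powr_nat')
    also have "\<dots> = of_real x powr (s - 1)"
    proof -
      have "complex_of_real (x\<^sup>2) powr (?z - 1) = exp ((?z - 1) * of_real (ln (x\<^sup>2)))"
        using x by (simp add: powr_def Ln_of_real del: of_real_power)
      also have "ln (x\<^sup>2) = 2 * ln x" using x by (simp add: ln_realpow)
      also have "(?z - 1) * of_real (2 * ln x) = (s - 1) * of_real (ln x)" by (simp add: field_simps)
      also have "exp ((s - 1) * of_real (ln x)) = of_real x powr (s - 1)"
        using x by (simp add: powr_def Ln_of_real)
      finally show ?thesis using x by (simp add: powr_nat')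
    qed
    finally have "of_real x * of_real (x\<^sup>2) powr (?z - 1) = (of_real x powr s :: complex)"
      using x powr_add[of "complex_of_real x" "s - 1" 1] by simp
    then show "of_real x powr s * of_real (exp (- v * x\<^sup>2)) = 1 / 2 * (\<bar>2 * x\<bar> *\<^sub>R ?f (x\<^sup>2))"
      using x by (simp add: scaleR_conv_of_real flip: mult.assoc)
  qed simp
qed

text \<open>Write \<open>1 / (1 + x^2)\<close> as the integral of
  \<open>exp (- v) * exp (- v * x^2)\<close> over \<open>v\<close> and exchange the order: the
  integral over \<open>x\<close> produces the first Gamma factor and a power of \<open>v\<close>,
  whose integral is the second. Tonelli applies because integrating the norm over \<open>v\<close>
  returns \<open>x powr Re s / (1 + x^2)\<close>.\<close>

lemma has_pos_integral_powr_over_1_plus_square: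
  assumes s: "-1 < Re s" "Re s < 1"
  shows "has_pos_integral (\<lambda>x. of_real x powr s / of_real (1 + x\<^sup>2)) (Gamma ((1 + s) / 2) * Gamma ((1 - s) / 2) / 2)"
proof -
  let ?I = "indicator {0<..} :: real \<Rightarrow> real"
  define g h where "g = (\<lambda>x. ?I x *\<^sub>R (of_real x powr s :: complex))" and "h = (\<lambda>v. ?I v *\<^sub>R complex_of_real (exp (- v)))"
  define f where "f = (\<lambda>x v. g x * (h v * complex_of_real (exp (- v * x\<^sup>2))))"
  have gm [measurable]: "g \<in> borel_measurable borel"
    unfolding g_def by (intro borel_measurable_continuous_on_indicator continuous_intros) auto
  have hm [measurable]: "h \<in> borel_measurable borel"
    unfolding h_def by (intro borel_measurable_continuous_on_indicator continuous_intros) auto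
  have c: "continuous_on {0<..} (\<lambda>x. of_real x powr s / complex_of_real (1 + x\<^sup>2))"
  proof -
    have "1 + (complex_of_real x)\<^sup>2 \<noteq> 0" for x
    proof -
      have "1 + (complex_of_real x)\<^sup>2 = of_real (1 + x\<^sup>2)" by simp
      moreover have "1 + x\<^sup>2 \<noteq> 0" using zero_le_power2[of x] by linarith
      ultimately show ?thesis by (metis of_real_eq_0_iff)
    qed
    then show ?thesis by (intro continuous_intros) auto
  qed
  have norm: "cmod (of_real x powr s / complex_of_real (1 + x\<^sup>2)) = x powr Re s / (1 + x\<^sup>2)" if "x > 0" for x
  proof -
    have "cmod (complex_of_real (1 + x\<^sup>2)) = 1 + x\<^sup>2" by (simp only: norm_of_real) simp
    then show ?thesis using that by (simp only: norm_divide) (simp add: norm_powr_real_powr)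
  qed
  have int: "set_integrable lborel {0<..} (\<lambda>x. of_real x powr s / complex_of_real (1 + x\<^sup>2))"
  proof (rule set_integrable_pos_bound[OF c, where \<alpha> = "Re s" and \<beta> = "Re s - 2" and C = 1])
    fix x :: real assume x: "x > 0"
    show "cmod (of_real x powr s / complex_of_real (1 + x\<^sup>2)) \<le> 1 * x powr Re s"
      unfolding norm[OF x] using divide_left_mono[of 1 "1 + x\<^sup>2" "x powr Re s"] by (simp add: add_pos_nonneg)
    show "cmod (of_real x powr s / complex_of_real (1 + x\<^sup>2)) \<le> 1 * x powr (Re s - 2)"
      unfolding norm[OF x] using x divide_left_mono[of "x\<^sup>2" "1 + x\<^sup>2" "x powr Re s"] by (simp add: powr_diff add_pos_pos)
  qed (use s in auto)
  have inner_v: "has_pos_integral (\<lambda>v. of_real (exp (- v)) * of_real (exp (- v * x\<^sup>2))) (1 / of_real (1 + x\<^sup>2))" for x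
  proof -
    have p: "1 + x\<^sup>2 > 0" using zero_le_power2[of x] by linarith
    have "has_pos_integral (\<lambda>v. of_real v powr (1 - 1) * of_real (exp (- (1 + x\<^sup>2) * v))) (Gamma 1 * of_real (1 + x\<^sup>2) powr (- 1))"
      using p by (intro has_pos_integral_Gamma) auto
    moreover have "Gamma 1 * of_real (1 + x\<^sup>2) powr (- 1) = 1 / complex_of_real (1 + x\<^sup>2)"
      using p by (simp add: powr_minus powr_of_real inverse_eq_divide del: of_real_add)
    ultimately show ?thesis
    proof (subst has_pos_integral_cong)
      fix v :: real assume "v > 0"
      have "exp (- v) * exp (- v * x\<^sup>2) = exp (- (1 + x\<^sup>2) * v)" by (simp add: exp_add[symmetric] algebra_simps)
      then show "of_real (exp (- v)) * of_real (exp (- v * x\<^sup>2)) = of_real v powr (1 - 1) * complex_of_real (exp (- (1 + x\<^sup>2) * v))"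
        using \<open>v > 0\<close> by (simp flip: of_real_mult)
    qed simp
  qed
  have fv: "integrable lborel (f x)" "(\<integral>v. f x v \<partial>lborel) = g x / of_real (1 + x\<^sup>2)" for x
  proof -
    from has_pos_integral_cmult[OF inner_v[of x], of "g x"]
    have 1: "has_pos_integral (\<lambda>v. g x * (of_real (exp (- v)) * of_real (exp (- v * x\<^sup>2)))) (g x / of_real (1 + x\<^sup>2))" by simp
    have 2: "f x v = ?I v *\<^sub>R (g x * (of_real (exp (- v)) * of_real (exp (- v * x\<^sup>2))))" for v
      by (simp add: f_def h_def indicator_def)
    show "integrable lborel (f x)" "(\<integral>v. f x v \<partial>lborel) = g x / of_real (1 + x\<^sup>2)"
      using 1 unfolding 2 has_pos_integral_def set_integrable_def set_lebesgue_integral_def by auto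
  qed
  have fx: "(\<integral>x. f x v \<partial>lborel) = ?I v *\<^sub>R (Gamma ((1 + s) / 2) / 2 * (of_real v powr ((1 - s) / 2 - 1) * of_real (exp (- 1 * v))))" for v
  proof (cases "v > 0")
    case True
    from has_pos_integral_cmult[OF has_pos_integral_gauss[OF s(1) True], of "of_real (exp (- v))"]
    have "(\<integral>x. ?I x *\<^sub>R (of_real (exp (- v)) * (of_real x powr s * of_real (exp (- v * x\<^sup>2)))) \<partial>lborel)
      = of_real (exp (- v)) * (Gamma ((1 + s) / 2) * of_real v powr (- ((1 + s) / 2)) / 2)"
      by (simp only: has_pos_integral_def set_lebesgue_integral_def)
    moreover have "?I x *\<^sub>R (of_real (exp (- v)) * (of_real x powr s * of_real (exp (- v * x\<^sup>2)))) = f x v" for x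
      using True by (simp add: f_def g_def h_def indicator_def)
    moreover have "- ((1 + s) / 2) = (1 - s) / 2 - 1" by (simp add: field_simps)
    ultimately show ?thesis using True by simp
  next
    case False
    then show ?thesis by (simp add: f_def h_def)
  qed
  have meas: "case_prod f \<in> borel_measurable (lborel \<Otimes>\<^sub>M lborel)"
    unfolding f_def by measurable
  have "integrable (lborel \<Otimes>\<^sub>M lborel) (case_prod f)"
  proof (rule lborel_pair.Fubini_integrable[OF meas])
    have nf: "norm (f x v) = norm (g x) * (?I v * (exp (- v) * exp (- v * x\<^sup>2)))" for x v
      by (simp add: f_def h_def norm_mult indicator_def)
    have "(\<integral>v. ?I v * (exp (- v) * exp (- v * x\<^sup>2)) \<partial>lborel) = 1 / (1 + x\<^sup>2)" for x
    proof -
      have "complex_of_real (LINT v:{0<..}|lborel. exp (- v) * exp (- v * x\<^sup>2)) = 1 / of_real (1 + x\<^sup>2)"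
        using inner_v[of x] by (intro set_integral_of_real_eq) simp
      then have "complex_of_real (LINT v:{0<..}|lborel. exp (- v) * exp (- v * x\<^sup>2)) = of_real (1 / (1 + x\<^sup>2))" by simp
      then show ?thesis unfolding of_real_eq_iff by (simp add: set_lebesgue_integral_def)
    qed
    then have "(\<integral>v. norm (f x v) \<partial>lborel) = norm (g x / of_real (1 + x\<^sup>2))" for x
      unfolding nf by (simp add: norm_divide del: of_real_add)
    moreover have "integrable lborel (\<lambda>x. norm (g x / of_real (1 + x\<^sup>2)))"
    proof (rule integrable_norm)
      have "g x / of_real (1 + x\<^sup>2) = ?I x *\<^sub>R (of_real x powr s / complex_of_real (1 + x\<^sup>2))" for x
        unfolding g_def by (simp only: scaleR_conv_of_real times_divide_eq_right)
      then show "integrable lborel (\<lambda>x. g x / complex_of_real (1 + x\<^sup>2))"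
        using int unfolding set_integrable_def by (simp only:)
    qed
    ultimately show "integrable lborel (\<lambda>x. \<integral>v. norm (case_prod f (x, v)) \<partial>lborel)" by simp
    show "AE x in lborel. integrable lborel (\<lambda>v. case_prod f (x, v))" using fv by simp
  qed
  from lborel_pair.Fubini_integral[OF this]
  have "(\<integral>v. (\<integral>x. f x v \<partial>lborel) \<partial>lborel) = (\<integral>x. (\<integral>v. f x v \<partial>lborel) \<partial>lborel)" .
  moreover have "(\<integral>v. (\<integral>x. f x v \<partial>lborel) \<partial>lborel) = Gamma ((1 + s) / 2) / 2 * (Gamma ((1 - s) / 2) * of_real 1 powr (- ((1 - s) / 2)))"
  proof -
    have "has_pos_integral (\<lambda>v. of_real v powr ((1 - s) / 2 - 1) * of_real (exp (- 1 * v))) (Gamma ((1 - s) / 2) * of_real 1 powr (- ((1 - s) / 2)))"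
      by (rule has_pos_integral_Gamma) (use s in auto)
    from has_pos_integral_cmult[OF this, of "Gamma ((1 + s) / 2) / 2"] show ?thesis
      unfolding fx by (simp only: has_pos_integral_def set_lebesgue_integral_def)
  qed
  moreover have "(\<integral>x. (\<integral>v. f x v \<partial>lborel) \<partial>lborel) = (LINT x:{0<..}|lborel. of_real x powr s / of_real (1 + x\<^sup>2))"
    unfolding fv g_def set_lebesgue_integral_def by (simp only: scaleR_conv_of_real times_divide_eq_right)
  ultimately show ?thesis using int by (simp add: has_pos_integral_def)
qed

section \<open>The two evaluations compared\<close>

text \<open>In the partial fraction expansion, scaling by \<open>b k = 2 pi (k + 1)\<close> reduces
  each term to the transform of \<open>1 / (1 + x^2)\<close> times \<open>b k powr (s - 1)\<close>.
  Summing over \<open>k\<close> gives \<open>\<zeta>(1 - s)\<close> by its Dirichlet series, as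
  \<open>Re (1 - s) > 1\<close>.\<close>

lemma zeta1_functional_equation_aux:
  assumes s: "-1 < Re s" "Re s < 0"
  shows "Gamma (s + 1) * zeta1 s =
    (1 - s) * of_real (2 * pi) powr (s - 1) * Gamma ((1 + s) / 2) * Gamma ((1 - s) / 2) * zeta1 (1 - s)"
proof -
  define b where "b = (\<lambda>k. 2 * pi * real (Suc k))"
  have b: "b k > 0" for k by (simp add: b_def)
  let ?f = "\<lambda>k x. of_real x powr (s - 2) * of_real (2 * x\<^sup>2 / (x\<^sup>2 + (b k)\<^sup>2))"
  let ?g = "\<lambda>x. of_real x powr (s - 2) * of_real (em_kernel x / (1 - exp (- x)))"
  \<comment> \<open>Stated for a free \<open>z\<close>, since it is used at \<open>s\<close> for the
    values and at the real point \<open>Re s\<close> for the integrals of the norms.\<close>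
  have gen: "has_pos_integral (\<lambda>x. of_real x powr (z - 2) * of_real (2 * x\<^sup>2 / (x\<^sup>2 + (b k)\<^sup>2)))
      (of_real (b k) powr (z - 1) * (Gamma ((1 + z) / 2) * Gamma ((1 - z) / 2)))" if z: "-1 < Re z" "Re z < 1" for z k
  proof -
    let ?G = "Gamma ((1 + z) / 2) * Gamma ((1 - z) / 2) / 2"
    have I: "has_pos_integral (\<lambda>x. of_real x powr z / of_real (1 + x\<^sup>2)) ?G"
      by (rule has_pos_integral_powr_over_1_plus_square[OF z])
    have c: "continuous_on {0<..} (\<lambda>x. of_real x powr z / complex_of_real (1 + x\<^sup>2))"
    proof -
      have "1 + (complex_of_real x)\<^sup>2 \<noteq> 0" for x
      proof -
        have "1 + (complex_of_real x)\<^sup>2 = of_real (1 + x\<^sup>2)" by simp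
        moreover have "1 + x\<^sup>2 \<noteq> 0" using zero_le_power2[of x] by linarith
        ultimately show ?thesis by (metis of_real_eq_0_iff)
      qed
      then show ?thesis by (intro continuous_intros) auto
    qed
    from has_pos_integral_cmult[OF has_pos_integral_scale[OF c _ I, of "1 / b k"], of "2 * of_real (b k) powr z / of_real ((b k)\<^sup>2)"] b[of k]
    have "has_pos_integral (\<lambda>x. 2 * of_real (b k) powr z / of_real ((b k)\<^sup>2) * (of_real (1 / b k * x) powr z / of_real (1 + (1 / b k * x)\<^sup>2)))
       (2 * of_real (b k) powr z / of_real ((b k)\<^sup>2) * (?G / of_real (1 / b k)))" by simp
    moreover have "2 * of_real (b k) powr z / of_real ((b k)\<^sup>2) * (?G / of_real (1 / b k)) = of_real (b k) powr (z - 1) * (Gamma ((1 + z) / 2) * Gamma ((1 - z) / 2))"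
      using b[of k] by (simp add: powr_diff field_simps power2_eq_square)
    ultimately show ?thesis
    proof (subst has_pos_integral_cong)
      fix x :: real assume x: "x > 0"
      have "of_real (b k) powr z * of_real (1 / b k * x) powr z = (of_real (b k * (1 / b k * x)) powr z :: complex)"
        using x b[of k] by (subst of_real_mult, subst powr_times_real) auto
      then have e: "of_real (b k) powr z * of_real (1 / b k * x) powr z = (of_real x powr z :: complex)" using b[of k] by simp
      have "2 * of_real (b k) powr z / of_real ((b k)\<^sup>2) * (of_real (1 / b k * x) powr z / of_real (1 + (1 / b k * x)\<^sup>2))
        = (of_real (b k) powr z * of_real (1 / b k * x) powr z) * of_real (2 / ((b k)\<^sup>2 * (1 + (1 / b k * x)\<^sup>2)))"
        by simp
      also have "2 / ((b k)\<^sup>2 * (1 + (1 / b k * x)\<^sup>2)) = 2 / (x\<^sup>2 + (b k)\<^sup>2)"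
      proof -
        have "(b k)\<^sup>2 * (1 + (1 / b k * x)\<^sup>2) = x\<^sup>2 + (b k)\<^sup>2"
          using b[of k] by (simp add: field_simps power2_eq_square)
        then show ?thesis by simp
      qed
      also have "(of_real (b k) powr z * of_real (1 / b k * x) powr z) * of_real (2 / (x\<^sup>2 + (b k)\<^sup>2)) =
         of_real x powr (z - 2) * of_real (x\<^sup>2) * complex_of_real (2 / (x\<^sup>2 + (b k)\<^sup>2))"
        unfolding e using x by (simp add: powr_diff powr_nat' )
      finally show "of_real x powr (z - 2) * of_real (2 * x\<^sup>2 / (x\<^sup>2 + (b k)\<^sup>2)) =
        2 * of_real (b k) powr z / of_real ((b k)\<^sup>2) * (of_real (1 / b k * x) powr z / complex_of_real (1 + (1 / b k * x)\<^sup>2))"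
        by simp
    qed simp
  qed
  have nrm: "cmod (of_real x powr (z - 2) * of_real q) = x powr (Re z - 2) * q" if "x > 0" "q \<ge> 0" for x q :: real and z :: complex
    using that by (simp add: norm_mult norm_powr_real_powr)
  have b0: "0 \<le> 2 * x\<^sup>2 / (x\<^sup>2 + (b n)\<^sup>2)" for x n by simp
  let ?I = "\<lambda>k. of_real (b k) powr (s - 1) * (Gamma ((1 + s) / 2) * Gamma ((1 - s) / 2))"
  have "?I sums (LINT x:{0<..}|lborel. ?g x)"
  proof (rule has_pos_integral_sums)
    show "has_pos_integral (?f n) (?I n)" for n using s by (intro gen) auto
    fix x :: real assume x: "x > 0"
    have pf: "(\<lambda>n. 2 * x\<^sup>2 / (x\<^sup>2 + (b n)\<^sup>2)) sums (em_kernel x / (1 - exp (- x)))"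
      unfolding b_def by (rule em_kernel_partial_fractions[OF x])
    show "(\<lambda>n. ?f n x) sums ?g x" by (intro sums_mult sums_of_real pf)
    show "summable (\<lambda>n. cmod (?f n x))"
      unfolding nrm[OF x b0] by (intro summable_mult sums_summable[OF pf])
  next
    define \<sigma> where "\<sigma> = Re s"
    let ?\<sigma> = "complex_of_real \<sigma>"
    define c where "c = cmod (Gamma ((1 + ?\<sigma>) / 2) * Gamma ((1 - ?\<sigma>) / 2))"
    have nv: "norm (LINT x:{0<..}|lborel. cmod (?f n x)) = c * b n powr (\<sigma> - 1)" for n
    proof -
      have eq: "(LINT x:{0<..}|lborel. cmod (?f n x)) = (LINT x:{0<..}|lborel. x powr (\<sigma> - 2) * (2 * x\<^sup>2 / (x\<^sup>2 + (b n)\<^sup>2)))"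
      proof (rule set_lebesgue_integral_cong)
        show "\<forall>x. x \<in> {0<..} \<longrightarrow> cmod (?f n x) = x powr (\<sigma> - 2) * (2 * x\<^sup>2 / (x\<^sup>2 + (b n)\<^sup>2))"
          unfolding \<sigma>_def using nrm[OF _ b0, of _ s _ n] by blast
      qed simp
      have "has_pos_integral (\<lambda>x. of_real (x powr (\<sigma> - 2) * (2 * x\<^sup>2 / (x\<^sup>2 + (b n)\<^sup>2))))
          (of_real (b n) powr (?\<sigma> - 1) * (Gamma ((1 + ?\<sigma>) / 2) * Gamma ((1 - ?\<sigma>) / 2)))"
      proof (subst has_pos_integral_cong)
        show "has_pos_integral (\<lambda>x. of_real x powr (?\<sigma> - 2) * of_real (2 * x\<^sup>2 / (x\<^sup>2 + (b n)\<^sup>2)))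
          (of_real (b n) powr (?\<sigma> - 1) * (Gamma ((1 + ?\<sigma>) / 2) * Gamma ((1 - ?\<sigma>) / 2)))"
          by (rule gen) (use s in \<open>auto simp: \<sigma>_def\<close>)
      next
        fix x :: real assume "x > 0"
        then show "of_real (x powr (\<sigma> - 2) * (2 * x\<^sup>2 / (x\<^sup>2 + (b n)\<^sup>2))) =
          of_real x powr (?\<sigma> - 2) * complex_of_real (2 * x\<^sup>2 / (x\<^sup>2 + (b n)\<^sup>2))"
          using powr_of_real[of x "\<sigma> - 2"] by simp
      qed
      from set_integral_of_real_eq[OF this]
      have val: "complex_of_real (LINT x:{0<..}|lborel. cmod (?f n x)) = of_real (b n) powr (?\<sigma> - 1) * (Gamma ((1 + ?\<sigma>) / 2) * Gamma ((1 - ?\<sigma>) / 2))"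
        unfolding eq .
      have "norm (LINT x:{0<..}|lborel. cmod (?f n x)) = cmod (complex_of_real (LINT x:{0<..}|lborel. cmod (?f n x)))"
        by simp
      also have "\<dots> = c * b n powr (\<sigma> - 1)" unfolding val using b[of n] by (simp add: c_def norm_mult norm_powr_real_powr)
      finally show ?thesis .
    qed
    have "summable (\<lambda>n. c * ((2 * pi) powr (\<sigma> - 1) * real (Suc n) powr (\<sigma> - 1)))"
      using s by (intro summable_mult summable_Suc_powr) (auto simp: \<sigma>_def)
    also have "(\<lambda>n. c * ((2 * pi) powr (\<sigma> - 1) * real (Suc n) powr (\<sigma> - 1))) = (\<lambda>n. c * b n powr (\<sigma> - 1))"
      by (simp add: b_def powr_mult del: of_nat_Suc)
    finally show "summable (\<lambda>n. LINT x:{0<..}|lborel. cmod (?f n x))"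
      by (rule summable_comparison_test') (use nv in auto)
  qed
  then have 1: "?I sums (Gamma (s + 1) * zeta1 s / (s * (s - 1)))"
    unfolding integral_em_kernel_series[OF s] .
  have "(\<lambda>n. of_real (2 * pi) powr (s - 1) * of_nat (Suc n) powr (- (1 - s)) * (Gamma ((1 + s) / 2) * Gamma ((1 - s) / 2))) sums
     (of_real (2 * pi) powr (s - 1) * riemann_zeta (1 - s) * (Gamma ((1 + s) / 2) * Gamma ((1 - s) / 2)))"
    using s by (intro sums_mult2 sums_mult riemann_zeta_sums) auto
  moreover have "of_real (2 * pi) powr (s - 1) * of_nat (Suc n) powr (- (1 - s)) = of_real (b n) powr (s - 1)" for n
    unfolding b_def using powr_times_real[of "of_real (2 * pi)" "of_nat (Suc n)" "s - 1"] by simp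
  ultimately have "?I sums (of_real (2 * pi) powr (s - 1) * riemann_zeta (1 - s) * (Gamma ((1 + s) / 2) * Gamma ((1 - s) / 2)))"
    by (simp only:)
  with 1 have eq: "Gamma (s + 1) * zeta1 s / (s * (s - 1)) = of_real (2 * pi) powr (s - 1) * riemann_zeta (1 - s) * (Gamma ((1 + s) / 2) * Gamma ((1 - s) / 2))"
    by (rule sums_unique2)
  have s0: "s \<noteq> 0" "s \<noteq> 1" "1 - s \<noteq> 1" using s by auto
  have "Gamma (s + 1) * zeta1 s = (Gamma (s + 1) * zeta1 s / (s * (s - 1))) * (s * (s - 1))" using s0 by simp
  also have "\<dots> = (1 - s) * of_real (2 * pi) powr (s - 1) * Gamma ((1 + s) / 2) * Gamma ((1 - s) / 2) * zeta1 (1 - s)"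
    unfolding eq zeta1_eq[OF s0(3)] by (simp add: algebra_simps)
  finally show ?thesis .
qed

text \<open>Continuation past \<open>Re s = 0\<close> brings in the imaginary axis. The Gamma
  factors stay unsimplified: they have neither zeros nor poles in the strip, which suffices for
  reflecting zeros.\<close>

lemma zeta1_functional_equation:
  assumes s: "-1 < Re s" "Re s < 1"
  shows "Gamma (s + 1) * zeta1 s =
    (1 - s) * of_real (2 * pi) powr (s - 1) * Gamma ((1 + s) / 2) * Gamma ((1 - s) / 2) * zeta1 (1 - s)"
proof (rule analytic_continuation_open[of "{s. -1 < Re s \<and> Re s < 0}" "{s. -1 < Re s \<and> Re s < 1}" "\<lambda>s. Gamma (s + 1) * zeta1 s"
    "\<lambda>s. (1 - s) * of_real (2 * pi) powr (s - 1) * Gamma ((1 + s) / 2) * Gamma ((1 - s) / 2) * zeta1 (1 - s)"])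
  have o: "open {s. a < Re s \<and> Re s < c}" and cn: "connected {s. a < Re s \<and> Re s < c}" for a c
  proof -
    have "{s. a < Re s \<and> Re s < c} = {s. a < Re s} \<inter> {s. Re s < c}" by auto
    then show "open {s. a < Re s \<and> Re s < c}" "connected {s. a < Re s \<and> Re s < c}"
      by (simp_all add: open_Int open_halfspace_Re_gt open_halfspace_Re_lt convex_connected convex_Int convex_halfspace_Re_gt convex_halfspace_Re_lt)
  qed
  show "open {s. -1 < Re s \<and> Re s < 0}" "open {s. -1 < Re s \<and> Re s < 1}" "connected {s. -1 < Re s \<and> Re s < 1}"
    by (rule o, rule o, rule cn)
  show "{s. -1 < Re s \<and> Re s < 0} \<noteq> {}" by (auto intro: exI[of _ "- 1 / 2"])
  have np: "z \<notin> \<int>\<^sub>\<le>\<^sub>0" if "Re z > 0" for z :: complex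
    using that by (auto elim!: nonpos_Ints_cases)
  show "(\<lambda>s. Gamma (s + 1) * zeta1 s) holomorphic_on {s. -1 < Re s \<and> Re s < 1}"
    by (intro holomorphic_intros) (auto intro!: np)
  show "(\<lambda>s. (1 - s) * of_real (2 * pi) powr (s - 1) * Gamma ((1 + s) / 2) * Gamma ((1 - s) / 2) * zeta1 (1 - s)) holomorphic_on {s. -1 < Re s \<and> Re s < 1}"
    by (intro holomorphic_intros) (auto intro!: np simp: complex_nonpos_Reals_iff)
next
  fix z :: complex assume "z \<in> {s. -1 < Re s \<and> Re s < 0}"
  then show "Gamma (z + 1) * zeta1 z =
      (1 - z) * of_real (2 * pi) powr (z - 1) * Gamma ((1 + z) / 2) * Gamma ((1 - z) / 2) * zeta1 (1 - z)"
    by (intro zeta1_functional_equation_aux) auto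
qed (use s in auto)

section \<open>The Dirichlet series of the von Mangoldt function\<close>

lemma mangoldt_le_ln: "n > 0 \<Longrightarrow> (mangoldt n :: real) \<le> ln (real n)"
proof -
  assume n: "n > 0"
  have "(mangoldt n :: real) \<le> (\<Sum>d | d dvd n. mangoldt d)"
    using n by (intro member_le_sum) (auto simp: mangoldt_nonneg)
  then show ?thesis using n by (simp add: mangoldt_sum)
qed

lemma summable_ln_powr:
  assumes "\<sigma> > 1"
  shows "summable (\<lambda>n. ln (real (Suc n)) * real (Suc n) powr (- \<sigma>))"
proof (rule summable_comparison_test')
  define \<epsilon> where "\<epsilon> = (\<sigma> - 1) / 2"
  have \<epsilon>: "\<epsilon> > 0" using assms by (simp add: \<epsilon>_def)
  show "summable (\<lambda>n. 1 / \<epsilon> * real (Suc n) powr (\<epsilon> - \<sigma>))"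
    using assms by (intro summable_mult summable_Suc_powr) (simp add: \<epsilon>_def field_simps)
  fix n
  have "ln (real (Suc n)) * real (Suc n) powr (- \<sigma>) \<le> real (Suc n) powr \<epsilon> / \<epsilon> * real (Suc n) powr (- \<sigma>)"
    using \<epsilon> by (intro mult_right_mono ln_powr_bound) auto
  also have "\<dots> = 1 / \<epsilon> * real (Suc n) powr (\<epsilon> - \<sigma>)"
    using powr_add[of "real (Suc n)" \<epsilon> "- \<sigma>"] by simp
  finally show "norm (ln (real (Suc n)) * real (Suc n) powr (- \<sigma>)) \<le> 1 / \<epsilon> * real (Suc n) powr (\<epsilon> - \<sigma>)"
    by simp
qed

lemma summable_mangoldt_powr:
  assumes "\<sigma> > 1"
  shows "summable (\<lambda>n. mangoldt (Suc n) * real (Suc n) powr (- \<sigma>))"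
proof (rule summable_comparison_test'[OF summable_ln_powr[OF assms]])
  fix n
  show "norm (mangoldt (Suc n) * real (Suc n) powr (- \<sigma>)) \<le> ln (real (Suc n)) * real (Suc n) powr (- \<sigma>)"
    using mangoldt_le_ln[of "Suc n"] by (simp add: mangoldt_nonneg mult_right_mono del: of_nat_Suc)
qed

definition mangoldt_series :: "complex \<Rightarrow> complex" where
  "mangoldt_series s = (\<Sum>n. mangoldt (Suc n) * of_nat (Suc n) powr (- s))"

lemma norm_of_nat_Suc_powr: "cmod (of_nat (Suc n) powr s) = real (Suc n) powr Re s"
  by (rule norm_of_nat_powr) simp

lemma mangoldt_series_sums:
  assumes "Re s > 1"
  shows "(\<lambda>n. mangoldt (Suc n) * of_nat (Suc n) powr (- s)) sums mangoldt_series s"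
proof -
  have "summable (\<lambda>n. mangoldt (Suc n) * of_nat (Suc n) powr (- s))"
    by (rule summable_norm_cancel)
       (use summable_mangoldt_powr[OF assms] in \<open>simp add: norm_mult norm_of_nat_Suc_powr del: of_nat_Suc\<close>)
  then show ?thesis unfolding mangoldt_series_def by (rule summable_sums)
qed

lemma sums_imp_has_sum_pos:
  fixes f :: "nat \<Rightarrow> complex"
  assumes "(\<lambda>n. f (Suc n)) sums S" "summable (\<lambda>n. cmod (f (Suc n)))"
  shows "(f has_sum S) {0<..}"
proof -
  have "((\<lambda>n. f (Suc n)) has_sum S) UNIV"
    using assms by (intro norm_summable_imp_has_sum)
  moreover have "bij_betw Suc UNIV {0<..}"
    by (rule bij_betwI[of _ _ _ "\<lambda>n. n - 1"]) auto
  ultimately show ?thesis using has_sum_reindex_bij_betw by blast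
qed

lemma has_sum_pos_imp_sums:
  fixes f :: "nat \<Rightarrow> complex"
  assumes "(f has_sum S) {0<..}"
  shows "(\<lambda>n. f (Suc n)) sums S"
proof -
  have "bij_betw Suc UNIV {0<..}"
    by (rule bij_betwI[of _ _ _ "\<lambda>n. n - 1"]) auto
  then have "((\<lambda>n. f (Suc n)) has_sum S) UNIV"
    using has_sum_reindex_bij_betw assms by blast
  then show ?thesis by (rule has_sum_imp_sums)
qed

text \<open>The identity \<open>\<Sum>d | d dvd n. mangoldt d = ln n\<close>, read as a product of
  two absolutely convergent Dirichlet series.\<close>

lemma ln_series_sums:
  assumes s: "Re s > 1"
  shows "(\<lambda>n. of_real (ln (real (Suc n))) * of_nat (Suc n) powr (- s)) sums (mangoldt_series s * riemann_zeta s)"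
proof -
  define u v :: "nat \<Rightarrow> complex" where "u = (\<lambda>n. mangoldt n * of_nat n powr (- s))" and "v = (\<lambda>n. of_nat n powr (- s))"
  let ?A = "{0<..} :: nat set"
  have su: "summable (\<lambda>n. cmod (u (Suc n)))"
    using summable_mangoldt_powr[OF s] by (simp add: u_def norm_mult norm_of_nat_Suc_powr del: of_nat_Suc)
  have sv: "summable (\<lambda>n. cmod (v (Suc n)))"
    using summable_Suc_powr[of "- Re s"] s by (simp add: v_def norm_of_nat_Suc_powr del: of_nat_Suc)
  have U: "(u has_sum mangoldt_series s) ?A"
    using su mangoldt_series_sums[OF s] unfolding u_def by (intro sums_imp_has_sum_pos)
  have V: "(v has_sum riemann_zeta s) ?A"
    using sv riemann_zeta_sums[OF s] unfolding v_def by (intro sums_imp_has_sum_pos)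
  have nU: "(\<lambda>n. norm (u n)) summable_on ?A"
  proof -
    have "(\<lambda>n. complex_of_real (cmod (u (Suc n)))) sums of_real (\<Sum>n. cmod (u (Suc n)))"
      by (intro sums_of_real summable_sums su)
    then have "((\<lambda>n. complex_of_real (cmod (u n))) has_sum of_real (\<Sum>n. cmod (u (Suc n)))) ?A"
      using su by (intro sums_imp_has_sum_pos) auto
    then show ?thesis using has_sum_of_real_iff[where 'a = complex] summable_on_def by blast
  qed
  have nV: "(\<lambda>n. norm (v n)) summable_on ?A"
  proof -
    have "(\<lambda>n. complex_of_real (cmod (v (Suc n)))) sums of_real (\<Sum>n. cmod (v (Suc n)))"
      by (intro sums_of_real summable_sums sv)
    then have "((\<lambda>n. complex_of_real (cmod (v n))) has_sum of_real (\<Sum>n. cmod (v (Suc n)))) ?A"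
      using sv by (intro sums_imp_has_sum_pos) auto
    then show ?thesis using has_sum_of_real_iff[where 'a = complex] summable_on_def by blast
  qed
  have sum: "(\<lambda>x. norm (case x of (d, m) \<Rightarrow> u d * v m)) summable_on ?A \<times> ?A"
    unfolding Infinite_Sum.abs_summable_on_Sigma_iff
  proof (intro conjI ballI)
    show "(\<lambda>m. norm (case (d, m) of (d, m) \<Rightarrow> u d * v m)) summable_on ?A" for d
      using summable_on_cmult_right[OF nV, of "norm (u d)"] by (simp add: norm_mult)
    show "(\<lambda>d. norm (infsum (\<lambda>m. norm (case (d, m) of (d, m) \<Rightarrow> u d * v m)) ?A)) summable_on ?A"
    proof -
      have "infsum (\<lambda>m. norm (u d * v m)) ?A = norm (u d) * infsum (\<lambda>m. norm (v m)) ?A" for d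
        unfolding norm_mult by (rule infsum_cmult_right')
      moreover have "infsum (\<lambda>m. norm (v m)) ?A \<ge> 0" by (intro infsum_nonneg) auto
      ultimately show ?thesis
        using summable_on_cmult_left[OF nU, of "infsum (\<lambda>m. norm (v m)) ?A"] by (simp add: abs_mult)
    qed
  qed
  have P: "((\<lambda>(d, m). u d * v m) has_sum mangoldt_series s * riemann_zeta s) (?A \<times> ?A)"
  proof (rule has_sum_SigmaI)
    show "((\<lambda>m. case (d, m) of (d, m) \<Rightarrow> u d * v m) has_sum u d * riemann_zeta s) ?A" for d
      using has_sum_cmult_right[OF V] by simp
    show "((\<lambda>d. u d * riemann_zeta s) has_sum mangoldt_series s * riemann_zeta s) ?A"
      by (rule has_sum_cmult_left[OF U])
    show "(\<lambda>(d, m). u d * v m) summable_on ?A \<times> ?A" by (rule abs_summable_summable[OF sum])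
  qed
  have "((\<lambda>(n, d). u d * v (n div d)) has_sum mangoldt_series s * riemann_zeta s) (SIGMA n:?A. {d. d dvd n})"
  \<comment> \<open>Pairs of positive factors \<open>(d, m)\<close> correspond to a number
    \<open>n = d * m\<close> with a chosen divisor \<open>d\<close>.\<close>
  proof (rule iffD2[OF has_sum_reindex_bij_witness[where i = "\<lambda>(d, m). (d * m, d)" and j = "\<lambda>(n, d). (d, n div d)"
      and h = "\<lambda>(d, m). u d * v m" and T = "?A \<times> ?A" and s' = "mangoldt_series s * riemann_zeta s"]])
    show "((\<lambda>(d, m). u d * v m) has_sum mangoldt_series s * riemann_zeta s) (?A \<times> ?A)" by (rule P)
    show "(\<lambda>(d, m). (d * m, d)) ((\<lambda>(n, d). (d, n div d)) a) = a" if "a \<in> (SIGMA n:?A. {d. d dvd n})" for a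
      using that by auto
    show "(\<lambda>(n, d). (d, n div d)) a \<in> ?A \<times> ?A" if "a \<in> (SIGMA n:?A. {d. d dvd n})" for a
      using that by (auto intro: dvd_pos_nat simp: dvd_div_eq_0_iff)
    show "(\<lambda>(n, d). (d, n div d)) ((\<lambda>(d, m). (d * m, d)) b) = b" if "b \<in> ?A \<times> ?A" for b
      using that by auto
    show "(\<lambda>(d, m). (d * m, d)) b \<in> (SIGMA n:?A. {d. d dvd n})" if "b \<in> ?A \<times> ?A" for b
      using that by auto
    show "(case (case a of (n, d) \<Rightarrow> (d, n div d)) of (d, m) \<Rightarrow> u d * v m) = (case a of (n, d) \<Rightarrow> u d * v (n div d))" for a
      by (cases a) auto
  qed auto
  then have "((\<lambda>n. \<Sum>d | d dvd n. u d * v (n div d)) has_sum mangoldt_series s * riemann_zeta s) ?A"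
  proof (rule has_sum_SigmaD)
    fix n :: nat assume "n \<in> ?A"
    then have "finite {d. d dvd n}" by simp
    then show "((\<lambda>d. case (n, d) of (n, d) \<Rightarrow> u d * v (n div d)) has_sum (\<Sum>d | d dvd n. u d * v (n div d))) {d. d dvd n}"
      by (simp add: has_sum_finite_iff)
  qed
  from has_sum_pos_imp_sums[OF this]
  have "(\<lambda>n. \<Sum>d | d dvd Suc n. u d * v (Suc n div d)) sums (mangoldt_series s * riemann_zeta s)" .
  moreover have "(\<Sum>d | d dvd Suc n. u d * v (Suc n div d)) = of_real (ln (real (Suc n))) * of_nat (Suc n) powr (- s)" for n
  proof -
    have "(\<Sum>d | d dvd Suc n. u d * v (Suc n div d)) = (\<Sum>d | d dvd Suc n. mangoldt d * of_nat (Suc n) powr (- s))"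
    proof (rule sum.cong[OF refl])
      fix d assume "d \<in> {d. d dvd Suc n}"
      then obtain m where m: "Suc n = d * m" by auto
      then have d: "d > 0" by (cases d) auto
      have "of_nat d powr (- s) * of_nat m powr (- s) = (of_nat d * of_nat m :: complex) powr (- s)"
        by (subst powr_times_real) auto
      then show "u d * v (Suc n div d) = mangoldt d * of_nat (Suc n) powr (- s)"
        using d by (simp add: u_def v_def m del: of_nat_Suc)
    qed
    also have "\<dots> = of_real (ln (real (Suc n))) * of_nat (Suc n) powr (- s)"
      by (subst sum_distrib_right[symmetric], subst mangoldt_sum) auto
    finally show ?thesis .
  qed
  ultimately show ?thesis by (simp only:)
qed

text \<open>Termwise differentiation gives the series of \<open>ln_series_sums\<close>. The product
  form needs no division by \<open>riemann_zeta\<close>, so it is available before that is known to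
  be nonzero.\<close>

lemma riemann_zeta_deriv:
  assumes s: "Re s > 1"
  shows "(riemann_zeta has_field_derivative - mangoldt_series s * riemann_zeta s) (at s)"
proof -
  let ?S = "{s. Re s > 1}"
  let ?f = "\<lambda>n s. of_nat (Suc n) powr (- s) :: complex"
  let ?f' = "\<lambda>n s. - (of_real (ln (real (Suc n))) * of_nat (Suc n) powr (- s)) :: complex"
  have "\<exists>g g'. \<forall>x\<in>?S. ((\<lambda>n. ?f n x) sums g x) \<and> ((\<lambda>n. ?f' n x) sums g' x) \<and> (g has_field_derivative g' x) (at x)"
  proof (rule series_and_derivative_comparison_complex)
    show "open ?S" by (rule open_halfspace_Re_gt)
    show "(?f n has_field_derivative ?f' n x) (at x)" for n x
    proof -
      have "complex_of_nat (Suc n) \<noteq> 0" by (simp del: of_nat_Suc)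
      then have e: "of_nat (Suc n) powr (- z) = exp (- z * of_real (ln (real (Suc n))))" for z :: complex
        by (simp add: powr_def Ln_of_nat del: of_nat_Suc)
      show ?thesis unfolding e by (auto intro!: derivative_eq_intros)
    qed
    fix x assume "x \<in> ?S"
    then have x: "Re x > 1" by simp
    define d where "d = (Re x - 1) / 2"
    have d: "d > 0" using x by (simp add: d_def)
    show "\<exists>d h. 0 < d \<and> summable h \<and> range h \<subseteq> \<real>\<^sub>\<ge>\<^sub>0 \<and> (\<forall>\<^sub>F n in sequentially. \<forall>y\<in>ball x d \<inter> ?S. cmod (?f n y) \<le> cmod (h n))"
    proof (rule exI[of _ d], rule exI[of _ "\<lambda>n. complex_of_real (real (Suc n) powr (- (1 + d)))"], intro conjI always_eventually allI ballI)
      show "summable (\<lambda>n. complex_of_real (real (Suc n) powr - (1 + d)))"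
        using d by (intro summable_of_real summable_Suc_powr) auto
      show "range (\<lambda>n. complex_of_real (real (Suc n) powr - (1 + d))) \<subseteq> \<real>\<^sub>\<ge>\<^sub>0" by auto
      fix n y assume "y \<in> ball x d \<inter> ?S"
      then have "\<bar>Re x - Re y\<bar> < d" using abs_Re_le_cmod[of "x - y"] by (simp add: dist_norm)
      then have "Re x - Re y < d" by linarith
      then have "Re y \<ge> 1 + d" unfolding d_def by argo
      then have "real (Suc n) powr (- Re y) \<le> real (Suc n) powr (- (1 + d))" by (intro powr_mono) auto
      then show "cmod (?f n y) \<le> cmod (complex_of_real (real (Suc n) powr (- (1 + d))))"
        by (simp add: norm_of_nat_Suc_powr del: of_nat_Suc)
    qed (use d in auto)
  qed
  then obtain g g' where g: "\<And>x. Re x > 1 \<Longrightarrow> (\<lambda>n. ?f n x) sums g x" "\<And>x. Re x > 1 \<Longrightarrow> (\<lambda>n. ?f' n x) sums g' x"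
    "\<And>x. Re x > 1 \<Longrightarrow> (g has_field_derivative g' x) (at x)" by blast
  have gz: "g x = riemann_zeta x" if "Re x > 1" for x
    using g(1)[OF that] riemann_zeta_sums[OF that] by (rule sums_unique2)
  have g's: "g' s = - mangoldt_series s * riemann_zeta s"
    using sums_unique2[OF g(2)[OF s] sums_minus[OF ln_series_sums[OF s]]] by simp
  show ?thesis
    by (rule has_field_derivative_transform_within_open[OF g(3)[OF s, unfolded g's] open_halfspace_Re_gt[of 1]])
       (use s in \<open>auto simp: gz\<close>)
qed

lemma mangoldt_series_holomorphic: "mangoldt_series holomorphic_on {s. Re s > 1}"
proof (rule holomorphic_uniform_sequence)
  show "open {s. Re s > 1}" by (rule open_halfspace_Re_gt)
  show "(\<lambda>s. \<Sum>i<n. mangoldt (Suc i) * of_nat (Suc i) powr (- s)) holomorphic_on {s. Re s > 1}" for n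
    by (intro holomorphic_intros)
  fix x assume "x \<in> {s. Re s > 1}"
  then have x: "Re x > 1" by simp
  define d where "d = (Re x - 1) / 2"
  have d: "d > 0" using x by (simp add: d_def)
  have re: "Re y \<ge> 1 + d" if "y \<in> cball x d" for y
  proof -
    have "\<bar>Re x - Re y\<bar> \<le> d" using that abs_Re_le_cmod[of "x - y"] by (simp add: dist_norm)
    then have "Re x - Re y \<le> d" by linarith
    then show ?thesis unfolding d_def by argo
  qed
  have "uniform_limit (cball x d) (\<lambda>n s. \<Sum>i<n. mangoldt (Suc i) * of_nat (Suc i) powr (- s)) mangoldt_series sequentially"
    unfolding mangoldt_series_def
  proof (rule Weierstrass_m_test)
    show "summable (\<lambda>n. mangoldt (Suc n) * real (Suc n) powr (- (1 + d)))"
      using d by (intro summable_mangoldt_powr) auto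
    show "cmod (mangoldt (Suc n) * of_nat (Suc n) powr (- y)) \<le> mangoldt (Suc n) * real (Suc n) powr (- (1 + d))"
      if "y \<in> cball x d" for n y
    proof -
      have "real (Suc n) powr (- Re y) \<le> real (Suc n) powr (- (1 + d))"
        using re[OF that] by (intro powr_mono) auto
      then show ?thesis
        unfolding norm_mult norm_mangoldt norm_of_nat_Suc_powr uminus_complex.sel by (rule mult_left_mono[OF _ mangoldt_nonneg])
    qed
  qed
  moreover have "cball x d \<subseteq> {s. Re s > 1}" using re d by force
  ultimately show "\<exists>d>0. cball x d \<subseteq> {s. Re s > 1} \<and>
      uniform_limit (cball x d) (\<lambda>n s. \<Sum>i<n. mangoldt (Suc i) * of_nat (Suc i) powr (- s)) mangoldt_series sequentially"
    using d by blast
qed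

section \<open>Absence of zeros in \<open>Re s \<ge> 1\<close>\<close>

text \<open>The zeta function solves a linear differential equation with coefficient
  \<open>- mangoldt_series\<close>: multiplied by the exponential of a primitive \<open>P\<close> it
  is constant, and the constant is nonzero because \<open>\<zeta>(2)\<close> is.\<close>

lemma riemann_zeta_nonzero_Re_gt_1:
  assumes s: "Re s > 1"
  shows "riemann_zeta s \<noteq> 0"
proof -
  let ?S = "{s. Re s > 1}"
  obtain P where P: "\<And>z. z \<in> ?S \<Longrightarrow> (P has_field_derivative mangoldt_series z) (at z within ?S)"
    by (rule holomorphic_convex_primitive'[OF convex_halfspace_Re_gt open_halfspace_Re_gt mangoldt_series_holomorphic], rule that)
  have "\<exists>c. \<forall>z\<in>?S. riemann_zeta z * exp (P z) = c"
  proof (rule has_field_derivative_zero_constant)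
    show "convex ?S" by (rule convex_halfspace_Re_gt)
    fix z assume z: "z \<in> ?S"
    then have dz: "(riemann_zeta has_field_derivative - mangoldt_series z * riemann_zeta z) (at z)"
      by (intro riemann_zeta_deriv) auto
    have dP: "(P has_field_derivative mangoldt_series z) (at z)"
      using P[OF z] at_within_open[OF z open_halfspace_Re_gt] by simp
    have "((\<lambda>z. exp (P z)) has_field_derivative exp (P z) * mangoldt_series z) (at z)"
      using dP by (auto intro!: derivative_eq_intros)
    from DERIV_mult[OF dz this]
    have "((\<lambda>z. riemann_zeta z * exp (P z)) has_field_derivative 0) (at z)" by (simp add: algebra_simps)
    then show "((\<lambda>z. riemann_zeta z * exp (P z)) has_field_derivative 0) (at z within ?S)"
      by (rule has_field_derivative_at_within)
  qed
  then obtain c where c: "\<And>z. Re z > 1 \<Longrightarrow> riemann_zeta z * exp (P z) = c" by blast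
  have "riemann_zeta (Complex 2 0) \<noteq> 0" using norm_zeta_2[of 0] by auto
  then have "c \<noteq> 0" using c[of "Complex 2 0"] by auto
  then show ?thesis using c[OF s] by auto
qed

lemma zeta1_logderiv:
  assumes s: "Re s > 1"
  shows "mangoldt_series s = 1 / (s - 1) - deriv zeta1 s / zeta1 s"
proof -
  have nz: "riemann_zeta s \<noteq> 0" "s - 1 \<noteq> 0" using riemann_zeta_nonzero_Re_gt_1[OF s] s by auto
  have "((\<lambda>s. (s - 1) * riemann_zeta s) has_field_derivative 1 * riemann_zeta s + (- mangoldt_series s * riemann_zeta s) * (s - 1)) (at s)"
    by (intro DERIV_mult riemann_zeta_deriv[OF s]) (auto intro!: derivative_eq_intros)
  then have "(zeta1 has_field_derivative 1 * riemann_zeta s + (- mangoldt_series s * riemann_zeta s) * (s - 1)) (at s)"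
    by (rule has_field_derivative_transform_within_open[OF _ open_halfspace_Re_gt[of 1]]) (use s in \<open>auto simp: zeta1_def\<close>)
  then have d: "deriv zeta1 s = riemann_zeta s + (- mangoldt_series s * riemann_zeta s) * (s - 1)"
    by (simp add: DERIV_imp_deriv)
  have z: "zeta1 s = (s - 1) * riemann_zeta s" using nz by (simp add: zeta1_def)
  have "D = 1 / a - (z + (- D * z) * a) / (a * z)" if "a \<noteq> 0" "z \<noteq> 0" for a z D :: complex
  proof -
    have "(z + (- D * z) * a) / (a * z) = z / (a * z) - (D * (a * z)) / (a * z)"
      by (simp add: diff_divide_distrib mult_ac)
    also have "\<dots> = 1 / a - D" using that by simp
    finally show ?thesis by simp
  qed
  from this[OF nz(2,1)] show ?thesis unfolding d z .
qed

lemma zeta1_nonzero_Re_gt_1: "Re s > 1 \<Longrightarrow> zeta1 s \<noteq> 0"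
  using riemann_zeta_nonzero_Re_gt_1[of s] by (auto simp: zeta1_def)

text \<open>Near \<open>z\<close> the function is \<open>g w * (w - z) ^ n\<close> with
  \<open>g z \<noteq> 0\<close>, hence \<open>(w - z) f'/f = n + (w - z) g'/g\<close>. Points that
  are no zeros are included, with order 0.\<close>

lemma zorder_entire:
  assumes f: "f holomorphic_on UNIV" "f c \<noteq> 0"
  shows logderiv_tendsto_zorder: "((\<lambda>w. (w - z) * (deriv f w / f w)) \<longlongrightarrow> of_int (zorder f z)) (at z)"
    and zorder_entire_nonneg: "zorder f z \<ge> 0" and zorder_entire_pos: "f z = 0 \<Longrightarrow> zorder f z > 0"
proof -
  define g n where "g = zor_poly f z" and "n = nat (zorder f z)"
  have ex: "\<exists>w\<in>UNIV. f w \<noteq> 0" using f(2) by blast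
  note E = zorder_exist_zero[OF f(1) open_UNIV connected_UNIV UNIV_I[of z] ex]
  then show ge: "zorder f z \<ge> 0" "f z = 0 \<Longrightarrow> zorder f z > 0" by (auto split: if_splits)
  obtain r where r: "r > 0" "g holomorphic_on cball z r" "\<And>w. w \<in> cball z r \<Longrightarrow> f w = g w * (w - z) ^ n \<and> g w \<noteq> 0"
    using E unfolding g_def n_def by blast
  have gb: "g holomorphic_on ball z r" using r(2) by (rule holomorphic_on_subset) auto
  have "((\<lambda>w. (w - z) * (deriv g w / g w) + of_nat n) \<longlongrightarrow> (z - z) * (deriv g z / g z) + of_nat n) (at z)"
  proof (intro tendsto_intros)
    have "(\<lambda>w. deriv g w) holomorphic_on ball z r" using gb by (intro holomorphic_deriv) auto
    then have "isCont (deriv g) z" "isCont g z"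
      using gb r(1) by (meson centre_in_ball continuous_on_eq_continuous_at holomorphic_on_imp_continuous_on open_ball)+
    then show "(deriv g \<longlongrightarrow> deriv g z) (at z)" "(g \<longlongrightarrow> g z) (at z)" by (auto simp: isCont_def)
    show "g z \<noteq> 0" using r by auto
  qed
  moreover have "\<forall>\<^sub>F w in at z. (w - z) * (deriv g w / g w) + of_nat n = (w - z) * (deriv f w / f w)"
    unfolding eventually_at
  proof (intro exI[of _ r] conjI ballI impI)
    fix w assume "w \<noteq> z \<and> dist w z < r"
    then have w: "w \<noteq> z" "w \<in> ball z r" by (auto simp: dist_commute)
    have "(g has_field_derivative deriv g w) (at w)" using gb w by (intro holomorphic_derivI) auto
    then have "((\<lambda>w. g w * (w - z) ^ n) has_field_derivative deriv g w * (w - z) ^ n + (of_nat n * (1 * (w - z) ^ (n - Suc 0))) * g w) (at w)"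
      by (intro DERIV_mult DERIV_power) (auto intro!: derivative_eq_intros)
    then have "(f has_field_derivative deriv g w * (w - z) ^ n + (of_nat n * (1 * (w - z) ^ (n - Suc 0))) * g w) (at w)"
      by (rule has_field_derivative_transform_within_open[OF _ open_ball w(2)]) (use r(3) in auto)
    then have d: "deriv f w = deriv g w * (w - z) ^ n + (of_nat n * (1 * (w - z) ^ (n - Suc 0))) * g w"
      by (rule DERIV_imp_deriv)
    have fw: "f w = g w * (w - z) ^ n" "g w \<noteq> 0" using r(3)[of w] w by auto
    show "(w - z) * (deriv g w / g w) + of_nat n = (w - z) * (deriv f w / f w)"
      unfolding d fw(1) using fw(2) w(1) by (cases n) (simp_all add: field_simps)
  qed (use r in auto)
  ultimately have "((\<lambda>w. (w - z) * (deriv f w / f w)) \<longlongrightarrow> (z - z) * (deriv g z / g z) + of_nat n) (at z)"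
    by (rule Lim_transform_eventually)
  moreover have "of_nat n = (of_int (zorder f z) :: complex)" using ge unfolding n_def by (metis int_nat_eq of_int_of_nat_eq)
  ultimately show "((\<lambda>w. (w - z) * (deriv f w / f w)) \<longlongrightarrow> of_int (zorder f z)) (at z)" by simp
qed

text \<open>Mertens' inequality \<open>3 + 4 cos \<theta> + cos (2 \<theta>) = 2 (1 + cos
  \<theta>)^2 \<ge> 0\<close>, applied to each term with \<open>\<theta> = t ln n\<close>.\<close>

lemma mangoldt_series_341:
  assumes "\<sigma> > 1"
  shows "3 * Re (mangoldt_series (Complex \<sigma> 0)) + 4 * Re (mangoldt_series (Complex \<sigma> t)) + Re (mangoldt_series (Complex \<sigma> (2 * t))) \<ge> 0"
proof -
  have s: "(\<lambda>n. mangoldt (Suc n) * (real (Suc n) powr (- \<sigma>) * cos (u * ln (real (Suc n))))) sums Re (mangoldt_series (Complex \<sigma> u))" for u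
  proof -
    have eq: "Re (mangoldt (Suc n) * of_nat (Suc n) powr (- Complex \<sigma> u)) = mangoldt (Suc n) * (real (Suc n) powr (- \<sigma>) * cos (u * ln (real (Suc n))))" for n
    proof -
      have "complex_of_nat (Suc n) powr (- Complex \<sigma> u) = exp (- Complex \<sigma> u * of_real (ln (real (Suc n))))"
        by (simp add: powr_def Ln_of_nat del: of_nat_Suc)
      then have "Re (of_nat (Suc n) powr (- Complex \<sigma> u)) = real (Suc n) powr (- \<sigma>) * cos (u * ln (real (Suc n)))"
        by (simp add: Re_exp powr_def del: of_nat_Suc)
      moreover have "Re (complex_of_real m * w) = m * Re w" for m w by simp
      from this[of "mangoldt (Suc n)" "of_nat (Suc n) powr (- Complex \<sigma> u)"]
      have "Re (mangoldt (Suc n) * of_nat (Suc n) powr (- Complex \<sigma> u)) = mangoldt (Suc n) * Re (of_nat (Suc n) powr (- Complex \<sigma> u))"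
        by (simp only: of_real_mangoldt)
      ultimately show ?thesis by (simp only:)
    qed
    have "Re (Complex \<sigma> u) > 1" using assms by simp
    from sums_Re[OF mangoldt_series_sums[OF this]] show ?thesis unfolding eq .
  qed
  have "(\<lambda>n. 3 * (mangoldt (Suc n) * (real (Suc n) powr (- \<sigma>) * cos (0 * ln (real (Suc n)))))
     + 4 * (mangoldt (Suc n) * (real (Suc n) powr (- \<sigma>) * cos (t * ln (real (Suc n)))))
     + mangoldt (Suc n) * (real (Suc n) powr (- \<sigma>) * cos (2 * t * ln (real (Suc n)))))
   sums (3 * Re (mangoldt_series (Complex \<sigma> 0)) + 4 * Re (mangoldt_series (Complex \<sigma> t)) + Re (mangoldt_series (Complex \<sigma> (2 * t))))"
    by (intro sums_add sums_mult s)
  moreover have "0 \<le> 3 * (mangoldt (Suc n) * (real (Suc n) powr (- \<sigma>) * cos (0 * ln (real (Suc n)))))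
     + 4 * (mangoldt (Suc n) * (real (Suc n) powr (- \<sigma>) * cos (t * ln (real (Suc n)))))
     + mangoldt (Suc n) * (real (Suc n) powr (- \<sigma>) * cos (2 * t * ln (real (Suc n))))" for n
  proof -
    define c where "c = cos (t * ln (real (Suc n)))"
    have c2: "cos (2 * t * ln (real (Suc n))) = 2 * c\<^sup>2 - 1" using cos_double_cos[of "t * ln (real (Suc n))"] by (simp add: c_def mult.assoc)
    have "0 \<le> 2 * (1 + c)\<^sup>2" by simp
    then have "0 \<le> 3 + 4 * c + (2 * c\<^sup>2 - 1)" by (simp add: power2_eq_square algebra_simps)
    then have "0 \<le> mangoldt (Suc n) * real (Suc n) powr (- \<sigma>) * (3 + 4 * c + (2 * c\<^sup>2 - 1))"
      by (intro mult_nonneg_nonneg mangoldt_nonneg) auto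
    then show ?thesis unfolding c2 c_def[symmetric] by (simp add: algebra_simps del: of_nat_Suc)
  qed
  ultimately show ?thesis by (rule sums_le[OF _ sums_zero, rotated])
qed

text \<open>Multiply the 3-4-1 inequality by \<open>x = \<sigma> - 1\<close> and let
  \<open>x\<close> tend to 0 from the right: each series leaves 1 for the pole, if
  \<open>u = 0\<close>, minus the order of \<open>zeta1\<close> at \<open>1 + iu\<close>. With
  nonnegative orders this leaves \<open>3 - 4 * zorder zeta1 (Complex 1 t) \<ge> 0\<close>, so an
  order of at least 1 is impossible.\<close>

lemma zeta1_nonzero_Re_eq_1: "zeta1 (Complex 1 t) \<noteq> 0"
proof (cases "t = 0")
  case True
  then have "Complex 1 t = 1" by (simp add: complex_eq_iff)
  then show ?thesis by simp
next
  case t: False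
  let ?z = "\<lambda>u. zorder zeta1 (Complex 1 u)"
  have nz: "zeta1 1 \<noteq> 0" by simp
  have lim: "((\<lambda>x. of_real x * (deriv zeta1 (Complex (1 + x) u) / zeta1 (Complex (1 + x) u))) \<longlongrightarrow> of_int (?z u)) (at_right 0)" for u
  proof -
    have "filterlim (\<lambda>x. Complex (1 + x) u) (at (Complex 1 u)) (at_right 0)"
    proof (rule filterlim_atI)
      have "((\<lambda>x. Complex 1 u + of_real x) \<longlongrightarrow> Complex 1 u + of_real 0) (at_right 0)" by (intro tendsto_intros)
      moreover have "Complex 1 u + of_real x = Complex (1 + x) u" for x by (simp add: complex_eq_iff)
      ultimately show "((\<lambda>x. Complex (1 + x) u) \<longlongrightarrow> Complex 1 u) (at_right 0)" by simp
      show "\<forall>\<^sub>F x in at_right 0. Complex (1 + x) u \<noteq> Complex 1 u"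
        using eventually_at_right_less[of 0] by eventually_elim auto
    qed
    from filterlim_compose[OF logderiv_tendsto_zorder[OF zeta1_holomorphic_UNIV nz] this]
    have "((\<lambda>x. (Complex (1 + x) u - Complex 1 u) * (deriv zeta1 (Complex (1 + x) u) / zeta1 (Complex (1 + x) u))) \<longlongrightarrow> of_int (?z u)) (at_right 0)" .
    moreover have "Complex (1 + x) u - Complex 1 u = of_real x" for x by (simp add: complex_eq_iff)
    ultimately show ?thesis by simp
  qed
  have D: "((\<lambda>x. x * Re (mangoldt_series (Complex (1 + x) u))) \<longlongrightarrow> (if u = 0 then 1 else 0) - of_int (?z u)) (at_right 0)" for u
  proof -
    have 1: "((\<lambda>x. of_real x / (Complex (1 + x) u - 1)) \<longlongrightarrow> (if u = 0 then 1 else 0)) (at_right 0)"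
    proof (cases "u = 0")
      case True
      have "\<forall>\<^sub>F x in at_right 0. of_real x / (Complex (1 + x) u - 1) = 1"
        using eventually_at_right_less[of 0]
      proof eventually_elim
        case (elim x)
        have "Complex (1 + x) u - 1 = of_real x" using True by (simp add: complex_eq_iff)
        then show ?case using elim by simp
      qed
      then show ?thesis using True by (simp add: tendsto_eventually)
    next
      case False
      have e: "Complex (1 + x) u - 1 = Complex 0 u + of_real x" for x by (simp add: complex_eq_iff)
      have "((\<lambda>x. of_real x / (Complex 0 u + of_real x)) \<longlongrightarrow> of_real 0 / (Complex 0 u + of_real 0)) (at_right 0)"
        using False by (intro tendsto_intros) (auto simp: complex_eq_iff)
      then show ?thesis using False by (simp add: e)
    qed
    have "((\<lambda>x. Re (of_real x / (Complex (1 + x) u - 1) - of_real x * (deriv zeta1 (Complex (1 + x) u) / zeta1 (Complex (1 + x) u))))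
       \<longlongrightarrow> Re ((if u = 0 then 1 else 0) - of_int (?z u))) (at_right 0)"
      by (intro tendsto_Re tendsto_diff 1 lim)
    moreover have "\<forall>\<^sub>F x in at_right 0. Re (of_real x / (Complex (1 + x) u - 1) - of_real x * (deriv zeta1 (Complex (1 + x) u) / zeta1 (Complex (1 + x) u)))
       = x * Re (mangoldt_series (Complex (1 + x) u))"
      using eventually_at_right_less[of 0]
    proof eventually_elim
      case (elim x)
      have eq: "of_real x * mangoldt_series (Complex (1 + x) u) = of_real x / (Complex (1 + x) u - 1) - of_real x * (deriv zeta1 (Complex (1 + x) u) / zeta1 (Complex (1 + x) u))"
        using elim by (subst zeta1_logderiv) (auto simp: right_diff_distrib)
      show ?case unfolding eq[symmetric] by simp
    qed
    ultimately have "((\<lambda>x. x * Re (mangoldt_series (Complex (1 + x) u))) \<longlongrightarrow> Re ((if u = 0 then 1 else 0) - of_int (?z u))) (at_right 0)"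
      by (rule Lim_transform_eventually)
    then show ?thesis by (simp split: if_splits)
  qed
  have "((\<lambda>x. 3 * (x * Re (mangoldt_series (Complex (1 + x) 0))) + 4 * (x * Re (mangoldt_series (Complex (1 + x) t))) + x * Re (mangoldt_series (Complex (1 + x) (2 * t))))
     \<longlongrightarrow> 3 * ((if (0::real) = 0 then 1 else 0) - of_int (?z 0)) + 4 * ((if t = 0 then 1 else 0) - of_int (?z t)) + ((if 2 * t = 0 then 1 else 0) - of_int (?z (2 * t)))) (at_right 0)"
    by (intro tendsto_add tendsto_mult tendsto_const D)
  moreover have "\<forall>\<^sub>F x in at_right 0. 0 \<le> 3 * (x * Re (mangoldt_series (Complex (1 + x) 0))) + 4 * (x * Re (mangoldt_series (Complex (1 + x) t))) + x * Re (mangoldt_series (Complex (1 + x) (2 * t)))"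
    using eventually_at_right_less[of 0]
  proof eventually_elim
    case (elim x)
    have "0 \<le> x * (3 * Re (mangoldt_series (Complex (1 + x) 0)) + 4 * Re (mangoldt_series (Complex (1 + x) t)) + Re (mangoldt_series (Complex (1 + x) (2 * t))))"
      using elim by (intro mult_nonneg_nonneg mangoldt_series_341) auto
    then show ?case by (simp add: algebra_simps)
  qed
  ultimately have "0 \<le> 3 * ((if (0::real) = 0 then 1 else 0) - of_int (?z 0)) + 4 * ((if t = 0 then 1 else 0) - of_int (?z t)) + ((if 2 * t = 0 then 1 else 0) - real_of_int (?z (2 * t)))"
    by (intro tendsto_lowerbound) auto
  then have "0 \<le> 3 * (1 - real_of_int (?z 0)) - 4 * of_int (?z t) - of_int (?z (2 * t))" using t by simp
  moreover have "?z 0 \<ge> 0" "?z (2 * t) \<ge> 0" by (rule zorder_entire_nonneg[OF zeta1_holomorphic_UNIV nz])+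
  then have "real_of_int (?z 0) \<ge> 0" "real_of_int (?z (2 * t)) \<ge> 0" by (simp_all only: of_int_0_le_iff)
  ultimately have "real_of_int (?z t) < 1" by argo
  then have "?z t \<le> 0" by simp
  then show ?thesis using zorder_entire_pos[OF zeta1_holomorphic_UNIV nz, of "Complex 1 t"] by linarith
qed

section \<open>The truncated Perron formula\<close>

lemma half_odd_neq: "(real K + 1 / 2) / real (Suc n) \<noteq> 1"
proof
  assume "(real K + 1 / 2) / real (Suc n) = 1"
  then have "real K + 1 / 2 = real (Suc n)" by (simp only: divide_eq_1_iff)
  then have "2 * (real K + 1 / 2) = 2 * real (Suc n)" by (simp only:)
  then have "real (2 * K + 1) = real (2 * Suc n)" by simp
  then have "2 * K + 1 = 2 * Suc n" by (simp only: of_nat_eq_iff)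
  then show False by presburger
qed

text \<open>The series converges uniformly on the segment, so it is integrated termwise and each
  term is replaced by the Perron kernel. Assuming a bound \<open>B\<close> for all partial sums lets
  the error pass to the limit with the integral.\<close>

lemma perron_mangoldt:
  assumes xK: "x = real K + 1 / 2" and c: "c > 1" and T: "T > 0"
    and B: "\<And>N. (\<Sum>n<N. mangoldt (Suc n) * ((x / real (Suc n)) powr c / \<bar>ln (x / real (Suc n))\<bar>)) \<le> B"
  shows "cmod (contour_integral (linepath (Complex c (-T)) (Complex c T)) (\<lambda>s. mangoldt_series s * (of_real x powr s / s))
           - 2 * of_real pi * \<i> * of_real (chebyshev_psi x)) \<le> 2 / T * B"
proof -
  let ?g = "linepath (Complex c (-T)) (Complex c T)"
  define F where "F = (\<lambda>N (s::complex). \<Sum>n<N. mangoldt (Suc n) * (of_real (x / real (Suc n)) powr s / s))"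
  have x: "x > 0" using xK by simp
  have seg: "Re s = c" if "s \<in> path_image ?g" for s
    using that by (auto simp: closed_segment_same_Re)
  have s0: "s \<noteq> 0" if "s \<in> path_image ?g" for s using seg[OF that] c by auto
  have Feq: "F N s = (\<Sum>n<N. mangoldt (Suc n) * of_nat (Suc n) powr (- s)) * (of_real x powr s / s)" for N and s :: complex
  proof -
    have E: "of_real (x / real (Suc n)) powr s = of_nat (Suc n) powr (- s) * (of_real x powr s :: complex)" for n
    proof -
      have "(of_real (x / real (Suc n)) * of_nat (Suc n) :: complex) powr s = of_real (x / real (Suc n)) powr s * of_nat (Suc n) powr s"
        using x by (intro powr_times_real) auto
      moreover have "of_real (x / real (Suc n)) * of_nat (Suc n) = complex_of_real x" by (simp del: of_nat_Suc)
      ultimately have XY: "of_real x powr s = of_real (x / real (Suc n)) powr s * (of_nat (Suc n) powr s :: complex)" by (simp only:)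
      have WM: "complex_of_nat (Suc n) powr (- s) * of_nat (Suc n) powr s = 1"
        by (simp add: powr_add[symmetric] del: of_nat_Suc)
      have "X = W * Y" if "Y = X * M" "W * M = 1" for X Y W M :: complex
        using that by (simp add: mult.left_commute)
      from this[OF XY WM] show ?thesis .
    qed
    show ?thesis unfolding F_def sum_distrib_right
      by (intro sum.cong refl) (simp only: E times_divide_eq_right mult.assoc)
  qed
  have hol: "(\<lambda>s. mangoldt (Suc n) * (of_real (x / real (Suc n)) powr s / s)) contour_integrable_on ?g" for n
    using x s0 by (intro contour_integrable_continuous_linepath continuous_intros) (auto simp del: of_nat_Suc)
  have lim: "(\<lambda>N. contour_integral ?g (F N)) \<longlonglongrightarrow> contour_integral ?g (\<lambda>s. mangoldt_series s * (of_real x powr s / s))"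
  proof (rule contour_integral_uniform_limit(2))
    show "\<forall>\<^sub>F N in sequentially. F N contour_integrable_on ?g"
      unfolding F_def by (intro always_eventually allI contour_integrable_sum hol) auto
    show "uniform_limit (path_image ?g) F (\<lambda>s. mangoldt_series s * (of_real x powr s / s)) sequentially"
      unfolding Feq[abs_def]
    proof (rule uniform_lim_mult)
      show "uniform_limit (path_image ?g) (\<lambda>N s. \<Sum>n<N. mangoldt (Suc n) * of_nat (Suc n) powr (- s)) mangoldt_series sequentially"
        unfolding mangoldt_series_def
      proof (rule Weierstrass_m_test)
        show "summable (\<lambda>n. mangoldt (Suc n) * real (Suc n) powr (- c))" using c by (rule summable_mangoldt_powr)
        show "cmod (mangoldt (Suc n) * of_nat (Suc n) powr (- s)) \<le> mangoldt (Suc n) * real (Suc n) powr (- c)"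
          if "s \<in> path_image ?g" for n s
          using seg[OF that] by (simp add: norm_mult norm_of_nat_Suc_powr del: of_nat_Suc)
      qed
      show "uniform_limit (path_image ?g) (\<lambda>N s. of_real x powr s / s) (\<lambda>s. of_real x powr s / s) sequentially"
        by (rule uniform_limit_const)
      have "continuous_on (path_image ?g) mangoldt_series"
        by (rule holomorphic_on_imp_continuous_on, rule holomorphic_on_subset[OF mangoldt_series_holomorphic])
           (use seg c in auto)
      then show "bounded (mangoldt_series ` path_image ?g)"
        by (intro compact_imp_bounded compact_continuous_image) auto
      have "continuous_on (path_image ?g) (\<lambda>s. of_real x powr s / s)"
        using s0 x by (intro continuous_intros) auto
      then show "bounded ((\<lambda>s. of_real x powr s / s) ` path_image ?g)"
        by (intro compact_imp_bounded compact_continuous_image) auto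
    qed
    show "norm (vector_derivative ?g (at t)) \<le> cmod (Complex c T - Complex c (-T))" for t
      by (simp add: vector_derivative_linepath_at)
  qed auto
  have ci: "contour_integral ?g (F N) = (\<Sum>n<N. mangoldt (Suc n) * contour_integral ?g (\<lambda>s. of_real (x / real (Suc n)) powr s / s))" for N
  proof -
    have i: "(\<lambda>s. of_real (x / real (Suc n)) powr s / s) contour_integrable_on ?g" for n
      using x s0 by (intro contour_integrable_continuous_linepath continuous_intros) (auto simp del: of_nat_Suc)
    have "contour_integral ?g (F N) = (\<Sum>n<N. contour_integral ?g (\<lambda>s. mangoldt (Suc n) * (of_real (x / real (Suc n)) powr s / s)))"
      unfolding F_def by (rule contour_integral_sum[OF finite_lessThan hol])
    also have "\<dots> = (\<Sum>n<N. mangoldt (Suc n) * contour_integral ?g (\<lambda>s. of_real (x / real (Suc n)) powr s / s))"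
      by (intro sum.cong refl contour_integral_lmul i)
    finally show ?thesis .
  qed
  \<comment> \<open>From \<open>N = K\<close> on the main terms no longer change, as
    \<open>K < x < K + 1\<close>.\<close>
  have psi: "(\<Sum>n<N. mangoldt (Suc n) * (if x / real (Suc n) > 1 then 1 else 0)) = (of_real (chebyshev_psi x) :: complex)" if N: "N \<ge> K" for N
  proof -
    have "(\<Sum>n<N. mangoldt (Suc n) * (if x / real (Suc n) > 1 then 1 else 0) :: complex) = (\<Sum>n\<in>{..<N}. if n < K then mangoldt (Suc n) else 0)"
      by (intro sum.cong) (auto simp: xK divide_simps)
    also have "\<dots> = (\<Sum>n<K. mangoldt (Suc n))"
      by (rule sum.mono_neutral_cong_right) (use N in auto)
    also have "\<dots> = (\<Sum>n\<in>{1..K}. mangoldt n)"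
      by (rule sum.reindex_bij_witness[of _ "\<lambda>n. n - 1" Suc]) auto
    also have "{1..K} = {n. 1 \<le> n \<and> real n \<le> x}"
    proof (intro set_eqI)
      fix n
      have "real n \<le> x \<longleftrightarrow> n \<le> K"
      proof (cases "n \<le> K")
        case True
        then have "real n \<le> real K" by simp
        then show ?thesis using xK True by simp
      next
        case False
        then have "real (K + 1) \<le> real n" by (simp only: of_nat_le_iff)
        then show ?thesis using xK False by simp
      qed
      then show "n \<in> {1..K} \<longleftrightarrow> n \<in> {n. 1 \<le> n \<and> real n \<le> x}" by auto
    qed
    finally show ?thesis by (simp add: chebyshev_psi_def)
  qed
  have bd: "cmod (contour_integral ?g (F N) - 2 * of_real pi * \<i> * of_real (chebyshev_psi x)) \<le> 2 / T * B" if N: "N \<ge> K" for N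
  proof -
    let ?y = "\<lambda>n. x / real (Suc n)"
    let ?V = "\<lambda>n. contour_integral ?g (\<lambda>s. of_real (?y n) powr s / s)"
    have e: "contour_integral ?g (F N) - 2 * of_real pi * \<i> * of_real (chebyshev_psi x)
      = (\<Sum>n<N. mangoldt (Suc n) * (?V n - 2 * of_real pi * \<i> * (if ?y n > 1 then 1 else 0)))"
      unfolding ci psi[OF N, symmetric] sum_distrib_left sum_subtractf[symmetric]
      by (intro sum.cong refl) (simp only: right_diff_distrib mult_ac)
    have "cmod (contour_integral ?g (F N) - 2 * of_real pi * \<i> * of_real (chebyshev_psi x)) \<le> (\<Sum>n<N. mangoldt (Suc n) * (2 * (?y n powr c / (T * \<bar>ln (?y n)\<bar>))))"
      unfolding e
    proof (rule sum_norm_le)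
      fix n
      have "?y n \<noteq> 1" unfolding xK by (rule half_odd_neq)
      then have "cmod (?V n - 2 * of_real pi * \<i> * (if ?y n > 1 then 1 else 0)) \<le> 2 * (?y n powr c / (T * \<bar>ln (?y n)\<bar>))"
        by (intro perron_bound[OF divide_pos_pos[OF x]]) (use c T in simp_all)
      then show "cmod (mangoldt (Suc n) * (?V n - 2 * of_real pi * \<i> * (if ?y n > 1 then 1 else 0))) \<le> mangoldt (Suc n) * (2 * (?y n powr c / (T * \<bar>ln (?y n)\<bar>)))"
        unfolding norm_mult norm_mangoldt by (rule mult_left_mono[OF _ mangoldt_nonneg])
    qed
    also have "\<dots> = 2 / T * (\<Sum>n<N. mangoldt (Suc n) * (?y n powr c / \<bar>ln (?y n)\<bar>))"
    proof -
      have "m * (2 * (p / (T * l))) = 2 / T * (m * (p / l))" for m p l :: real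
        by (simp only: times_divide_eq_right times_divide_eq_left divide_divide_eq_left mult_ac)
      then show ?thesis unfolding sum_distrib_left by (intro sum.cong refl)
    qed
    also have "\<dots> \<le> 2 / T * B" using T B[of N] by (intro mult_left_mono) auto
    finally show ?thesis .
  qed
  show ?thesis
    by (rule Lim_norm_ubound[OF sequentially_bot tendsto_diff[OF lim tendsto_const] eventually_sequentiallyI[OF bd]])
qed

section \<open>The error sum in Perron's formula\<close>

text \<open>Cauchy's inequality on the unit circle about \<open>z\<close>, which stays in
  \<open>Re s \<ge> -1/60\<close>; hence \<open>p = 119/60\<close>. The radius 1/60 is the largest
  value of \<open>1 / L\<close>.\<close>

lemma zeta1_deriv_near_1:
  assumes "cmod (z - 1) \<le> 1 / 60"
  shows "cmod (deriv zeta1 z) \<le> 8"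
proof -
  have "norm ((deriv ^^ 1) zeta1 z) \<le> fact 1 * 8 / 1 ^ 1"
  proof (rule Cauchy_inequality)
    show "zeta1 holomorphic_on ball z 1"
      using zeta1_holomorphic_UNIV by (rule holomorphic_on_subset) simp
    show "continuous_on (cball z 1) zeta1"
      by (rule holomorphic_on_imp_continuous_on, rule holomorphic_on_subset[OF zeta1_holomorphic_UNIV]) simp
    fix s assume s: "norm (z - s) = 1"
    have 1: "cmod (s - 1) \<le> 61 / 60"
      using norm_triangle_ineq[of "s - z" "z - 1"] s assms by (simp add: norm_minus_commute)
    then have 2: "cmod s \<le> 121 / 60" "cmod (s + 1) \<le> 181 / 60"
      using norm_triangle_ineq[of "s - 1" 1] norm_triangle_ineq[of "s - 1" 2] by (simp_all add: add.commute)
    have "\<bar>Re (s - 1)\<bar> \<le> 61 / 60" using abs_Re_le_cmod[of "s - 1"] 1 by linarith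
    then have "Re (s - 1) \<ge> - (61 / 60)" by linarith
    then have "Re s \<ge> - 1 / 60" by simp
    then have "cmod (zeta1 s) \<le> 1 + cmod (s - 1) / 2 + cmod (s - 1) * cmod s * cmod (s + 1) / 2 * ((119/60) / (119/60 - 1))"
      by (intro zeta1_bound) auto
    also have "\<dots> \<le> 1 + (61/60) / 2 + (61/60) * (121/60) * (181/60) / 2 * ((119/60) / (119/60 - 1))"
      using 1 2 by (intro add_mono mult_mono divide_right_mono) auto
    also have "\<dots> \<le> 8" by simp
    finally show "norm (zeta1 s) \<le> 8" .
  qed auto
  then show ?thesis by simp
qed

text \<open>The pole contributes \<open>1 / (c - 1) = L\<close>. Since \<open>zeta1 1 = 1\<close>
  and the derivative is at most 8, \<open>zeta1 c\<close> has modulus at least 52/60, and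
  \<open>8 / (52/60) < 10\<close> bounds the rest.\<close>

lemma mangoldt_series_near_1:
  assumes "L \<ge> 60"
  shows "Re (mangoldt_series (of_real (1 + 1 / L))) \<le> L + 10"
proof -
  define c where "c = complex_of_real (1 + 1 / L)"
  have c1: "c - 1 = of_real (1 / L)" by (simp add: c_def)
  have L: "0 < 1 / L" "1 / L \<le> 1 / 60" using assms by (auto simp: divide_simps)
  have nc: "cmod (c - 1) \<le> 1 / 60" unfolding c1 norm_of_real using L by simp
  have "norm (zeta1 1 - zeta1 c) \<le> 8 * norm (1 - c)"
  proof (rule field_differentiable_bound[of "cball 1 (1/60)"])
    show "(zeta1 has_field_derivative deriv zeta1 z) (at z within cball 1 (1 / 60))" for z
      by (rule has_field_derivative_at_within, rule holomorphic_derivI[OF zeta1_holomorphic_UNIV]) auto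
    show "norm (deriv zeta1 z) \<le> 8" if "z \<in> cball 1 (1/60)" for z
      using that by (intro zeta1_deriv_near_1) (simp add: dist_norm norm_minus_commute)
  qed (use nc in \<open>auto simp: dist_norm norm_minus_commute\<close>)
  then have "cmod (1 - zeta1 c) \<le> 8 / 60" using nc by (simp add: norm_minus_commute)
  then have z: "cmod (zeta1 c) \<ge> 52 / 60" using norm_triangle_ineq2[of 1 "1 - zeta1 c"] by simp
  have "cmod (deriv zeta1 c / zeta1 c) \<le> 8 / (52 / 60)"
    unfolding norm_divide using z by (intro frac_le zeta1_deriv_near_1 nc) auto
  then have d: "- Re (deriv zeta1 c / zeta1 c) \<le> 10"
    using abs_Re_le_cmod[of "deriv zeta1 c / zeta1 c"] by simp
  have "mangoldt_series c = 1 / (c - 1) - deriv zeta1 c / zeta1 c"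
    using L by (intro zeta1_logderiv) (simp add: c_def)
  also have "1 / (c - 1) = of_real L" unfolding c1 by simp
  finally have "Re (mangoldt_series c) = L - Re (deriv zeta1 c / zeta1 c)" by simp
  with d show ?thesis unfolding c_def by simp
qed

text \<open>Seen from a half-odd \<open>x\<close>, the integers on either side lie at distances 1/2,
  3/2, and so on. Each later term is at most a difference of logarithms, by
  \<open>ln u \<le> u - 1\<close>.\<close>

lemma sum_half_odd_reciprocals: "(\<Sum>j\<le>J. 1 / (real j + 1 / 2)) \<le> 2 + ln (2 * real J + 1)"
proof (induction J)
  case (Suc J)
  have "ln ((2 * real J + 1) / (2 * real J + 3)) \<le> (2 * real J + 1) / (2 * real J + 3) - 1"
    by (rule ln_le_minus_one) (auto intro!: divide_pos_pos)
  also have "(2 * real J + 1) / (2 * real J + 3) - 1 = - (1 / (real (Suc J) + 1 / 2))"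
    by (simp add: field_simps)
  finally have "1 / (real (Suc J) + 1 / 2) \<le> ln (2 * real J + 3) - ln (2 * real J + 1)"
    by (simp add: ln_div)
  moreover have "2 * real (Suc J) + 1 = 2 * real J + 3" by simp
  ultimately show ?case using Suc.IH unfolding sum.atMost_Suc by (simp only:)
qed simp

text \<open>
  The three summands bound the terms with \<open>n \<le> x/2\<close> or \<open>n \<ge> 2 x\<close>, with \<open>x/2 < n < x\<close>, and with
  \<open>x < n < 2 x\<close>.
\<close>

lemma perron_constant_bound:
  assumes "x > 0" and L: "L \<ge> (60 :: real)"
  shows "3 / 2 * (exp 1 * x) * (L + 10) + (L + 7/10) * (1012/1000 * x) * (101 / 100 + (2 + L)) + (L + 7/10) * x * (2 + (L + 7 / 10))
     \<le> 2212 / 1000 * x * L\<^sup>2"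
proof -
  define q where "q = L * L"
  have q: "60 * L \<le> q" unfolding q_def using L by (intro mult_right_mono) auto
  have "3 / 2 * (exp 1 * x) * (L + 10) \<le> 3 / 2 * (272 / 100 * x) * (L + 10)"
    using e_less_272 assms by (intro mult_right_mono mult_left_mono) auto
  also have "\<dots> = x * (408 / 100 * L + 408 / 10)" by (simp add: algebra_simps)
  finally have 1: "3 / 2 * (exp 1 * x) * (L + 10) \<le> x * (408 / 100 * L + 408 / 10)" .
  have 2: "(L + 7/10) * (1012/1000 * x) * (101 / 100 + (2 + L)) = x * (1012/1000 * q + 375452/100000 * L + 2132284/1000000)"
    by (simp add: q_def algebra_simps)
  have 3: "(L + 7/10) * x * (2 + (L + 7 / 10)) = x * (q + 34/10 * L + 189/100)"
    by (simp add: q_def algebra_simps)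
  \<comment> \<open>The quadratic terms give 1.012 + 1; the remaining 0.2 covers the lower-order
    terms, using \<open>L \<le> q / 60\<close> and \<open>3600 \<le> q\<close>.\<close>
  have "408 / 100 * L + 408 / 10 + (1012/1000 * q + 375452/100000 * L + 2132284/1000000) + (q + 34/10 * L + 189/100) \<le> 2212 / 1000 * q"
    using q L by linarith
  then have "x * (408 / 100 * L + 408 / 10 + (1012/1000 * q + 375452/100000 * L + 2132284/1000000) + (q + 34/10 * L + 189/100)) \<le> x * (2212 / 1000 * q)"
    using assms by (intro mult_left_mono) auto
  also have "x * (2212 / 1000 * q) = 2212 / 1000 * x * L\<^sup>2" by (simp add: q_def power2_eq_square)
  finally have 4: "x * (408 / 100 * L + 408 / 10 + (1012/1000 * q + 375452/100000 * L + 2132284/1000000) + (q + 34/10 * L + 189/100)) \<le> 2212 / 1000 * x * L\<^sup>2" .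
  have 5: "x * a + x * b + x * c = x * (a + b + c)" for a b c by (simp only: distrib_left)
  show ?thesis unfolding 2 3 by (rule order_trans[OF add_right_mono[OF add_right_mono[OF 1]]]) (unfold 5, rule 4)
qed

text \<open>Far from \<open>x\<close> the logarithm is bounded below and the sum is controlled by
  the Dirichlet series at \<open>c\<close>; near \<open>x\<close> the logarithm is about the
  relative distance to \<open>x\<close>, and a harmonic sum over half-odd distances supplies a
  second factor \<open>L\<close>.\<close>

lemma perron_error_sum:
  assumes xK: "x = real K + 1 / 2" and L: "L = ln x" "L \<ge> 60" and c: "c = 1 + 1 / L"
  shows "(\<Sum>n<N. mangoldt (Suc n) * ((x / real (Suc n)) powr c / \<bar>ln (x / real (Suc n))\<bar>)) \<le> 2212 / 1000 * x * L\<^sup>2"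
proof -
  define w where "w = (\<lambda>n. (x / real n) powr c / \<bar>ln (x / real n)\<bar>)"
  define a where "a = (\<lambda>n. (L + 7/10) * (1012/1000 * x) * (2 / x + 1 / (x - real n)))"
  define b where "b = (\<lambda>n. (L + 7/10) * x * (1 / (real n - x)))"
  define d where "d = (\<lambda>n. 3 / 2 * (exp 1 * x) * (mangoldt n * real n powr (- c)))"
  \<comment> \<open>The least integer above \<open>x / 2\<close>.\<close>
  define n0 where "n0 = K div 2 + 1"
  have x60: "x \<ge> exp 60"
  proof -
    have "0 < x" using xK by simp
    then have "x = exp L" by (simp add: L(1))
    then show ?thesis using L(2) by simp
  qed
  have "(1 + 60 / 2) ^ 2 \<le> exp (60 / 2 :: real) ^ 2" by (intro power_mono exp_ge_add_one_self) auto
  also have "\<dots> = exp 60" by (simp flip: exp_of_nat_mult)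
  finally have x: "x > 0" "x \<ge> 100" using x60 by auto
  have cb: "c > 1" "c \<le> 61 / 60" using L by (auto simp: c divide_simps)
  \<comment> \<open>The abscissa \<open>c = 1 + 1 / ln x\<close> is chosen for this.\<close>
  have xc: "x powr c = exp 1 * x" using x L by (simp add: c powr_def distrib_right exp_add)
  have lnn: "mangoldt n \<le> L + 7 / 10" if "n > 0" "real n < 2 * x" for n
  proof -
    have "mangoldt n \<le> ln (real n)" using that by (intro mangoldt_le_ln)
    also have "\<dots> \<le> ln (2 * x)" using that x by (subst ln_le_cancel_iff) auto
    also have "\<dots> = ln 2 + L" using x L by (simp add: ln_mult)
    finally show ?thesis using ln2_le_25_over_36 by simp
  qed
  have w0: "w n \<ge> 0" for n unfolding w_def by (intro divide_nonneg_nonneg) auto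
  have Ka: "a n \<ge> mangoldt n * w n" if n: "n \<in> {n0..K}" for n
  proof -
    have n1: "n > 0" "real n < x" using n xK by (auto simp: n0_def)
    have n2: "x / real n \<le> 2"
    proof -
      have "K < 2 * n" using n by (auto simp: n0_def)
      then have "real (K + 1) \<le> real (2 * n)" by (simp only: of_nat_le_iff)
      then show ?thesis using n1 xK by (simp add: divide_simps)
    qed
    define u where "u = x / real n"
    have u: "u > 1" "u \<le> 2" using n1 n2 by (auto simp: u_def divide_simps)
    have "ln (1 / u) \<le> 1 / u - 1" using u by (intro ln_le_minus_one) auto
    then have lu: "ln u \<ge> (x - real n) / x" using u n1 x by (simp add: ln_div u_def diff_divide_distrib)
    \<comment> \<open>As \<open>u \<le> 2\<close> and \<open>L \<ge> 60\<close>, the excess factor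
      \<open>u powr (1 / L)\<close> is at most the 60th root of 2.\<close>
    have "u powr c \<le> 1012 / 1000 * u"
    proof -
      have "u powr c = u * u powr (1 / L)" using u by (simp add: c powr_add)
      also have "u powr (1 / L) \<le> 2 powr (1 / 60)"
      proof -
        have "u powr (1 / L) \<le> 2 powr (1 / L)" using u L by (intro powr_mono2) auto
        also have "\<dots> \<le> 2 powr (1 / 60)" using L by (intro powr_mono) (auto simp: divide_simps)
        finally show ?thesis .
      qed
      also have "2 powr (1 / 60) \<le> (1012 / 1000 :: real)"
      proof -
        have "(2 powr (1/60)) ^ 60 \<le> (1012/1000 :: real) ^ 60"
          by (subst powr_realpow[symmetric]) (simp_all add: powr_powr power_divide)
        then show ?thesis by (rule power_le_imp_le_base[where n = 59, simplified]) simp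
      qed
      finally show ?thesis using u by (simp add: mult_ac)
    qed
    then have "w n \<le> (1012 / 1000 * u) / ((x - real n) / x)"
      unfolding w_def u_def[symmetric] using lu u n1 x by (intro frac_le) auto
    also have "\<dots> = 1012 / 1000 * x * (1 / real n + 1 / (x - real n))"
      using n1 x by (simp add: u_def field_simps)
    also have "\<dots> \<le> 1012 / 1000 * x * (2 / x + 1 / (x - real n))"
      using n1 n2 x by (intro mult_left_mono add_right_mono) (auto simp: divide_simps)
    finally have "w n \<le> 1012 / 1000 * x * (2 / x + 1 / (x - real n))" .
    then have "mangoldt n * w n \<le> (L + 7 / 10) * (1012 / 1000 * x * (2 / x + 1 / (x - real n)))"
      using lnn[of n] n1 x L by (intro mult_mono) (auto simp: w_def)
    then show ?thesis by (simp add: a_def mult.assoc)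
  qed
  have Kb: "b n \<ge> mangoldt n * w n" if n: "n \<in> {K + 1..2 * K}" for n
  proof -
    have n1: "n > 0" "x < real n" "real n < 2 * x" using n xK by auto
    define u where "u = x / real n"
    have u: "u > 0" "u < 1" using n1 x by (auto simp: u_def divide_simps)
    have "ln u \<le> u - 1" using u by (intro ln_le_minus_one) auto
    then have lu: "\<bar>ln u\<bar> \<ge> (real n - x) / real n" using u n1 by (simp add: u_def diff_divide_distrib)
    \<comment> \<open>Here \<open>u < 1\<close>, so the larger exponent only helps and the factor
      1.012 is absent from \<open>b\<close>.\<close>
    have "u powr c \<le> u powr 1" using u cb by (intro powr_mono') auto
    then have "w n \<le> u / ((real n - x) / real n)"
      unfolding w_def u_def[symmetric] using lu u n1 by (intro frac_le) auto
    also have "\<dots> = x * (1 / (real n - x))" using n1 by (simp add: u_def)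
    finally have "mangoldt n * w n \<le> (L + 7 / 10) * (x * (1 / (real n - x)))"
      using lnn[of n] n1 L w0[of n] by (intro mult_mono) auto
    then show ?thesis by (simp add: b_def mult.assoc)
  qed
  have Kd: "d n \<ge> mangoldt n * w n" if n: "n > 0" "n < n0 \<or> n > 2 * K" for n
  proof -
    define u where "u = x / real n"
    have u: "u > 0" using n x by (simp add: u_def)
    \<comment> \<open>Outside the window \<open>u\<close> is at least 2 or at most 1/2, and
      \<open>ln 2 \<ge> 2/3\<close>; this is the factor 3/2 in \<open>d\<close>.\<close>
    have "\<bar>ln u\<bar> \<ge> 2 / 3"
    proof (cases "n < n0")
      case True
      then have "2 * n \<le> K" by (auto simp: n0_def)
      then have "real (2 * n) \<le> real K" by (simp only: of_nat_le_iff)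
      then have "u \<ge> 2" using n xK by (simp add: u_def divide_simps)
      then have "ln u \<ge> ln 2" by simp
      then show ?thesis using ln2_ge_two_thirds by linarith
    next
      case False
      then have "2 * K + 1 \<le> n" using n by auto
      then have "real (2 * K + 1) \<le> real n" by (simp only: of_nat_le_iff)
      then have "u \<le> 1 / 2" using n xK by (simp add: u_def divide_simps)
      then have "ln u \<le> ln (1 / 2)" using u by (subst ln_le_cancel_iff) auto
      then have "ln u \<le> - ln 2" by (simp add: ln_div)
      then show ?thesis using ln2_ge_two_thirds by linarith
    qed
    then have "w n \<le> u powr c / (2 / 3)"
      unfolding w_def u_def[symmetric] by (intro divide_left_mono) auto
    also have "u powr c = exp 1 * x * real n powr (- c)"
      using x n by (simp add: u_def powr_divide xc powr_minus_divide)
    finally have "mangoldt n * w n \<le> mangoldt n * (exp 1 * x * real n powr (- c) / (2 / 3))"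
      by (intro mult_left_mono mangoldt_nonneg)
    then show ?thesis by (simp add: d_def mult_ac)
  qed
  have nonneg: "0 \<le> d n" for n using x by (auto simp: d_def mangoldt_nonneg)
  have a0: "0 \<le> a n" if "n \<in> {n0..K}" for n
    using that x xK L by (auto simp: a_def)
  have b0: "0 \<le> b n" if "n \<in> {K + 1..2 * K}" for n
    using that x xK L by (auto simp: b_def)
  have S0: "(\<Sum>n<N. mangoldt (Suc n) * w (Suc n)) = (\<Sum>n\<in>{1..N}. mangoldt n * w n)"
    by (rule sum.reindex_bij_witness[of _ "\<lambda>n. n - 1" Suc]) auto
  \<comment> \<open>The far bound \<open>d\<close> is added for every \<open>n\<close>, so that its
    sum compares directly with the full series.\<close>
  have S1: "(\<Sum>n\<in>{1..N}. mangoldt n * w n) \<le> (\<Sum>n\<in>{1..N}. d n + (if n \<in> {n0..K} then a n else 0) + (if n \<in> {K + 1..2 * K} then b n else 0))"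
  proof (rule sum_mono)
    fix n assume "n \<in> {1..N}"
    then have n: "n > 0" by simp
    have "(n0 \<le> n \<and> n \<le> K) \<or> (K + 1 \<le> n \<and> n \<le> 2 * K) \<or> (n < n0 \<or> n > 2 * K)" by linarith
    then consider "n \<in> {n0..K}" | "n \<in> {K + 1..2 * K}" | "n < n0 \<or> n > 2 * K"
      unfolding atLeastAtMost_iff by blast
    then show "mangoldt n * w n \<le> d n + (if n \<in> {n0..K} then a n else 0) + (if n \<in> {K + 1..2 * K} then b n else 0)"
    proof cases
      case 1 then show ?thesis using Ka[OF 1] nonneg[of n] by auto
    next
      case 2 then show ?thesis using Kb[OF 2] nonneg[of n] by auto
    next
      case 3
      have "0 \<le> (if n \<in> {n0..K} then a n else 0)" "0 \<le> (if n \<in> {K + 1..2 * K} then b n else 0)"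
        using a0 b0 by auto
      then show ?thesis using Kd[OF n 3] by linarith
    qed
  qed
  have S2: "(\<Sum>n\<in>{1..N}. d n + (if n \<in> {n0..K} then a n else 0) + (if n \<in> {K + 1..2 * K} then b n else 0)) = (\<Sum>n\<in>{1..N}. d n) + (\<Sum>n\<in>{1..N} \<inter> {n0..K}. a n) + (\<Sum>n\<in>{1..N} \<inter> {K + 1..2 * K}. b n)"
    by (simp only: sum.distrib sum.inter_restrict[OF finite_atLeastAtMost])
  have S3: "(\<Sum>n\<in>{1..N}. d n) + (\<Sum>n\<in>{1..N} \<inter> {n0..K}. a n) + (\<Sum>n\<in>{1..N} \<inter> {K + 1..2 * K}. b n) \<le> (\<Sum>n\<in>{1..N}. d n) + (\<Sum>n\<in>{n0..K}. a n) + (\<Sum>n\<in>{K + 1..2 * K}. b n)"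
    using a0 b0 by (intro add_mono sum_mono2) auto
  have D: "(\<Sum>n\<in>{1..N}. d n) \<le> 3 / 2 * (exp 1 * x) * (L + 10)"
  proof -
    have rs: "(\<lambda>n. mangoldt (Suc n) * real (Suc n) powr (- c)) sums Re (mangoldt_series (of_real c))"
    proof -
      have eq: "Re (mangoldt (Suc n) * of_nat (Suc n) powr (- complex_of_real c)) = mangoldt (Suc n) * real (Suc n) powr (- c)" for n
      proof -
        have "(mangoldt (Suc n) * of_nat (Suc n) powr (- complex_of_real c) :: complex) = of_real (mangoldt (Suc n) * real (Suc n) powr (- c))"
          using powr_of_real[of "real (Suc n)" "- c"] by (simp del: of_nat_Suc add: of_nat_Suc[symmetric])
        then show ?thesis by (simp only: Re_complex_of_real)
      qed
      have "Re (complex_of_real c) > 1" using cb by simp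
      from sums_Re[OF mangoldt_series_sums[OF this]] show ?thesis unfolding eq .
    qed
    have "(\<Sum>n\<in>{1..N}. mangoldt n * real n powr (- c)) = (\<Sum>n<N. mangoldt (Suc n) * real (Suc n) powr (- c))"
      by (rule sum.reindex_bij_witness[of _ Suc "\<lambda>n. n - 1"]) auto
    also have "\<dots> \<le> Re (mangoldt_series (of_real c))"
      using sum_le_suminf[OF sums_summable[OF rs], of "{..<N}"] sums_unique[OF rs] by (simp add: mangoldt_nonneg)
    also have "\<dots> \<le> L + 10" unfolding c by (rule mangoldt_series_near_1) (rule L)
    finally show ?thesis
      unfolding d_def sum_distrib_left[symmetric] using x by (intro mult_left_mono) auto
  qed
  have A: "(\<Sum>n\<in>{n0..K}. a n) \<le> (L + 7/10) * (1012/1000 * x) * (101 / 100 + (2 + L))"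
  proof -
    have n0K: "n0 \<le> K" using xK x by (auto simp: n0_def)
    define J where "J = K - n0"
    \<comment> \<open>Only integers above \<open>x / 2\<close> occur, so the harmonic sum has fewer
      than about \<open>x / 2\<close> terms and its logarithm stays below \<open>L\<close>.\<close>
    have J: "2 * real J + 1 \<le> x"
    proof -
      have "K + 1 \<le> 2 * n0" unfolding n0_def by presburger
      then have "2 * J + 1 \<le> K" using n0K unfolding J_def by linarith
      then have "real (2 * J + 1) \<le> real K" by (simp only: of_nat_le_iff)
      then show ?thesis using xK by simp
    qed
    have "(\<Sum>n\<in>{n0..K}. 2 / x + 1 / (x - real n)) = (\<Sum>j\<le>J. 2 / x + 1 / (real j + 1 / 2))"
    proof (rule sum.reindex_bij_witness[of _ "\<lambda>j. K - j" "\<lambda>n. K - n"])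
      fix n assume n: "n \<in> {n0..K}"
      then have "real (K - n) = real K - real n" by (intro of_nat_diff) auto
      then have "real (K - n) + 1 / 2 = x - real n" unfolding xK by linarith
      then show "2 / x + 1 / (real (K - n) + 1 / 2) = 2 / x + 1 / (x - real n)" by (simp only:)
    qed (use n0K in \<open>auto simp: J_def\<close>)
    also have "\<dots> = (real J + 1) * (2 / x) + (\<Sum>j\<le>J. 1 / (real j + 1 / 2))" by (simp add: sum.distrib)
    also have "(real J + 1) * (2 / x) \<le> 101 / 100"
    proof -
      have "2 * (real J + 1) \<le> x + 1" using J by simp
      also have "\<dots> \<le> 101 / 100 * x" using x by simp
      finally show ?thesis using x by (simp add: divide_simps)
    qed
    also have "(\<Sum>j\<le>J. 1 / (real j + 1 / 2)) \<le> 2 + ln (2 * real J + 1)" by (rule sum_half_odd_reciprocals)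
    also have "ln (2 * real J + 1) \<le> L" unfolding L(1) using J x by (subst ln_le_cancel_iff) auto
    finally show ?thesis unfolding a_def sum_distrib_left[symmetric] using x L by (intro mult_left_mono) auto
  qed
  have B: "(\<Sum>n\<in>{K + 1..2 * K}. b n) \<le> (L + 7/10) * x * (2 + (L + 7 / 10))"
  proof -
    have K1: "K \<ge> 1" using xK x by auto
    have "(\<Sum>n\<in>{K + 1..2 * K}. 1 / (real n - x)) = (\<Sum>j\<le>K - 1. 1 / (real j + 1 / 2))"
    proof (rule sum.reindex_bij_witness[of _ "\<lambda>j. K + 1 + j" "\<lambda>n. n - (K + 1)"])
      fix n assume n: "n \<in> {K + 1..2 * K}"
      then have "real (n - (K + 1)) = real n - real (K + 1)" by (intro of_nat_diff) auto
      then have "real (n - (K + 1)) + 1 / 2 = real n - x" unfolding xK of_nat_add of_nat_1 by linarith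
      then show "1 / (real (n - (K + 1)) + 1 / 2) = 1 / (real n - x)" by (simp only:)
    qed (use K1 in auto)
    also have "\<dots> \<le> 2 + ln (2 * real (K - 1) + 1)" by (rule sum_half_odd_reciprocals)
    also have "ln (2 * real (K - 1) + 1) \<le> ln (2 * x)"
    proof (subst ln_le_cancel_iff)
      have "real (K - 1) = real K - 1" using K1 by (simp add: of_nat_diff)
      then have "2 * real (K - 1) + 1 = 2 * (real K - 1) + 1" by (simp only:)
      also have "\<dots> \<le> 2 * x" unfolding xK by simp
      finally show "2 * real (K - 1) + 1 \<le> 2 * x" .
    qed (use x in auto)
    also have "ln (2 * x) = ln 2 + L" using x L by (simp add: ln_mult)
    also have "ln 2 + L \<le> L + 7 / 10" using ln2_le_25_over_36 by simp
    finally show ?thesis unfolding b_def sum_distrib_left[symmetric] using x L by (intro mult_left_mono) auto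
  qed
  have "(\<Sum>n<N. mangoldt (Suc n) * w (Suc n)) \<le> (\<Sum>n\<in>{1..N}. d n) + (\<Sum>n\<in>{n0..K}. a n) + (\<Sum>n\<in>{K + 1..2 * K}. b n)"
    unfolding S0 by (rule order_trans[OF S1]) (unfold S2, rule S3)
  also have "\<dots> \<le> 3 / 2 * (exp 1 * x) * (L + 10) + (L + 7/10) * (1012/1000 * x) * (101 / 100 + (2 + L)) + (L + 7/10) * x * (2 + (L + 7 / 10))"
    by (intro add_mono D A B)
  also have "\<dots> \<le> 2212 / 1000 * x * L\<^sup>2"
    by (rule perron_constant_bound) (use x L in auto)
  finally show ?thesis unfolding w_def .
qed

section \<open>Zeros of the zeta function\<close>

text \<open>The functional equation would reflect a zero with \<open>-1 < Re s \<le> 0\<close> to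
  one with \<open>Re s \<ge> 1\<close>, where there are none; its other factors do not
  vanish.\<close>

lemma zeta1_zero_strip:
  assumes z: "zeta1 s = 0" and s: "Re s > -1"
  shows "0 < Re s" "Re s < 1"
proof -
  have ge1: "zeta1 w \<noteq> 0" if w: "Re w \<ge> 1" for w
  proof (cases "Re w = 1")
    case True
    then have "w = Complex 1 (Im w)" by (simp add: complex_eq_iff)
    then show ?thesis using zeta1_nonzero_Re_eq_1[of "Im w"] by simp
  next
    case False
    then show ?thesis using w by (intro zeta1_nonzero_Re_gt_1) simp
  qed
  show s1: "Re s < 1" using ge1[of s] z by linarith
  have np: "w \<notin> \<int>\<^sub>\<le>\<^sub>0" if "Re w > 0" for w :: complex
    using that by (auto elim!: nonpos_Ints_cases)
  show "0 < Re s"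
  proof (rule ccontr)
    assume "\<not> 0 < Re s"
    then have s0: "Re s \<le> 0" by simp
    have "Gamma (s + 1) * zeta1 s =
        (1 - s) * of_real (2 * pi) powr (s - 1) * Gamma ((1 + s) / 2) * Gamma ((1 - s) / 2) * zeta1 (1 - s)"
      using s s1 by (rule zeta1_functional_equation)
    moreover have "1 - s \<noteq> 0" using s1 by auto
    moreover have "complex_of_real (2 * pi) powr (s - 1) \<noteq> 0" by simp
    moreover have "Gamma ((1 + s) / 2) \<noteq> 0" "Gamma ((1 - s) / 2) \<noteq> 0"
      using s s1 by (simp_all add: Gamma_eq_zero_iff np)
    moreover have "zeta1 (1 - s) \<noteq> 0" using s0 by (intro ge1) simp
    ultimately show False using z by simp
  qed
qed

text \<open>All discs about \<open>2 + it\<close> and all contours stay in \<open>Re s > -1\<close>,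
  so this condition is the one that can be checked there.\<close>

lemma nontrivial_zeros_iff: "\<rho> \<in> nontrivial_zeros \<longleftrightarrow> zeta1 \<rho> = 0 \<and> Re \<rho> > -1"
proof -
  have "riemann_zeta \<rho> = 0 \<longleftrightarrow> zeta1 \<rho> = 0" if "Re \<rho> < 1"
    using that zeta1_eq[of \<rho>] by (cases "\<rho> = 1") auto
  then show ?thesis using zeta1_zero_strip[of \<rho>] by (auto simp: nontrivial_zeros_def)
qed

lemma zeta1_not_zero_1: "zeta1 1 \<noteq> 0" by simp

text \<open>The factor \<open>s - 1\<close> is a unit near a point other than 1 and leaves the order
  unchanged.\<close>

lemma zorder_riemann_zeta:
  assumes "\<rho> \<in> nontrivial_zeros"
  shows "zorder riemann_zeta \<rho> = zorder zeta1 \<rho>"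
proof -
  define n where "n = zorder zeta1 \<rho>"
  have \<rho>: "zeta1 \<rho> = 0" "\<rho> \<noteq> 1" using assms by (auto simp: nontrivial_zeros_iff)
  have ex: "\<exists>w\<in>UNIV. zeta1 w \<noteq> 0" using zeta1_not_zero_1 by blast
  from zorder_exist_zero[OF zeta1_holomorphic_UNIV open_UNIV connected_UNIV UNIV_I[of \<rho>] ex] \<rho>(1)
  obtain r where n: "n > 0" and r: "r > 0" "zor_poly zeta1 \<rho> holomorphic_on cball \<rho> r"
    "\<And>w. w \<in> cball \<rho> r \<Longrightarrow> zeta1 w = zor_poly zeta1 \<rho> w * (w - \<rho>) ^ nat n \<and> zor_poly zeta1 \<rho> w \<noteq> 0"
    unfolding n_def by auto
  show ?thesis unfolding n_def[symmetric]
  proof (rule zorder_eqI[of "ball \<rho> r - {1}" _ "\<lambda>w. zor_poly zeta1 \<rho> w / (w - 1)"])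
    show "open (ball \<rho> r - {1})" by (intro open_Diff) auto
    show "\<rho> \<in> ball \<rho> r - {1}" using r \<rho> by auto
    have "zor_poly zeta1 \<rho> holomorphic_on ball \<rho> r - {1}" using r(2) by (rule holomorphic_on_subset) auto
    then show "(\<lambda>w. zor_poly zeta1 \<rho> w / (w - 1)) holomorphic_on ball \<rho> r - {1}"
      by (intro holomorphic_intros) auto
    show "zor_poly zeta1 \<rho> \<rho> / (\<rho> - 1) \<noteq> 0" using r(1) r(3)[of \<rho>] \<rho> by auto
    fix w assume w: "w \<in> ball \<rho> r - {1}"
    then have "(w - 1) * riemann_zeta w = zor_poly zeta1 \<rho> w * (w - \<rho>) ^ nat n"
      using r(3)[of w] zeta1_eq[of w] by auto
    moreover have "(w - \<rho>) powi n = (w - \<rho>) ^ nat n" using n by (simp add: power_int_def)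
    ultimately show "riemann_zeta w = zor_poly zeta1 \<rho> w / (w - 1) * (w - \<rho>) powi n"
      using w by (simp add: field_simps)
  qed
qed

text \<open>Cut the unit interval into \<open>n + 1\<close> open cells; one contains no point of
  \<open>Z\<close>, and \<open>t\<close> is its midpoint. Points outside the interval are at least
  as far away, so the conclusion covers them too.\<close>

lemma Im_pigeonhole:
  fixes Z :: "real set"
  assumes "finite Z" "card Z \<le> n"
  obtains t where "a < t" "t < a + 1"
    "\<And>z. z \<in> Z \<or> z \<le> a \<or> a + 1 \<le> z \<Longrightarrow> \<bar>t - z\<bar> \<ge> 1 / (2 * (real n + 1))"
proof -
  define d where "d = 1 / (real n + 1)"
  have d: "d > 0" "(real n + 1) * d = 1" by (auto simp: d_def)
  define cell where "cell = (\<lambda>j::nat. {a + real j * d <..< a + (real j + 1) * d})"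
  have disj: "i = j" if "z \<in> cell i" "z \<in> cell j" for i j z
  proof -
    have *: "\<not> i < j" if "z \<in> cell i" "z \<in> cell j" for i j
    proof
      assume "i < j"
      then have "real i + 1 \<le> real j" by simp
      then have "(real i + 1) * d \<le> real j * d" using d by (intro mult_right_mono) auto
      with that show False by (auto simp: cell_def)
    qed
    show ?thesis using *[OF that] *[OF that(2,1)] by simp
  qed
  have "\<exists>j\<le>n. cell j \<inter> Z = {}"
  proof (rule ccontr)
    assume "\<not> ?thesis"
    then have "\<forall>j\<in>{..n}. \<exists>z. z \<in> cell j \<inter> Z" by auto
    then obtain f where f: "\<And>j. j \<le> n \<Longrightarrow> f j \<in> cell j \<inter> Z" by (metis atMost_iff)
    have "inj_on f {..n}" using disj f by (intro inj_onI) (metis IntD1 atMost_iff)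
    then have "card {..n} \<le> card Z" using f assms(1) by (intro card_inj_on_le[of f]) auto
    with assms(2) show False by simp
  qed
  then obtain j where j: "j \<le> n" "cell j \<inter> Z = {}" by blast
  define t where "t = a + (real j + 1 / 2) * d"
  have jd: "0 \<le> real j * d" "(real j + 1) * d \<le> 1"
  proof -
    show "0 \<le> real j * d" using d by simp
    have "(real j + 1) * d \<le> (real n + 1) * d" using j d by (intro mult_right_mono) auto
    then show "(real j + 1) * d \<le> 1" using d by simp
  qed
  have e: "(real j + 1 / 2) * d = real j * d + d / 2" "(real j + 1) * d = real j * d + d"
    by (simp_all add: algebra_simps)
  have d2: "1 / (2 * (real n + 1)) = d / 2" by (simp add: d_def)
  show ?thesis
  proof (rule that[of t])
    show "a < t" "t < a + 1" using jd d unfolding t_def e by linarith+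
    fix z assume "z \<in> Z \<or> z \<le> a \<or> a + 1 \<le> z"
    then have "z \<notin> cell j" using j(2) jd by (auto simp: cell_def)
    then have "z \<le> a + real j * d \<or> a + (real j * d + d) \<le> z" unfolding cell_def e by auto
    then show "\<bar>t - z\<bar> \<ge> 1 / (2 * (real n + 1))" unfolding d2 t_def e using d by linarith
  qed
qed

section \<open>Zero counts and bounds for the logarithmic derivative\<close>

text \<open>As \<open>e < 2.72\<close>, a comparison of rational powers certifies a lower bound for
  a logarithm.\<close>

lemma ln_ge_from_power:
  fixes y :: real
  assumes "y > 0" "(272 / 100) ^ p \<le> y ^ q" "q > 0"
  shows "real p / real q \<le> ln y"
proof -
  have "exp (real p) \<le> (272 / 100) ^ p"
    using e_less_272 power_mono[of "exp (1::real)" "272/100" p] by (simp add: exp_of_nat_mult[symmetric])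
  also have "\<dots> \<le> y ^ q" by fact
  finally have "ln (exp (real p)) \<le> ln (y ^ q)" by (subst ln_le_cancel_iff) (use assms in auto)
  then have "real p \<le> real q * ln y" using assms by (simp add: ln_realpow)
  then show ?thesis using assms by (simp add: field_simps)
qed

abbreviation zeta1_mult :: "complex \<Rightarrow> real" where
  "zeta1_mult \<rho> \<equiv> real (nat (zorder zeta1 \<rho>))"

lemma finite_zeta1_zeros_in: "finite (zeros_in zeta1 (Complex 2 t) r)"
  by (rule finite_zeros_in[OF zeta1_holomorphic_UNIV]) (rule zeta1_nonzero_Re_gt_1, simp)

context
  fixes x L :: real
  assumes L: "L = ln x" "L \<ge> 60" and x0: "x > 0"
begin

lemma x_eq_exp: "x = exp L" using L x0 by simp

lemma x_large: "x \<ge> 1000"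
proof -
  have "(1 + 60 / 3) ^ 3 \<le> exp (60 / 3 :: real) ^ 3" by (intro power_mono exp_ge_add_one_self) auto
  also have "\<dots> = exp 60" by (simp flip: exp_of_nat_mult)
  also have "exp 60 \<le> x" unfolding x_eq_exp using L by simp
  finally show ?thesis by simp
qed

text \<open>In 21/10, the 2 is the quadratic growth of \<open>zeta1_disc_bound\<close> at height up
  to \<open>x + 1\<close>; the extra 1/10 absorbs the constant 220, since
  \<open>exp (L / 10) \<ge> exp 6 > 220\<close>.\<close>

lemma zeta1_growth:
  assumes t: "\<bar>t\<bar> \<le> x + 1"
  shows "growth_disc zeta1 (Complex 2 t) (29 / 10) (21 / 10 * L)"
proof
  show "zeta1 holomorphic_on UNIV" by (rule zeta1_holomorphic_UNIV)
  show nz: "zeta1 (Complex 2 t) \<noteq> 0" by (rule zeta1_nonzero_Re_gt_1) simp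
  fix z assume "cmod (z - Complex 2 t) = 29 / 10"
  then have "cmod (zeta1 z) \<le> 216 * (\<bar>t\<bar> + 6)\<^sup>2 * cmod (zeta1 (Complex 2 t))"
    by (intro zeta1_disc_bound) simp
  also have "\<dots> < exp (21 / 10 * L) * cmod (zeta1 (Complex 2 t))"
  proof (rule mult_strict_right_mono)
    have "\<bar>t\<bar> + 6 \<le> 1007 / 1000 * x" using t x_large by simp
    then have "(\<bar>t\<bar> + 6)\<^sup>2 \<le> (1007 / 1000 * x)\<^sup>2" by (intro power_mono) auto
    also have "\<dots> = (1007 / 1000)\<^sup>2 * exp (2 * L)"
      by (simp add: power_mult_distrib power_divide x_eq_exp exp_double)
    also have "(1007 / 1000)\<^sup>2 = (1014049 / 1000000 :: real)" by (simp add: power2_eq_square)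
    finally have "216 * (\<bar>t\<bar> + 6)\<^sup>2 \<le> 220 * exp (2 * L)" using exp_gt_zero[of "2 * L"] by linarith
    also have "\<dots> < exp (L / 10) * exp (2 * L)"
    proof (rule mult_strict_right_mono)
      have "(220 :: real) < (1 + 1 + 1\<^sup>2 / 2) ^ 6" by (simp add: power_divide)
      also have "\<dots> \<le> exp 1 ^ 6" by (intro power_mono exp_lower_Taylor_quadratic) auto
      also have "\<dots> = exp 6" by (simp flip: exp_of_nat_mult)
      also have "\<dots> \<le> exp (L / 10)" using L by simp
      finally show "220 < exp (L / 10)" .
    qed simp
    also have "\<dots> = exp (21 / 10 * L)" by (simp add: exp_add[symmetric])
    finally show "216 * (\<bar>t\<bar> + 6)\<^sup>2 < exp (21 / 10 * L)" .
  qed (use nz in auto)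
  finally show "cmod (zeta1 z) < exp (21 / 10 * L) * cmod (zeta1 (Complex 2 t))" .
qed simp

text \<open>\<open>k\<close> is a rational stand-in for the logarithm. The values 1/3, 7/12 and 1/7
  used below turn \<open>21/10 * L / k\<close> into 6.3 L, 3.6 L and 14.7 L.\<close>

lemma zeta1_zero_count:
  assumes t: "\<bar>t\<bar> \<le> x + 1" and r: "0 < r" "r < 29 / 10" and k: "0 < k" "k \<le> ln (29 / 10 / r)"
  shows "(\<Sum>\<rho>\<in>zeros_in zeta1 (Complex 2 t) r. zeta1_mult \<rho>) \<le> 21 / 10 * L / k"
proof -
  let ?N = "\<Sum>\<rho>\<in>zeros_in zeta1 (Complex 2 t) r. zeta1_mult \<rho>"
  have "?N * k \<le> ?N * ln (29 / 10 / r)" using k by (intro mult_left_mono sum_nonneg) auto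
  also have "\<dots> \<le> 21 / 10 * L" using growth_disc.zero_count[OF zeta1_growth[OF t] r] by simp
  finally show ?thesis using k by (simp add: field_simps)
qed

text \<open>
  About \<open>2 + it\<close>, radius \<open>2.07 > sqrt (2\<^sup>2 + 0.5\<^sup>2)\<close> reaches every zero with \<open>|Im \<rho> - t| \<le> 1/2\<close>, radius
  \<open>1.6 > sqrt (1.5\<^sup>2 + 0.25\<^sup>2)\<close> those with \<open>Re \<rho> \<ge> 1/2\<close> and \<open>|Im \<rho> - t| \<le> 1/4\<close>, and radius \<open>2.5\<close> leaves
  room around the points \<open>-1/4 + it\<close>.
\<close>

lemma zero_count_207: "\<bar>t\<bar> \<le> x + 1 \<Longrightarrow> (\<Sum>\<rho>\<in>zeros_in zeta1 (Complex 2 t) (207 / 100). zeta1_mult \<rho>) \<le> 63 / 10 * L"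
  using zeta1_zero_count[of t "207/100" "real 1 / real 3"] ln_ge_from_power[of "29 / 10 / (207 / 100)" 1 3]
  by (simp add: power_divide)

lemma zero_count_16: "\<bar>t\<bar> \<le> x + 1 \<Longrightarrow> (\<Sum>\<rho>\<in>zeros_in zeta1 (Complex 2 t) (16 / 10). zeta1_mult \<rho>) \<le> 36 / 10 * L"
  using zeta1_zero_count[of t "16/10" "real 7 / real 12"] ln_ge_from_power[of "29 / 10 / (16 / 10)" 7 12]
  by (simp add: power_divide)

lemma zero_count_25: "\<bar>t\<bar> \<le> x + 1 \<Longrightarrow> (\<Sum>\<rho>\<in>zeros_in zeta1 (Complex 2 t) (25 / 10). zeta1_mult \<rho>) \<le> 147 / 10 * L"
  using zeta1_zero_count[of t "25/10" "real 1 / real 7"] ln_ge_from_power[of "29 / 10 / (25 / 10)" 1 7]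
  by (simp add: power_divide)

text \<open>Landau's bound with radii 2.25, 2.5 and 2.9, where 2.25 is the distance from 2 to -1/4.
  Every zero of the disc is charged at distance \<open>d\<close>. The 652 is 638.4 from
  Borel-Caratheodory plus 14.7 * 0.9 from the replaced factors, rounded up.\<close>

lemma zeta1_logderiv_bound_left:
  assumes t: "\<bar>t\<bar> \<le> x + 1" and \<sigma>: "- 1 / 4 \<le> \<sigma>" "\<sigma> \<le> 2" and nz: "zeta1 (Complex \<sigma> t) \<noteq> 0"
    and d: "d > 0" "\<And>\<rho>. \<rho> \<in> zeros_in zeta1 (Complex 2 t) (25 / 10) \<Longrightarrow> cmod (Complex \<sigma> t - \<rho>) \<ge> d"
  shows "cmod (deriv zeta1 (Complex \<sigma> t) / zeta1 (Complex \<sigma> t)) \<le> 652 * L + 147 / 10 * L / d"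
proof -
  let ?Z = "zeros_in zeta1 (Complex 2 t) (25 / 10)" and ?s = "Complex \<sigma> t"
  have "?s - Complex 2 t = of_real (\<sigma> - 2)" by (simp add: complex_eq_iff)
  then have "cmod (?s - Complex 2 t) = \<bar>\<sigma> - 2\<bar>" by (simp only: norm_of_real)
  then have zz: "cmod (?s - Complex 2 t) \<le> 225 / 100" using \<sigma> by simp
  have "cmod (deriv zeta1 ?s / zeta1 ?s) \<le> 4 * (21 / 10 * L) * (25 / 10 + 225 / 100) / (25 / 10 - 225 / 100)\<^sup>2 +
      (\<Sum>\<rho>\<in>?Z. zeta1_mult \<rho> * (1 / cmod (?s - \<rho>) + 25 / 10 / ((29 / 10)\<^sup>2 - 25 / 10 * (225 / 100))))"
    by (rule growth_disc.logderiv_bound[OF zeta1_growth[OF t]]) (use zz nz in auto)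
  also have "(\<Sum>\<rho>\<in>?Z. zeta1_mult \<rho> * (1 / cmod (?s - \<rho>) + 25 / 10 / ((29 / 10)\<^sup>2 - 25 / 10 * (225 / 100))))
      \<le> (\<Sum>\<rho>\<in>?Z. zeta1_mult \<rho> * (1 / d + 9 / 10))"
  proof (intro sum_mono mult_left_mono add_mono)
    fix \<rho> assume "\<rho> \<in> ?Z"
    then have "d \<le> cmod (?s - \<rho>)" by (rule d(2))
    then show "1 / cmod (?s - \<rho>) \<le> 1 / d" using d(1) by (intro frac_le) auto
  qed (auto simp: power2_eq_square)
  also have "(\<Sum>\<rho>\<in>?Z. zeta1_mult \<rho> * (1 / d + 9 / 10)) = (\<Sum>\<rho>\<in>?Z. zeta1_mult \<rho>) * (1 / d + 9 / 10)"
    by (rule sum_distrib_right[symmetric])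
  also have "\<dots> \<le> 147 / 10 * L * (1 / d + 9 / 10)"
    using zero_count_25[OF t] d by (intro mult_right_mono) auto
  finally have "cmod (deriv zeta1 ?s / zeta1 ?s) \<le> 4 * (21 / 10 * L) * (25 / 10 + 225 / 100) / (25 / 10 - 225 / 100)\<^sup>2
      + 147 / 10 * L * (1 / d + 9 / 10)" by simp
  also have "\<dots> = 63840 / 100 * L + 1323 / 100 * L + 147 / 10 * L / d"
    by (simp add: power2_eq_square distrib_left)
  also have "\<dots> \<le> 652 * L + 147 / 10 * L / d" using L by simp
  finally show ?thesis .
qed

text \<open>For \<open>\<sigma> \<ge> 3/4\<close> a zero closer than 1/4 has real part at least 1/2
  and ordinate within 1/4 of \<open>t\<close>, hence lies in the disc of radius 1.6. Only those 3.6
  L zeros are charged \<open>1 / d\<close>; the others cost 4 each. The 86.1 is 20.16 from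
  Borel-Caratheodory plus 14.7 * 4.48, rounded up.\<close>

lemma zeta1_logderiv_bound_right:
  assumes t: "\<bar>t\<bar> \<le> x + 1" and \<sigma>: "3 / 4 \<le> \<sigma>" "\<sigma> \<le> 2" and nz: "zeta1 (Complex \<sigma> t) \<noteq> 0"
    and d: "d > 0" "\<And>\<rho>. \<rho> \<in> zeros_in zeta1 (Complex 2 t) (25 / 10) \<Longrightarrow> \<bar>Im \<rho> - t\<bar> \<ge> d"
  shows "cmod (deriv zeta1 (Complex \<sigma> t) / zeta1 (Complex \<sigma> t)) \<le> 861 / 10 * L + 36 / 10 * L / d"
proof -
  let ?Z = "zeros_in zeta1 (Complex 2 t) (25 / 10)" and ?s = "Complex \<sigma> t" and ?Y = "zeros_in zeta1 (Complex 2 t) (16 / 10)"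
  have "?s - Complex 2 t = of_real (\<sigma> - 2)" by (simp add: complex_eq_iff)
  then have "cmod (?s - Complex 2 t) = \<bar>\<sigma> - 2\<bar>" by (simp only: norm_of_real)
  then have zz: "cmod (?s - Complex 2 t) \<le> 125 / 100" using \<sigma> by simp
  have fin: "finite ?Z" "finite ?Y" by (rule finite_zeta1_zeros_in)+
  have YZ: "?Y \<subseteq> ?Z" by (auto simp: zeros_in_def)
  have reciprocal_le: "1 / cmod (?s - \<rho>) \<le> 4 + (if \<rho> \<in> ?Y then 1 / d else 0)" if \<rho>: "\<rho> \<in> ?Z" for \<rho>
  proof (cases "\<rho> \<in> ?Y")
    case True
    have "\<bar>Im (?s - \<rho>)\<bar> \<le> cmod (?s - \<rho>)" by (rule abs_Im_le_cmod)
    then have "d \<le> cmod (?s - \<rho>)" using d(2)[OF \<rho>] by simp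
    then have "1 / cmod (?s - \<rho>) \<le> 1 / d" using d(1) by (intro frac_le) auto
    then show ?thesis using True by simp
  next
    case False
    have zr: "zeta1 \<rho> = 0" "cmod (\<rho> - Complex 2 t) \<le> 25 / 10" using \<rho> by (auto simp: zeros_in_def)
    have "\<bar>Re (\<rho> - Complex 2 t)\<bar> \<le> 25 / 10" using abs_Re_le_cmod[of "\<rho> - Complex 2 t"] zr by linarith
    then have "\<bar>Re \<rho> - 2\<bar> \<le> 25 / 10" by simp
    then have "Re \<rho> > -1" by linarith
    then have st: "0 < Re \<rho>" "Re \<rho> < 1" using zeta1_zero_strip[OF zr(1)] by auto
    have far: "cmod (\<rho> - Complex 2 t) > 16 / 10" using False zr by (auto simp: zeros_in_def)
    have "cmod (?s - \<rho>) \<ge> 1 / 4"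
    proof (cases "Re \<rho> < 1 / 2")
      case True
      have "\<bar>Re (?s - \<rho>)\<bar> \<le> cmod (?s - \<rho>)" by (rule abs_Re_le_cmod)
      then show ?thesis using True \<sigma> by simp
    next
      case False
      have "\<bar>Im \<rho> - t\<bar> \<ge> 1 / 4"
      proof (rule ccontr)
        assume "\<not> ?thesis"
        then have a: "\<bar>Im \<rho> - t\<bar> \<le> 1 / 4" by simp
        have b: "\<bar>Re \<rho> - 2\<bar> \<le> 3 / 2" using False st by simp
        have "(cmod (\<rho> - Complex 2 t))\<^sup>2 = \<bar>Re \<rho> - 2\<bar>\<^sup>2 + \<bar>Im \<rho> - t\<bar>\<^sup>2" by (simp add: cmod_power2)
        also have "\<dots> \<le> (3 / 2)\<^sup>2 + (1 / 4)\<^sup>2" using a b by (intro add_mono power_mono) auto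
        also have "\<dots> \<le> (16 / 10)\<^sup>2" by (simp add: power2_eq_square)
        finally have "cmod (\<rho> - Complex 2 t) \<le> 16 / 10" by (rule power2_le_imp_le) simp
        with far show False by simp
      qed
      moreover have "\<bar>Im (?s - \<rho>)\<bar> \<le> cmod (?s - \<rho>)" by (rule abs_Im_le_cmod)
      ultimately show ?thesis by (simp add: abs_minus_commute)
    qed
    then have "1 / cmod (?s - \<rho>) \<le> 1 / (1 / 4)" by (intro frac_le) auto
    then show ?thesis using False by simp
  qed
  have A: "(\<Sum>\<rho>\<in>?Z. zeta1_mult \<rho> * (1 / cmod (?s - \<rho>) + 25 / 10 / ((29 / 10)\<^sup>2 - 25 / 10 * (125 / 100))))
      \<le> (\<Sum>\<rho>\<in>?Z. zeta1_mult \<rho> * (448 / 100) + (if \<rho> \<in> ?Y then zeta1_mult \<rho> / d else 0))"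
  proof (rule sum_mono)
    fix \<rho> assume "\<rho> \<in> ?Z"
    from reciprocal_le[OF this] have "1 / cmod (?s - \<rho>) + 25 / 10 / ((29 / 10)\<^sup>2 - 25 / 10 * (125 / 100)) \<le> 448 / 100 + (if \<rho> \<in> ?Y then 1 / d else 0)"
      by (simp add: power2_eq_square split: if_splits)
    then have "zeta1_mult \<rho> * (1 / cmod (?s - \<rho>) + 25 / 10 / ((29 / 10)\<^sup>2 - 25 / 10 * (125 / 100))) \<le> zeta1_mult \<rho> * (448 / 100 + (if \<rho> \<in> ?Y then 1 / d else 0))"
      by (rule mult_left_mono) simp
    then show "zeta1_mult \<rho> * (1 / cmod (?s - \<rho>) + 25 / 10 / ((29 / 10)\<^sup>2 - 25 / 10 * (125 / 100))) \<le> zeta1_mult \<rho> * (448 / 100) + (if \<rho> \<in> ?Y then zeta1_mult \<rho> / d else 0)"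
      by (simp add: distrib_left split: if_splits)
  qed
  have "(\<Sum>\<rho>\<in>?Z. zeta1_mult \<rho> * (448 / 100) + (if \<rho> \<in> ?Y then zeta1_mult \<rho> / d else 0))
      = (\<Sum>\<rho>\<in>?Z. zeta1_mult \<rho>) * (448 / 100) + (\<Sum>\<rho>\<in>?Y. zeta1_mult \<rho>) / d"
    unfolding sum.distrib sum_distrib_right[symmetric] sum_divide_distrib
    using YZ fin by (simp add: sum.inter_restrict[symmetric] Int_absorb1)
  also have "\<dots> \<le> 147 / 10 * L * (448 / 100) + 36 / 10 * L / d"
    using zero_count_25[OF t] zero_count_16[OF t] d(1) by (intro add_mono mult_right_mono divide_right_mono) auto
  finally have B: "(\<Sum>\<rho>\<in>?Z. zeta1_mult \<rho> * (448 / 100) + (if \<rho> \<in> ?Y then zeta1_mult \<rho> / d else 0)) \<le> 147 / 10 * L * (448 / 100) + 36 / 10 * L / d" .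
  have C: "cmod (deriv zeta1 ?s / zeta1 ?s) \<le> 4 * (21 / 10 * L) * (25 / 10 + 125 / 100) / (25 / 10 - 125 / 100)\<^sup>2 +
      (\<Sum>\<rho>\<in>?Z. zeta1_mult \<rho> * (1 / cmod (?s - \<rho>) + 25 / 10 / ((29 / 10)\<^sup>2 - 25 / 10 * (125 / 100))))"
    by (rule growth_disc.logderiv_bound[OF zeta1_growth[OF t]]) (use zz nz in auto)
  have D: "4 * (21 / 10 * L) * (25 / 10 + 125 / 100) / (25 / 10 - 125 / 100)\<^sup>2 = 2016 / 100 * L"
    by (simp add: power2_eq_square)
  show ?thesis using A B C L unfolding D by linarith
qed

end

section \<open>The contour integral of the explicit formula\<close>

text \<open>Cauchy's inequality on the circle of radius 1/2 with \<open>zeta1 0 = 1/2\<close>. A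
  crude value is enough, since the final unit of error is at least 3600.\<close>

lemma residue_0_bound: "cmod (- 1 - deriv zeta1 0 / zeta1 0) \<le> 17"
proof -
  have "norm ((deriv ^^ 1) zeta1 0) \<le> fact 1 * 4 / (1 / 2) ^ 1"
  proof (rule Cauchy_inequality)
    show "zeta1 holomorphic_on ball 0 (1 / 2)"
      using zeta1_holomorphic_UNIV by (rule holomorphic_on_subset) simp
    show "continuous_on (cball 0 (1 / 2)) zeta1"
      by (rule holomorphic_on_imp_continuous_on, rule holomorphic_on_subset[OF zeta1_holomorphic_UNIV]) simp
    fix s :: complex assume "norm (0 - s) = 1 / 2"
    then have s: "cmod s = 1 / 2" by simp
    then have 1: "cmod (s - 1) \<le> 3 / 2" "cmod (s + 1) \<le> 3 / 2"
      using norm_triangle_ineq4[of s 1] norm_triangle_ineq[of s 1] by simp_all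
    have "Re s \<ge> 3 / 2 - 2" using abs_Re_le_cmod[of s] s by simp
    then have "cmod (zeta1 s) \<le> 1 + cmod (s - 1) / 2 + cmod (s - 1) * cmod s * cmod (s + 1) / 2 * ((3/2) / (3/2 - 1))"
      by (intro zeta1_bound) auto
    also have "\<dots> \<le> 1 + (3/2) / 2 + (3/2) * (1/2) * (3/2) / 2 * ((3/2) / (3/2 - 1))"
      using 1 s by (intro add_mono mult_mono divide_right_mono) auto
    also have "\<dots> \<le> 4" by simp
    finally show "norm (zeta1 s) \<le> 4" .
  qed simp
  then have "cmod (deriv zeta1 0) \<le> 8" by simp
  then have "cmod (deriv zeta1 0 / zeta1 0) \<le> 16" by (simp add: norm_divide)
  then show ?thesis using norm_triangle_ineq4[of "- 1" "deriv zeta1 0 / zeta1 0"] by simp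
qed

lemma zeros_in_strip:
  assumes "\<rho> \<in> zeros_in zeta1 (Complex 2 t) (25 / 10)"
  shows "zeta1 \<rho> = 0" "Re \<rho> > -1"
proof -
  show "zeta1 \<rho> = 0" using assms by (simp add: zeros_in_def)
  have "\<bar>Re (\<rho> - Complex 2 t)\<bar> \<le> 25 / 10"
    using assms abs_Re_le_cmod[of "\<rho> - Complex 2 t"] unfolding zeros_in_def by simp
  then have "\<bar>Re \<rho> - 2\<bar> \<le> 25 / 10" by simp
  then show "Re \<rho> > -1" by linarith
qed

section \<open>Residues of the integrand\<close>

text \<open>The Perron integrand \<open>- \<zeta>'/\<zeta> (s) * x powr s / s\<close>, with the pole
  at 1 split off so that the remaining quotient has poles only at zeros of
  \<open>zeta1\<close>.\<close>

definition explicit_integrand :: "real \<Rightarrow> complex \<Rightarrow> complex" where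
  "explicit_integrand x s = (1 / (s - 1) - deriv zeta1 s / zeta1 s) * (of_real x powr s / s)"

lemma explicit_integrand_holomorphic:
  assumes "x > 0" "0 \<notin> S" "1 \<notin> S" "\<And>s. s \<in> S \<Longrightarrow> zeta1 s \<noteq> 0"
  shows "explicit_integrand x holomorphic_on S"
proof -
  have d: "deriv zeta1 holomorphic_on S"
    using holomorphic_deriv[OF zeta1_holomorphic_UNIV open_UNIV] by (rule holomorphic_on_subset) simp
  have "zeta1 holomorphic_on S" using zeta1_holomorphic_UNIV by (rule holomorphic_on_subset) simp
  with d have "(\<lambda>s. deriv zeta1 s / zeta1 s) holomorphic_on S"
    by (rule holomorphic_on_divide) (rule assms(4))
  moreover have "(\<lambda>s. 1 / (s - 1)) holomorphic_on S" "(\<lambda>s. of_real x powr s / s) holomorphic_on S"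
    using assms by (intro holomorphic_intros; auto)+
  ultimately show ?thesis
    unfolding explicit_integrand_def by (intro holomorphic_on_mult holomorphic_on_diff)
qed

text \<open>Every singularity in question is isolated: a box within \<open>Re s > -1\<close>
  contains only finitely many others, and these are removed from it. The pole being at most simple,
  the residue is a limit.\<close>

lemma explicit_integrand_residue:
  assumes x: "x > 0" and z: "z = 0 \<or> z = 1 \<or> zeta1 z = 0" "Re z > -1"
    and lim: "((\<lambda>w. explicit_integrand x w * (w - z)) \<longlongrightarrow> l) (at z)"
  shows "residue (explicit_integrand x) z = l"
proof -
  let ?P = "insert 0 (insert 1 {\<rho> \<in> nontrivial_zeros. \<bar>Im \<rho>\<bar> < \<bar>Im z\<bar> + 1}) - {z}"
  let ?S = "box (Complex (- 1) (- (\<bar>Im z\<bar> + 1))) (Complex (Re z + 1) (\<bar>Im z\<bar> + 1)) - ?P"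
  have fin: "finite ?P" using finite_nontrivial_zeros by simp
  show ?thesis
  proof (rule residue_simple'[of ?S])
    show "open ?S" using fin by (intro open_Diff open_box finite_imp_closed)
    show "z \<in> ?S" using z(2) by (auto simp: in_box_complex_iff)
    show "explicit_integrand x holomorphic_on ?S - {z}"
      using x by (intro explicit_integrand_holomorphic) (auto simp: in_box_complex_iff nontrivial_zeros_iff)
  qed fact
qed

lemma explicit_integrand_residue_1:
  assumes x: "x > 0" shows "residue (explicit_integrand x) 1 = of_real x"
proof (rule explicit_integrand_residue[OF x])
  have d: "isCont (deriv zeta1) 1" "isCont zeta1 1"
    using holomorphic_on_imp_continuous_on[OF holomorphic_deriv[OF zeta1_holomorphic_UNIV open_UNIV]]
      holomorphic_on_imp_continuous_on[OF zeta1_holomorphic_UNIV]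
    by (simp_all add: continuous_on_eq_continuous_at)
  have "isCont (\<lambda>w. (1 - (w - 1) * (deriv zeta1 w / zeta1 w)) * (of_real x powr w / w)) (1 :: complex)"
    using x by (intro continuous_intros d) auto
  then have "((\<lambda>w. (1 - (w - 1) * (deriv zeta1 w / zeta1 w)) * (of_real x powr w / w)) \<longlongrightarrow>
      (1 - (1 - 1) * (deriv zeta1 1 / zeta1 1)) * (of_real x powr 1 / 1)) (at (1 :: complex))"
    unfolding isCont_def .
  then have "((\<lambda>w. (1 - (w - 1) * (deriv zeta1 w / zeta1 w)) * (of_real x powr w / w)) \<longlongrightarrow> of_real x) (at 1)"
    using x by simp
  then show "((\<lambda>w. explicit_integrand x w * (w - 1)) \<longlongrightarrow> of_real x) (at 1)"
  proof (rule Lim_transform_eventually)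
    have "(1 - (w - 1) * q) * p = (1 / (w - 1) - q) * p * (w - 1)" if "w \<noteq> 1" for w q p :: complex
      using that by (simp add: field_simps)
    then show "\<forall>\<^sub>F w in at 1. (1 - (w - 1) * (deriv zeta1 w / zeta1 w)) * (of_real x powr w / w) = explicit_integrand x w * (w - 1)"
      unfolding explicit_integrand_def by (intro eventually_mono[OF eventually_neq_at_within]) blast
  qed
qed auto

lemma explicit_integrand_residue_0:
  assumes x: "x > 0" shows "residue (explicit_integrand x) 0 = - 1 - deriv zeta1 0 / zeta1 0"
proof (rule explicit_integrand_residue[OF x])
  have d: "isCont (deriv zeta1) 0" "isCont zeta1 0"
    using holomorphic_on_imp_continuous_on[OF holomorphic_deriv[OF zeta1_holomorphic_UNIV open_UNIV]]
      holomorphic_on_imp_continuous_on[OF zeta1_holomorphic_UNIV]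
    by (simp_all add: continuous_on_eq_continuous_at)
  have "isCont (\<lambda>w. (1 / (w - 1) - deriv zeta1 w / zeta1 w) * of_real x powr w) (0 :: complex)"
    using x by (intro continuous_intros d) auto
  then have "((\<lambda>w. (1 / (w - 1) - deriv zeta1 w / zeta1 w) * of_real x powr w) \<longlongrightarrow>
      (1 / (0 - 1) - deriv zeta1 0 / zeta1 0) * of_real x powr 0) (at (0 :: complex))"
    unfolding isCont_def .
  then have "((\<lambda>w. (1 / (w - 1) - deriv zeta1 w / zeta1 w) * of_real x powr w) \<longlongrightarrow> - 1 - deriv zeta1 0 / zeta1 0) (at 0)"
    using x by simp
  then show "((\<lambda>w. explicit_integrand x w * (w - 0)) \<longlongrightarrow> - 1 - deriv zeta1 0 / zeta1 0) (at 0)"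
  proof (rule Lim_transform_eventually)
    have "q * p = q * (p / w) * (w - 0)" if "w \<noteq> 0" for w q p :: complex
      using that by (simp add: field_simps)
    then show "\<forall>\<^sub>F w in at 0. (1 / (w - 1) - deriv zeta1 w / zeta1 w) * of_real x powr w = explicit_integrand x w * (w - 0)"
      unfolding explicit_integrand_def by (intro eventually_mono[OF eventually_neq_at_within]) blast
  qed
qed auto

lemma explicit_integrand_residue_zero:
  assumes x: "x > 0" and \<rho>: "zeta1 \<rho> = 0" "Re \<rho> > -1"
  shows "residue (explicit_integrand x) \<rho> = - (of_int (zorder zeta1 \<rho>) * (of_real x powr \<rho> / \<rho>))"
proof (rule explicit_integrand_residue[OF x _ \<rho>(2)])
  have n: "\<rho> \<noteq> 1" "\<rho> \<noteq> 0" using \<rho> by auto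
  have "isCont (\<lambda>w. (w - \<rho>) / (w - 1)) \<rho>" "isCont (\<lambda>w. of_real x powr w / w) \<rho>"
    using x n by (intro continuous_intros; auto)+
  then have l: "((\<lambda>w. (w - \<rho>) / (w - 1)) \<longlongrightarrow> (\<rho> - \<rho>) / (\<rho> - 1)) (at \<rho>)"
     "((\<lambda>w. of_real x powr w / w) \<longlongrightarrow> of_real x powr \<rho> / \<rho>) (at \<rho>)" unfolding isCont_def .
  have "((\<lambda>w. ((w - \<rho>) / (w - 1) - (w - \<rho>) * (deriv zeta1 w / zeta1 w)) * (of_real x powr w / w)) \<longlongrightarrow>
     ((\<rho> - \<rho>) / (\<rho> - 1) - of_int (zorder zeta1 \<rho>)) * (of_real x powr \<rho> / \<rho>)) (at \<rho>)"
    by (intro tendsto_mult tendsto_diff l logderiv_tendsto_zorder[OF zeta1_holomorphic_UNIV zeta1_not_zero_1])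
  then have lim: "((\<lambda>w. ((w - \<rho>) / (w - 1) - (w - \<rho>) * (deriv zeta1 w / zeta1 w)) * (of_real x powr w / w)) \<longlongrightarrow>
     - (of_int (zorder zeta1 \<rho>) * (of_real x powr \<rho> / \<rho>))) (at \<rho>)" by simp
  have eq: "((w - \<rho>) / (w - 1) - (w - \<rho>) * q) * p = (1 / (w - 1) - q) * p * (w - \<rho>)" for w q p :: complex
    by (simp add: divide_inverse algebra_simps)
  show "((\<lambda>w. explicit_integrand x w * (w - \<rho>)) \<longlongrightarrow> - (of_int (zorder zeta1 \<rho>) * (of_real x powr \<rho> / \<rho>))) (at \<rho>)"
    unfolding explicit_integrand_def eq[symmetric] by (rule lim)
qed (use \<rho> in auto)

text \<open>The residue theorem is applied on a box larger than the rectangle. It may contain zeros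
  of ordinate between \<open>U\<close> and \<open>U + 1\<close> in absolute value, which have
  winding number 0 and drop out.\<close>

lemma explicit_contour_integral:
  assumes x: "x > 0" and c: "c > 1" and U: "U > 0"
    and nz: "\<And>\<rho>. zeta1 \<rho> = 0 \<Longrightarrow> Re \<rho> > -1 \<Longrightarrow> \<bar>Im \<rho>\<bar> \<noteq> U"
  shows "contour_integral (rectpath (Complex (- 1 / 4) (- U)) (Complex c U)) (explicit_integrand x) =
    2 * of_real pi * \<i> * (of_real x + (- 1 - deriv zeta1 0 / zeta1 0) -
      (\<Sum>\<rho> | \<rho> \<in> nontrivial_zeros \<and> \<bar>Im \<rho>\<bar> < U. of_int (zorder zeta1 \<rho>) * (of_real x powr \<rho> / \<rho>)))"
proof -
  let ?a = "Complex (- 1 / 4) (- U)" and ?b = "Complex c U"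
  let ?g = "rectpath ?a ?b" and ?h = "\<lambda>\<rho>. of_int (zorder zeta1 \<rho>) * (of_real x powr \<rho> / \<rho>)"
  let ?S = "box (Complex (- 1 / 2) (- (U + 1))) (Complex (c + 1) (U + 1))"
  let ?Z = "{\<rho> \<in> nontrivial_zeros. \<bar>Im \<rho>\<bar> < U + 1}"
  let ?res = "\<lambda>p. winding_number ?g p * residue (explicit_integrand x) p"
  have fin: "finite ?Z" by (rule finite_nontrivial_zeros)
  have Z: "zeta1 \<rho> = 0" "0 < Re \<rho>" "Re \<rho> < 1" "\<bar>Im \<rho>\<bar> < U + 1" "\<bar>Im \<rho>\<bar> \<noteq> U" if "\<rho> \<in> ?Z" for \<rho>
    using that nz[of \<rho>] zeta1_zero_strip[of \<rho>] by (auto simp: nontrivial_zeros_iff)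
  have ab: "Re ?a \<le> Re ?b" "Im ?a \<le> Im ?b" using c U by auto
  have pimg: "path_image ?g = cbox ?a ?b - box ?a ?b" using ab by (rule path_image_rectpath_cbox_minus_box)
  have "contour_integral ?g (explicit_integrand x) = 2 * pi * \<i> * (\<Sum>p\<in>insert 0 (insert 1 ?Z). ?res p)"
  proof (rule Residue_theorem[of ?S])
    show "open ?S" by (rule open_box)
    show "connected ?S" by (intro convex_connected convex_box)
    show "finite (insert 0 (insert 1 ?Z))" using fin by simp
    show "explicit_integrand x holomorphic_on ?S - insert 0 (insert 1 ?Z)"
      using x by (intro explicit_integrand_holomorphic) (auto simp: in_box_complex_iff nontrivial_zeros_iff)
    show "path_image ?g \<subseteq> ?S - insert 0 (insert 1 ?Z)"
    proof
      fix z assume z: "z \<in> path_image ?g"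
      have "z \<noteq> 0" "z \<noteq> 1" using z c U unfolding pimg by (auto simp: in_box_complex_iff)
      moreover have "z \<notin> ?Z" using z c U Z[of z] unfolding pimg by (auto simp: in_box_complex_iff in_cbox_complex_iff)
      moreover have "z \<in> ?S" using z c U unfolding pimg by (auto simp: in_box_complex_iff in_cbox_complex_iff)
      ultimately show "z \<in> ?S - insert 0 (insert 1 ?Z)" by blast
    qed
    show "\<forall>z. z \<notin> ?S \<longrightarrow> winding_number ?g z = 0"
    proof (intro allI impI)
      fix z assume "z \<notin> ?S"
      then have "z \<notin> cbox ?a ?b" using c U by (auto simp: in_box_complex_iff in_cbox_complex_iff)
      then show "winding_number ?g z = 0" by (rule winding_number_rectpath_outside[OF ab])
    qed
  qed simp_all
  also have "(\<Sum>p\<in>insert 0 (insert 1 ?Z). ?res p) = ?res 0 + (?res 1 + (\<Sum>p\<in>?Z. ?res p))"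
    using fin Z(2)[of 0] Z(1)[of 1] zeta1_not_zero_1 by (subst sum.insert; fastforce)+
  also have "?res 0 = - 1 - deriv zeta1 0 / zeta1 0"
    using c U by (subst winding_number_rectpath) (auto simp: in_box_complex_iff explicit_integrand_residue_0[OF x])
  also have "?res 1 = of_real x"
    using c U by (subst winding_number_rectpath) (auto simp: in_box_complex_iff explicit_integrand_residue_1[OF x])
  also have "(\<Sum>p\<in>?Z. ?res p) = (\<Sum>p\<in>?Z. if \<bar>Im p\<bar> < U then - ?h p else 0)"
  proof (rule sum.cong[OF refl])
    fix p assume p: "p \<in> ?Z"
    have r: "residue (explicit_integrand x) p = - ?h p"
      using Z[OF p] by (intro explicit_integrand_residue_zero[OF x]) auto
    show "?res p = (if \<bar>Im p\<bar> < U then - ?h p else 0)"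
    proof (cases "\<bar>Im p\<bar> < U")
      case True
      then have "winding_number ?g p = 1" using Z[OF p] c by (intro winding_number_rectpath) (auto simp: in_box_complex_iff)
      then show ?thesis using True r by simp
    next
      case False
      then have "winding_number ?g p = 0" using Z[OF p] c by (intro winding_number_rectpath_outside ab) (auto simp: in_cbox_complex_iff)
      then show ?thesis using False by simp
    qed
  qed
  also have "\<dots> = (\<Sum>p\<in>{p \<in> ?Z. \<bar>Im p\<bar> < U}. - ?h p)" using fin by (rule sum.inter_filter[symmetric])
  also have "{p \<in> ?Z. \<bar>Im p\<bar> < U} = {\<rho>. \<rho> \<in> nontrivial_zeros \<and> \<bar>Im \<rho>\<bar> < U}" by auto
  finally show ?thesis by (simp add: sum_negf)
qed

section \<open>The ordinate \<open>U\<close>, the sides of the contour and the return to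
  \<open>T\<close>\<close>

context
  fixes x L :: real
  assumes L: "L = ln x" "L \<ge> 60" and x0: "x > 0"
begin

text \<open>All zeros with ordinate in \<open>(T, T + 1)\<close> lie in the disc of radius 2.07
  about \<open>2 + i (T + 1/2)\<close>, which has at most 6.3 L of them. The pigeonhole avoids their
  ordinates, and conjugation transfers the gap to \<open>-U\<close>.\<close>

lemma zero_free_ordinate:
  assumes T: "0 < T" "T < x"
  obtains U where "T < U" "U < T + 1"
    "\<And>\<rho>. zeta1 \<rho> = 0 \<Longrightarrow> Re \<rho> > -1 \<Longrightarrow> 1 / (1264 / 100 * L) \<le> \<bar>Im \<rho> - U\<bar> \<and> 1 / (1264 / 100 * L) \<le> \<bar>Im \<rho> - (- U)\<bar>"
proof -
  let ?Z = "zeros_in zeta1 (Complex 2 (T + 1 / 2)) (207 / 100)"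
  have fin: "finite ?Z" by (rule finite_zeta1_zeros_in)
  have "real (card ?Z) = (\<Sum>\<rho>\<in>?Z. 1)" by simp
  also have "\<dots> \<le> (\<Sum>\<rho>\<in>?Z. zeta1_mult \<rho>)"
  proof (rule sum_mono)
    fix \<rho> assume "\<rho> \<in> ?Z"
    then have "zorder zeta1 \<rho> > 0"
      by (intro zorder_entire_pos[OF zeta1_holomorphic_UNIV zeta1_not_zero_1]) (simp add: zeros_in_def)
    then show "1 \<le> zeta1_mult \<rho>" by linarith
  qed
  also have "\<dots> \<le> 63 / 10 * L" using T by (intro zero_count_207[OF L x0]) auto
  finally have cZ: "real (card ?Z) \<le> 63 / 10 * L" .
  obtain U where U: "T < U" "U < T + 1"
    "\<And>z. z \<in> Im ` ?Z \<or> z \<le> T \<or> T + 1 \<le> z \<Longrightarrow> \<bar>U - z\<bar> \<ge> 1 / (2 * (real (card ?Z) + 1))"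
    by (rule Im_pigeonhole[of "Im ` ?Z" "card ?Z" T]) (use fin in \<open>auto intro: card_image_le\<close>)
  \<comment> \<open>\<open>2 * (6.3 L + 1) \<le> 12.64 L\<close> because
    \<open>L \<ge> 60\<close>.\<close>
  have D: "1 / (1264 / 100 * L) \<le> 1 / (2 * (real (card ?Z) + 1))"
    using cZ L(2) by (intro frac_le) auto
  have far: "1 / (1264 / 100 * L) \<le> \<bar>Im \<rho> - U\<bar>" if \<rho>: "zeta1 \<rho> = 0" "Re \<rho> > -1" for \<rho>
  proof -
    have st: "0 < Re \<rho>" "Re \<rho> < 1" using zeta1_zero_strip[OF \<rho>] by auto
    have "Im \<rho> \<in> Im ` ?Z \<or> Im \<rho> \<le> T \<or> T + 1 \<le> Im \<rho>"
    proof (cases "T < Im \<rho> \<and> Im \<rho> < T + 1")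
      case True
      then have "T < Im \<rho>" "Im \<rho> < T + 1" by auto
      then have b: "\<bar>Im \<rho> - (T + 1 / 2)\<bar> \<le> 1 / 2" "\<bar>Re \<rho> - 2\<bar> \<le> 2" using st by linarith+
      have "(cmod (\<rho> - Complex 2 (T + 1 / 2)))\<^sup>2 = \<bar>Re \<rho> - 2\<bar>\<^sup>2 + \<bar>Im \<rho> - (T + 1 / 2)\<bar>\<^sup>2" by (simp add: cmod_power2)
      also have "\<dots> \<le> 2\<^sup>2 + (1 / 2)\<^sup>2" using b by (intro add_mono power_mono) auto
      also have "\<dots> \<le> (207 / 100)\<^sup>2" by (simp add: power2_eq_square)
      finally have "cmod (\<rho> - Complex 2 (T + 1 / 2)) \<le> 207 / 100" by (rule power2_le_imp_le) simp
      then show ?thesis using \<rho> by (auto simp: zeros_in_def)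
    qed auto
    from U(3)[OF this] D show ?thesis by linarith
  qed
  show ?thesis
  proof (rule that[OF U(1,2)])
    fix \<rho> assume \<rho>: "zeta1 \<rho> = 0" "Re \<rho> > -1"
    have "zeta1 (cnj \<rho>) = 0" using zeta1_cnj[OF \<rho>(2)] \<rho>(1) by simp
    then have "1 / (1264 / 100 * L) \<le> \<bar>Im (cnj \<rho>) - U\<bar>" using \<rho>(2) by (intro far) auto
    then show "1 / (1264 / 100 * L) \<le> \<bar>Im \<rho> - U\<bar> \<and> 1 / (1264 / 100 * L) \<le> \<bar>Im \<rho> - (- U)\<bar>"
      using far[OF \<rho>] by auto
  qed
qed

text \<open>\<open>exp (- L / 4) \<le> exp (- 15)\<close>, and
  \<open>exp 15 \<ge> 2 ^ 15\<close>.\<close>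

lemma x_powr_quarter: "x powr (- 1 / 4) \<le> 1 / 32768"
proof -
  have "(2 :: real) ^ 15 \<le> exp 1 ^ 15" using exp_ge_add_one_self[of "1::real"] by (intro power_mono) auto
  also have "\<dots> = exp 15" by (simp flip: exp_of_nat_mult)
  also have "\<dots> \<le> exp (L / 4)" using L by simp
  finally have e: "32768 \<le> exp (L / 4)" by simp
  have "x powr (- 1 / 4) = 1 / exp (L / 4)" using x0 L(1) by (simp add: powr_def exp_minus field_simps)
  also have "\<dots> \<le> 1 / 32768" using e by (intro frac_le) auto
  finally show ?thesis .
qed

text \<open>Integrating \<open>x powr \<sigma>\<close> gains \<open>1 / L\<close>, so bounds of
  order \<open>L^2\<close> for \<open>F'/F\<close> yield order \<open>x * L\<close>. Right of 3/4
  the constant 47 comes from 3.6 * 12.64 and the linear terms; times 2.72 for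
  \<open>x powr c = exp 1 * x\<close> it gives 127.84. The left part, with constant 200, is reduced
  by \<open>x powr (- 1/4)\<close>. Finally \<open>127.86 / 60 = 2.131\<close>.\<close>

lemma horizontal_side_bound:
  assumes t: "50 \<le> \<bar>t\<bar>" "\<bar>t\<bar> \<le> x + 1"
    and far: "\<And>\<rho>. zeta1 \<rho> = 0 \<Longrightarrow> Re \<rho> > -1 \<Longrightarrow> 1 / (1264 / 100 * L) \<le> \<bar>Im \<rho> - t\<bar>"
  shows "cmod (contour_integral (linepath (Complex (- 1 / 4) t) (Complex (1 + 1 / L) t)) (explicit_integrand x))
    \<le> 2131 / 1000 * x * L\<^sup>2 / \<bar>t\<bar>"
proof -
  let ?g = "explicit_integrand x" and ?c = "1 + 1 / L"
  define d where "d = 1 / (1264 / 100 * L)"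
  have d: "d > 0" "1 / d = 1264 / 100 * L" using L by (simp_all add: d_def)
  have L2: "60 * L \<le> L\<^sup>2" unfolding power2_eq_square using L by (intro mult_right_mono) auto
  have Lp: "1 / L \<le> 1" "0 \<le> 1 / L" using L(2) by simp_all
  then have c_ge: "3 / 4 \<le> ?c" "- 1 / 4 \<le> ?c" by linarith+
  have nz: "zeta1 (Complex \<sigma> t) \<noteq> 0" if "\<sigma> > -1" for \<sigma>
    using far[of "Complex \<sigma> t"] that d by (auto simp: d_def)
  have hol: "?g holomorphic_on closed_segment (Complex a t) (Complex b t)" if "-1 < a" "a \<le> b" for a b
  proof (rule explicit_integrand_holomorphic[OF x0])
    have s: "Im s = t \<and> Re s > -1" if "s \<in> closed_segment (Complex a t) (Complex b t)" for s
      using that \<open>-1 < a\<close> \<open>a \<le> b\<close> by (auto simp: closed_segment_same_Im closed_segment_eq_real_ivl)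
    show "0 \<notin> closed_segment (Complex a t) (Complex b t)" "1 \<notin> closed_segment (Complex a t) (Complex b t)"
      using s[of 0] s[of 1] t by auto
    fix s assume "s \<in> closed_segment (Complex a t) (Complex b t)"
    then have "s = Complex (Re s) t" "Re s > -1" using s by (auto simp: complex_eq_iff)
    then show "zeta1 s \<noteq> 0" using nz by metis
  qed
  note cont = holomorphic_on_imp_continuous_on[OF hol]
  have pt: "cmod (?g (Complex \<sigma> t)) \<le> C / \<bar>t\<bar> * x powr \<sigma>"
    if C: "cmod (deriv zeta1 (Complex \<sigma> t) / zeta1 (Complex \<sigma> t)) + 1 \<le> C" for \<sigma> C
  proof -
    let ?s = "Complex \<sigma> t"
    have s: "\<bar>t\<bar> \<le> cmod (?s - 1)" "\<bar>t\<bar> \<le> cmod ?s"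
      using abs_Im_le_cmod[of "?s - 1"] abs_Im_le_cmod[of ?s] by simp_all
    have "cmod (1 / (?s - 1)) = 1 / cmod (?s - 1)" by (simp add: norm_divide)
    also have "\<dots> \<le> 1 / 50" using s t by (intro frac_le) auto
    finally have 1: "cmod (1 / (?s - 1)) \<le> 1" by simp
    have "cmod (1 / (?s - 1) - deriv zeta1 ?s / zeta1 ?s) \<le> C"
      using norm_triangle_ineq4[of "1 / (?s - 1)" "deriv zeta1 ?s / zeta1 ?s"] 1 C by linarith
    moreover have "cmod (of_real x powr ?s / ?s) \<le> x powr \<sigma> / \<bar>t\<bar>"
      using s t by (simp add: norm_divide norm_of_real_powr[OF x0]) (intro frac_le, auto)
    ultimately have "cmod (?g ?s) \<le> C * (x powr \<sigma> / \<bar>t\<bar>)"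
      unfolding explicit_integrand_def norm_mult by (intro mult_mono) (auto intro: order_trans[OF norm_ge_zero])
    then show ?thesis by (simp add: mult_ac)
  qed
  have x1: "x \<noteq> 1" using L by auto
  have "?c * ln x = 1 + ln x" using L by (simp add: distrib_right)
  then have xc: "x powr ?c = exp 1 * x" using x0 by (simp add: powr_def exp_add)
  have "cmod (contour_integral (linepath (Complex (3 / 4) t) (Complex ?c t)) ?g)
      \<le> 47 * L\<^sup>2 / \<bar>t\<bar> * ((x powr ?c - x powr (3 / 4)) / ln x)"
  proof (rule contour_integral_horizontal_bound[OF cont])
    fix \<sigma> assume \<sigma>: "\<sigma> \<in> {3 / 4..?c}"
    then have s: "3 / 4 \<le> \<sigma>" "\<sigma> \<le> 1 + 1 / L" by auto
    then have s2: "\<sigma> \<le> 2" using Lp by linarith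
    have "cmod (deriv zeta1 (Complex \<sigma> t) / zeta1 (Complex \<sigma> t)) \<le> 861 / 10 * L + 36 / 10 * L / d"
    proof (rule zeta1_logderiv_bound_right[OF L x0])
      show "d \<le> \<bar>Im \<rho> - t\<bar>" if "\<rho> \<in> zeros_in zeta1 (Complex 2 t) (25 / 10)" for \<rho>
        unfolding d_def using zeros_in_strip[OF that] by (rule far)
    qed (use s s2 t d nz in auto)
    also have "\<dots> = 861 / 10 * L + 36 / 10 * L * (1 / d)" by simp
    also have "\<dots> = 861 / 10 * L + 45504 / 1000 * L\<^sup>2" unfolding d by (simp add: power2_eq_square)
    finally show "cmod (?g (Complex \<sigma> t)) \<le> 47 * L\<^sup>2 / \<bar>t\<bar> * x powr \<sigma>"
      using L2 L by (intro pt) linarith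
  qed (use c_ge x0 x1 in auto)
  also have "\<dots> \<le> 47 * L\<^sup>2 / \<bar>t\<bar> * ((272 / 100 * x) / ln x)"
  proof (intro mult_left_mono divide_right_mono)
    have "exp 1 * x \<le> 272 / 100 * x" using e_less_272 x0 by (intro mult_right_mono) auto
    moreover have "x powr (3 / 4) \<ge> 0" by simp
    ultimately show "x powr ?c - x powr (3 / 4) \<le> 272 / 100 * x" unfolding xc by linarith
  qed (use L in auto)
  also have "\<dots> = 12784 / 100 * (x * L / \<bar>t\<bar>)" using L by (simp add: power2_eq_square mult_ac)
  finally have R: "cmod (contour_integral (linepath (Complex (3 / 4) t) (Complex ?c t)) ?g) \<le> 12784 / 100 * (x * L / \<bar>t\<bar>)" .
  have "cmod (contour_integral (linepath (Complex (- 1 / 4) t) (Complex (3 / 4) t)) ?g)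
      \<le> 200 * L\<^sup>2 / \<bar>t\<bar> * ((x powr (3 / 4) - x powr (- 1 / 4)) / ln x)"
  proof (rule contour_integral_horizontal_bound[OF cont])
    fix \<sigma> :: real assume \<sigma>: "\<sigma> \<in> {- 1 / 4..3 / 4}"
    have "cmod (deriv zeta1 (Complex \<sigma> t) / zeta1 (Complex \<sigma> t)) \<le> 652 * L + 147 / 10 * L / d"
    proof (rule zeta1_logderiv_bound_left[OF L x0])
      fix \<rho> assume "\<rho> \<in> zeros_in zeta1 (Complex 2 t) (25 / 10)"
      then have "d \<le> \<bar>Im \<rho> - t\<bar>" unfolding d_def by (intro far zeros_in_strip)
      also have "\<dots> = \<bar>Im (Complex \<sigma> t - \<rho>)\<bar>" by simp
      also have "\<dots> \<le> cmod (Complex \<sigma> t - \<rho>)" by (rule abs_Im_le_cmod)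
      finally show "d \<le> cmod (Complex \<sigma> t - \<rho>)" .
    qed (use \<sigma> t d nz in auto)
    also have "\<dots> = 652 * L + 147 / 10 * L * (1 / d)" by simp
    also have "\<dots> = 652 * L + 185808 / 1000 * L\<^sup>2" unfolding d by (simp add: power2_eq_square)
    finally show "cmod (?g (Complex \<sigma> t)) \<le> 200 * L\<^sup>2 / \<bar>t\<bar> * x powr \<sigma>"
      using L2 L by (intro pt) linarith
  qed (use c_ge x0 x1 in auto)
  also have "\<dots> \<le> 200 * L\<^sup>2 / \<bar>t\<bar> * ((x * (1 / 32768)) / ln x)"
  proof (intro mult_left_mono divide_right_mono)
    have "x powr (3 / 4) = x powr (1 + (- 1 / 4))" by simp
    also have "\<dots> = x * x powr (- 1 / 4)" using x0 by (simp only: powr_add) simp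
    also have "\<dots> \<le> x * (1 / 32768)" using x_powr_quarter x0 by (intro mult_left_mono) auto
    moreover have "x powr (- 1 / 4) \<ge> 0" by simp
    ultimately show "x powr (3 / 4) - x powr (- 1 / 4) \<le> x * (1 / 32768)" by linarith
  qed (use L in auto)
  also have "\<dots> = 200 / 32768 * (x * L / \<bar>t\<bar>)" using L by (simp add: power2_eq_square mult_ac)
  finally have Lf: "cmod (contour_integral (linepath (Complex (- 1 / 4) t) (Complex (3 / 4) t)) ?g) \<le> 200 / 32768 * (x * L / \<bar>t\<bar>)" .
  have "contour_integral (linepath (Complex (- 1 / 4) t) (Complex ?c t)) ?g =
     contour_integral (linepath (Complex (- 1 / 4) t) (Complex (3 / 4) t)) ?g + contour_integral (linepath (Complex (3 / 4) t) (Complex ?c t)) ?g"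
  proof (rule contour_integral_split_linepath[OF cont])
    show "Complex (3 / 4) t \<in> closed_segment (Complex (- 1 / 4) t) (Complex ?c t)"
      using c_ge by (auto simp: closed_segment_same_Im closed_segment_eq_real_ivl)
  qed (use c_ge in auto)
  then have "cmod (contour_integral (linepath (Complex (- 1 / 4) t) (Complex ?c t)) ?g) \<le> (12784 / 100 + 200 / 32768) * (x * L / \<bar>t\<bar>)"
    using R Lf by (auto intro!: norm_triangle_le simp: distrib_right)
  also have "\<dots> \<le> (12786 / 100) * (x * L / \<bar>t\<bar>)" using L(2) x0 by (intro mult_right_mono) auto
  also have "\<dots> = 2131 / 1000 * (x / \<bar>t\<bar> * (60 * L))" by simp
  also have "\<dots> \<le> 2131 / 1000 * (x / \<bar>t\<bar> * L\<^sup>2)" using L2 x0 by (intro mult_left_mono) auto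
  finally show ?thesis by simp
qed

text \<open>Zeros have positive real part, so on \<open>Re s = -1/4\<close> they are at least 1/4
  away and \<open>F'/F\<close> is of order \<open>L\<close>, with 712 covering 652 + 14.7 * 4 and
  the pole term. Comparing \<open>cmod s\<close> with \<open>sqrt (u^2 + 1) / 4\<close> makes the
  integral an \<open>arsinh\<close>, worth another \<open>L\<close>, and
  \<open>x powr (- 1/4)\<close> shrinks the constant.\<close>

lemma left_side_bound:
  assumes U: "0 < U" "U \<le> x + 1"
  shows "cmod (contour_integral (linepath (Complex (- 1 / 4) (- U)) (Complex (- 1 / 4) U)) (explicit_integrand x)) \<le> 18 / 100 * L\<^sup>2"
proof -
  let ?g = "explicit_integrand x"
  let ?a = "Complex (- 1 / 4) (- U)" and ?b = "Complex (- 1 / 4) U"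
  define K where "K = 712 * L * (x powr (- 1 / 4) * 4)"
  have K: "K \<ge> 0" using L by (simp add: K_def)
  have seg: "Re s = - 1 / 4" if "s \<in> closed_segment ?a ?b" for s using that by (simp add: closed_segment_same_Re)
  have pt: "cmod (?g (Complex (- 1 / 4) u)) \<le> K / sqrt (u\<^sup>2 + 1)" if u: "\<bar>u\<bar> \<le> U" for u
  proof -
    let ?s = "Complex (- 1 / 4) u"
    have nz: "zeta1 ?s \<noteq> 0" using zeta1_zero_strip(1)[of ?s] by auto
    have h2: "cmod (deriv zeta1 ?s / zeta1 ?s) \<le> 652 * L + 147 / 10 * L / (1 / 4)"
    proof (rule zeta1_logderiv_bound_left[OF L x0])
      fix \<rho> assume "\<rho> \<in> zeros_in zeta1 (Complex 2 u) (25 / 10)"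
      then have "Re \<rho> > 0" by (intro zeta1_zero_strip(1) zeros_in_strip)
      then have "1 / 4 \<le> \<bar>Re (?s - \<rho>)\<bar>" by simp
      also have "\<dots> \<le> cmod (?s - \<rho>)" by (rule abs_Re_le_cmod)
      finally show "1 / 4 \<le> cmod (?s - \<rho>)" .
    qed (use u U nz in auto)
    have h1: "cmod (1 / (?s - 1)) \<le> 1"
    proof -
      have "1 \<le> \<bar>Re (?s - 1)\<bar>" by simp
      also have "\<dots> \<le> cmod (?s - 1)" by (rule abs_Re_le_cmod)
      finally have "1 / cmod (?s - 1) \<le> 1 / 1" by (intro frac_le) auto
      then show ?thesis by (simp add: norm_divide)
    qed
    have "cmod (1 / (?s - 1) - deriv zeta1 ?s / zeta1 ?s) \<le> cmod (1 / (?s - 1)) + cmod (deriv zeta1 ?s / zeta1 ?s)"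
      by (rule norm_triangle_ineq4)
    also have "\<dots> \<le> 1 + (652 * L + 147 / 10 * L / (1 / 4))" using h1 h2 by (rule add_mono)
    also have "\<dots> \<le> 712 * L" using L by simp
    finally have A: "cmod (1 / (?s - 1) - deriv zeta1 ?s / zeta1 ?s) \<le> 712 * L" .
    have "sqrt (u\<^sup>2 + 1) / 4 = sqrt ((u\<^sup>2 + 1) / 16)" by (simp add: real_sqrt_divide)
    also have "\<dots> \<le> cmod ?s" unfolding cmod_def by (intro real_sqrt_le_mono) (simp add: power2_eq_square)
    finally have B0: "sqrt (u\<^sup>2 + 1) / 4 \<le> cmod ?s" .
    have p: "sqrt (u\<^sup>2 + 1) > 0" by (simp add: add_nonneg_pos)
    have "cmod (of_real x powr ?s / ?s) = x powr (- 1 / 4) / cmod ?s" by (simp add: norm_divide norm_of_real_powr[OF x0])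
    also have "\<dots> \<le> x powr (- 1 / 4) / (sqrt (u\<^sup>2 + 1) / 4)" using B0 p by (intro frac_le) auto
    finally have B: "cmod (of_real x powr ?s / ?s) \<le> x powr (- 1 / 4) / (sqrt (u\<^sup>2 + 1) / 4)" .
    have "cmod (?g ?s) \<le> 712 * L * (x powr (- 1 / 4) / (sqrt (u\<^sup>2 + 1) / 4))"
      unfolding explicit_integrand_def norm_mult using A B L by (intro mult_mono) auto
    then show ?thesis by (simp add: K_def)
  qed
  have "cmod (contour_integral (linepath ?a ?b) ?g) \<le> K * arsinh (- U + 1 * (2 * U)) - K * arsinh (- U + 0 * (2 * U))"
  proof (rule contour_integral_linepath_bound_antideriv[where G = "\<lambda>t. K * arsinh (- U + t * (2 * U))"
        and g = "\<lambda>t. K / sqrt ((- U + t * (2 * U))\<^sup>2 + 1) * (2 * U)"])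
    show "continuous_on (closed_segment ?a ?b) ?g"
      using seg zeta1_zero_strip(1) by (intro holomorphic_on_imp_continuous_on explicit_integrand_holomorphic x0) force+
    fix t :: real assume t: "t \<in> {0..1}"
    show "((\<lambda>t. K * arsinh (- U + t * (2 * U))) has_real_derivative K / sqrt ((- U + t * (2 * U))\<^sup>2 + 1) * (2 * U)) (at t within {0..1})"
    proof -
      have "((\<lambda>t. - U + t * (2 * U)) has_real_derivative 2 * U) (at t within {0..1})"
        by (auto intro!: derivative_eq_intros)
      then have "((\<lambda>t. arsinh (- U + t * (2 * U))) has_real_derivative
          1 / sqrt ((- U + t * (2 * U))\<^sup>2 + 1) * (2 * U)) (at t within {0..1})"
        by (rule DERIV_chain2[OF arsinh_real_has_field_derivative])
      from DERIV_cmult[OF this, of K] show ?thesis by simp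
    qed
    have "linepath ?a ?b t = Complex (- 1 / 4) (- U + t * (2 * U))"
      by (simp add: linepath_def complex_eq_iff algebra_simps)
    moreover have "cmod (?b - ?a) = 2 * U" using U by (simp add: cmod_def real_sqrt_mult)
    moreover have "\<bar>- U + t * (2 * U)\<bar> \<le> U"
    proof -
      have "t * (2 * U) \<le> 1 * (2 * U)" using t U by (intro mult_right_mono) auto
      moreover have "0 \<le> t * (2 * U)" using t U by simp
      ultimately show ?thesis by linarith
    qed
    ultimately show "cmod (?g (linepath ?a ?b t)) * cmod (?b - ?a) \<le> K / sqrt ((- U + t * (2 * U))\<^sup>2 + 1) * (2 * U)"
      using pt[of "- U + t * (2 * U)"] U by (simp only:) (intro mult_right_mono, auto)
  qed
  also have "\<dots> = 2 * K * arsinh U" by simp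
  also have "\<dots> \<le> 2 * K * (L + 12 / 10)"
  proof (rule mult_left_mono)
    have "sqrt (U\<^sup>2 + 1) \<le> U + 1" using U by (intro real_le_lsqrt) (auto simp: power2_eq_square algebra_simps)
    then have "U + sqrt (U\<^sup>2 + 1) \<le> 3 * x" using U x_large[OF L x0] by linarith
    then have "arsinh U \<le> ln (3 * x)" unfolding arsinh_real_def using arsinh_real_aux[of U] by (subst ln_le_cancel_iff) (use x0 in auto)
    also have "\<dots> = ln 3 + L" using x0 L by (simp add: ln_mult)
    also have "ln 3 \<le> (12 / 10 :: real)"
    proof -
      have "(3 :: real) \<le> (1 + 6 / 10 + (6 / 10)\<^sup>2 / 2) ^ 2" by (simp add: power2_eq_square)
      also have "\<dots> \<le> exp (6 / 10) ^ 2" by (intro power_mono exp_lower_Taylor_quadratic) auto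
      also have "\<dots> = exp (12 / 10)" by (simp flip: exp_of_nat_mult)
      finally have "ln 3 \<le> ln (exp (12 / 10 :: real))" by (subst ln_le_cancel_iff) auto
      then show ?thesis by simp
    qed
    finally show "arsinh U \<le> L + 12 / 10" by simp
  qed (use K in simp)
  also have "\<dots> \<le> 2 * (712 * L * (1 / 32768 * 4)) * (L + 12 / 10)"
    unfolding K_def using x_powr_quarter L by (intro mult_right_mono mult_left_mono) auto
  also have "\<dots> \<le> 2 * (712 * L * (1 / 32768 * 4)) * (L * (102 / 100))"
    using L by (intro mult_left_mono) auto
  also have "\<dots> \<le> 18 / 100 * L\<^sup>2" by (simp add: power2_eq_square)
  finally show ?thesis .
qed

text \<open>The zeros gained between \<open>T\<close> and \<open>U\<close> lie in the two discs of
  radius 2.07 about \<open>2 + i (T + 1/2)\<close> and its conjugate, so their number is at most 2 *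
  6.3 L. Each term is at most \<open>x / T\<close>, as \<open>Re \<rho> < 1\<close> and
  \<open>cmod \<rho> \<ge> T\<close>.\<close>

lemma zero_sum_shift:
  assumes T: "50 < T" "T < x" and U: "T < U" "U < T + 1"
  shows "cmod ((\<Sum>\<rho> | \<rho> \<in> nontrivial_zeros \<and> \<bar>Im \<rho>\<bar> < U. of_int (zorder zeta1 \<rho>) * (of_real x powr \<rho> / \<rho>)) -
     (\<Sum>\<rho> | \<rho> \<in> nontrivial_zeros \<and> \<bar>Im \<rho>\<bar> < T. of_int (zorder zeta1 \<rho>) * (of_real x powr \<rho> / \<rho>))) \<le> 126 / 10 * L * x / T"
proof -
  let ?h = "\<lambda>\<rho>. of_int (zorder zeta1 \<rho>) * (of_real x powr \<rho> / \<rho>)"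
  let ?D = "{\<rho>. \<rho> \<in> nontrivial_zeros \<and> \<bar>Im \<rho>\<bar> < U} - {\<rho>. \<rho> \<in> nontrivial_zeros \<and> \<bar>Im \<rho>\<bar> < T}"
  let ?P = "zeros_in zeta1 (Complex 2 (T + 1 / 2)) (207 / 100)" and ?N = "zeros_in zeta1 (Complex 2 (- (T + 1 / 2))) (207 / 100)"
  have fin: "finite ?P" "finite ?N" by (rule finite_zeta1_zeros_in)+
  have x1: "x \<ge> 1" using T by simp
  have D: "zeta1 \<rho> = 0" "0 < Re \<rho>" "Re \<rho> < 1" "T \<le> \<bar>Im \<rho>\<bar>" "\<bar>Im \<rho>\<bar> < T + 1" if "\<rho> \<in> ?D" for \<rho>
    using that U zeta1_zero_strip[of \<rho>] by (auto simp: nontrivial_zeros_iff)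
  have sub: "?D \<subseteq> ?P \<union> ?N"
  proof
    fix \<rho> assume "\<rho> \<in> ?D"
    note d = D[OF this]
    have *: "cmod (\<rho> - Complex 2 t) \<le> 207 / 100" if "\<bar>Im \<rho> - t\<bar> \<le> 1 / 2" for t
    proof -
      have "(cmod (\<rho> - Complex 2 t))\<^sup>2 = \<bar>Re \<rho> - 2\<bar>\<^sup>2 + \<bar>Im \<rho> - t\<bar>\<^sup>2" by (simp add: cmod_power2)
      also have "\<dots> \<le> 2\<^sup>2 + (1 / 2)\<^sup>2" using d that by (intro add_mono power_mono) auto
      also have "\<dots> \<le> (207 / 100)\<^sup>2" by (simp add: power2_eq_square)
      finally show ?thesis by (rule power2_le_imp_le) simp
    qed
    have "\<bar>Im \<rho> - (T + 1 / 2)\<bar> \<le> 1 / 2 \<or> \<bar>Im \<rho> - (- (T + 1 / 2))\<bar> \<le> 1 / 2" using d(4,5) T by linarith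
    then show "\<rho> \<in> ?P \<union> ?N" using *[of "T + 1 / 2"] *[of "- (T + 1 / 2)"] d(1) by (auto simp: zeros_in_def)
  qed
  have disj: "?P \<inter> ?N = {}"
  proof (rule ccontr)
    assume "?P \<inter> ?N \<noteq> {}"
    then obtain \<rho> where "cmod (\<rho> - Complex 2 (T + 1 / 2)) \<le> 207 / 100" "cmod (\<rho> - Complex 2 (- (T + 1 / 2))) \<le> 207 / 100"
      by (auto simp: zeros_in_def)
    then have "\<bar>Im \<rho> - (T + 1 / 2)\<bar> \<le> 207 / 100" "\<bar>Im \<rho> - (- (T + 1 / 2))\<bar> \<le> 207 / 100"
      using abs_Im_le_cmod[of "\<rho> - Complex 2 (T + 1 / 2)"] abs_Im_le_cmod[of "\<rho> - Complex 2 (- (T + 1 / 2))"] by auto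
    then show False using T by linarith
  qed
  have "(\<Sum>\<rho> | \<rho> \<in> nontrivial_zeros \<and> \<bar>Im \<rho>\<bar> < U. ?h \<rho>) - (\<Sum>\<rho> | \<rho> \<in> nontrivial_zeros \<and> \<bar>Im \<rho>\<bar> < T. ?h \<rho>) = (\<Sum>\<rho>\<in>?D. ?h \<rho>)"
    using U finite_nontrivial_zeros[of U] by (intro sum_diff[symmetric]) auto
  also have "cmod \<dots> \<le> (\<Sum>\<rho>\<in>?D. zeta1_mult \<rho> * (x / T))"
  proof (rule sum_norm_le)
    fix \<rho> assume "\<rho> \<in> ?D"
    note d = D[OF this]
    have nn: "zorder zeta1 \<rho> \<ge> 0" by (rule zorder_entire_nonneg[OF zeta1_holomorphic_UNIV zeta1_not_zero_1])
    have "x powr Re \<rho> \<le> x powr 1" using d x1 by (intro powr_mono) auto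
    moreover have "T \<le> cmod \<rho>" using abs_Im_le_cmod[of \<rho>] d(4) by linarith
    ultimately have "cmod (of_real x powr \<rho> / \<rho>) \<le> x / T"
      using T x0 by (simp add: norm_divide norm_of_real_powr[OF x0]) (intro frac_le, auto)
    then have "zeta1_mult \<rho> * cmod (of_real x powr \<rho> / \<rho>) \<le> zeta1_mult \<rho> * (x / T)" by (rule mult_left_mono) simp
    moreover have "cmod (of_int (zorder zeta1 \<rho>)) = zeta1_mult \<rho>" using nn by simp
    ultimately show "cmod (?h \<rho>) \<le> zeta1_mult \<rho> * (x / T)" by (simp only: norm_mult)
  qed
  also have "\<dots> \<le> (\<Sum>\<rho>\<in>?P \<union> ?N. zeta1_mult \<rho> * (x / T))" using fin T x0 sub by (intro sum_mono2) auto
  also have "\<dots> = ((\<Sum>\<rho>\<in>?P. zeta1_mult \<rho>) + (\<Sum>\<rho>\<in>?N. zeta1_mult \<rho>)) * (x / T)"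
    unfolding sum_distrib_right[symmetric] using fin disj by (simp add: sum.union_disjoint)
  also have "\<dots> \<le> (63 / 10 * L + 63 / 10 * L) * (x / T)"
    using T x0 by (intro mult_right_mono add_mono zero_count_207[OF L x0]) auto
  finally show ?thesis by simp
qed

end

section \<open>The explicit formula\<close>

text \<open>Everything is compared at height \<open>U\<close> after multiplication by
  \<open>2 * pi * \<i>\<close>, and every error is measured in the unit \<open>E\<close>. Since
  \<open>T < x\<close>, the unit dominates \<open>L^2\<close>, hence the left side and the bounded
  residue at 0; since \<open>U > T\<close>, errors over \<open>U\<close> are no worse than over
  \<open>T\<close>.\<close>

lemma explicit_formula_half_odd:
  assumes xK: "x = real K + 1 / 2" and x60: "x > exp 60" and T: "50 < T" "T < x"
  shows "cmod (of_real (chebyshev_psi x) - (of_real x -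
     (\<Sum>\<rho> | \<rho> \<in> nontrivial_zeros \<and> \<bar>Im \<rho>\<bar> < T. of_int (zorder zeta1 \<rho>) * (of_real x powr \<rho> / \<rho>)))) < 2 * x * (ln x)\<^sup>2 / T"
proof -
  define L c where "L = ln x" and "c = 1 + 1 / L"
  have x0: "x > 0" using xK by simp
  have L60: "L \<ge> 60" unfolding L_def using x60 x0 by (simp add: ln_ge_iff)
  note L = L_def L60
  have c: "c > 1" using L60 by (simp add: c_def)
  obtain U where U: "T < U" "U < T + 1" and far:
    "\<And>\<rho>. zeta1 \<rho> = 0 \<Longrightarrow> Re \<rho> > -1 \<Longrightarrow> 1 / (1264 / 100 * L) \<le> \<bar>Im \<rho> - U\<bar> \<and> 1 / (1264 / 100 * L) \<le> \<bar>Im \<rho> - (- U)\<bar>"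
    using zero_free_ordinate[OF L x0, of T] T by (smt (verit))
  let ?g = "explicit_integrand x" and ?l = "\<lambda>a b. contour_integral (linepath a b) (explicit_integrand x)"
  define S where "S = (\<lambda>t. \<Sum>\<rho> | \<rho> \<in> nontrivial_zeros \<and> \<bar>Im \<rho>\<bar> < t. of_int (zorder zeta1 \<rho>) * (of_real x powr \<rho> / \<rho> :: complex))"
  define r where "r = - 1 - deriv zeta1 0 / zeta1 (0 :: complex)"
  define p where "p = 2 * of_real pi * \<i>"
  define Hb Ht V W where "Hb = ?l (Complex (- 1 / 4) (- U)) (Complex c (- U))" and "Ht = ?l (Complex (- 1 / 4) U) (Complex c U)"
    and "V = ?l (Complex c (- U)) (Complex c U)" and "W = ?l (Complex (- 1 / 4) (- U)) (Complex (- 1 / 4) U)"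
  define E where "E = x * L\<^sup>2 / T"
  have d: "0 < 1 / (1264 / 100 * L)" using L60 by simp
  have nz: "\<bar>Im \<rho>\<bar> \<noteq> U" if "zeta1 \<rho> = 0" "Re \<rho> > -1" for \<rho>
  proof
    assume "\<bar>Im \<rho>\<bar> = U"
    then have "Im \<rho> - U = 0 \<or> Im \<rho> - (- U) = 0" by linarith
    then show False using far[OF that] d by (metis abs_zero not_le)
  qed
  have U0: "U > 0" "50 \<le> \<bar>U\<bar>" "\<bar>U\<bar> \<le> x + 1" using U T by auto
  have "p * (of_real x + r - S U) = contour_integral (rectpath (Complex (- 1 / 4) (- U)) (Complex c U)) ?g"
    unfolding p_def r_def S_def by (rule explicit_contour_integral[OF x0 c U0(1), symmetric]) (rule nz)
  also have "\<dots> = Hb + V - Ht - W"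
    unfolding Hb_def V_def Ht_def W_def
  proof (rule contour_integral_rectpath)
    have "path_image (rectpath (Complex (- 1 / 4) (- U)) (Complex c U)) =
        cbox (Complex (- 1 / 4) (- U)) (Complex c U) - box (Complex (- 1 / 4) (- U)) (Complex c U)"
      using c U0 by (intro path_image_rectpath_cbox_minus_box) auto
    moreover have "?g holomorphic_on (cbox (Complex (- 1 / 4) (- U)) (Complex c U) - box (Complex (- 1 / 4) (- U)) (Complex c U))"
    proof (rule explicit_integrand_holomorphic[OF x0])
      fix s assume s: "s \<in> cbox (Complex (- 1 / 4) (- U)) (Complex c U) - box (Complex (- 1 / 4) (- U)) (Complex c U)"
      show "zeta1 s \<noteq> 0"
      proof
        assume z: "zeta1 s = 0"
        have "Re s > -1" using s by (auto simp: in_cbox_complex_iff)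
        from zeta1_zero_strip[OF z this] nz[OF z this] s c show False
          by (auto simp: in_box_complex_iff in_cbox_complex_iff)
      qed
    qed (use c U0 in \<open>auto simp: in_box_complex_iff in_cbox_complex_iff\<close>)
    ultimately show "continuous_on (path_image (rectpath (Complex (- 1 / 4) (- U)) (Complex c U))) ?g"
      by (simp only: holomorphic_on_imp_continuous_on)
  qed (use c U0 in auto)
  finally have res: "p * (of_real x + r - S U) = Hb + V - Ht - W" .
  have hb: "cmod Hb \<le> 2131 / 1000 * x * L\<^sup>2 / \<bar>- U\<bar>"
    unfolding Hb_def c_def using U0 far by (intro horizontal_side_bound[OF L x0]) auto
  have ht: "cmod Ht \<le> 2131 / 1000 * x * L\<^sup>2 / \<bar>U\<bar>"
    unfolding Ht_def c_def using U0 far by (intro horizontal_side_bound[OF L x0]) auto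
  have w: "cmod W \<le> 18 / 100 * L\<^sup>2"
    unfolding W_def using U0 by (intro left_side_bound[OF L x0]) auto
  have sh: "cmod (S U - S T) \<le> 126 / 10 * L * x / T"
    unfolding S_def using T U by (rule zero_sum_shift[OF L x0])
  have r: "cmod r \<le> 17" unfolding r_def by (rule residue_0_bound)
  have "V = contour_integral (linepath (Complex c (- U)) (Complex c U)) (\<lambda>s. mangoldt_series s * (of_real x powr s / s))"
    unfolding V_def
  proof (rule contour_integral_cong[OF refl])
    fix s assume "s \<in> path_image (linepath (Complex c (- U)) (Complex c U))"
    then have "Re s > 1" using c by (auto simp: closed_segment_same_Re)
    then show "?g s = mangoldt_series s * (of_real x powr s / s)"
      by (simp only: explicit_integrand_def zeta1_logderiv)
  qed
  moreover have "cmod (contour_integral (linepath (Complex c (- U)) (Complex c U)) (\<lambda>s. mangoldt_series s * (of_real x powr s / s))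
           - 2 * of_real pi * \<i> * of_real (chebyshev_psi x)) \<le> 2 / U * (2212 / 1000 * x * L\<^sup>2)"
    by (intro perron_mangoldt[OF xK c U0(1)] perron_error_sum[OF xK L c_def])
  ultimately have v: "cmod (V - p * of_real (chebyshev_psi x)) \<le> 2 / U * (2212 / 1000 * x * L\<^sup>2)"
    unfolding p_def by (simp only:)
  have xT: "1 \<le> x / T" using T by simp
  have EL: "L\<^sup>2 \<le> E" unfolding E_def using mult_right_mono[OF xT, of "L\<^sup>2"] by simp
  have "60\<^sup>2 \<le> L\<^sup>2" using L60 by (intro power_mono) auto
  then have E36: "3600 \<le> E" using EL by simp
  have "x / T * (60 * L) \<le> x / T * (L * L)" using L60 xT by (intro mult_left_mono mult_right_mono) auto
  moreover have "x / T * (L * L) = E" by (simp add: E_def power2_eq_square)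
  moreover have "x / T * (60 * L) = 60 * (L * x / T)" by simp
  ultimately have Lx: "L * x / T \<le> E / 60" by linarith
  have EU: "x * L\<^sup>2 / U \<le> E" unfolding E_def using U T x0 by (intro divide_left_mono) auto
  have np: "cmod p = 2 * pi" by (simp add: p_def norm_mult)
  have "p * (of_real (chebyshev_psi x) - (of_real x - S T)) =
      - (V - p * of_real (chebyshev_psi x)) + (Ht + (W + (- Hb))) + p * (r - (S U - S T))"
    using res by (simp add: algebra_simps)
  moreover have "cmod (- a + (b + (c + (- d))) + q) \<le> cmod a + (cmod b + (cmod c + cmod d)) + cmod q" for a b c d q
    by (intro order_trans[OF norm_triangle_ineq] add_mono) auto
  ultimately have "cmod (p * (of_real (chebyshev_psi x) - (of_real x - S T))) \<le>
      cmod (V - p * of_real (chebyshev_psi x)) + (cmod Ht + (cmod W + cmod Hb)) + cmod (p * (r - (S U - S T)))"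
    by (simp only:)
  moreover have "cmod (p * (r - (S U - S T))) \<le> cmod p * (cmod r + cmod (S U - S T))"
    unfolding norm_mult by (intro mult_left_mono norm_triangle_ineq4) auto
  moreover have "cmod (V - p * of_real (chebyshev_psi x)) \<le> 4424 / 1000 * E"
  proof -
    have "2 / U * (2212 / 1000 * x * L\<^sup>2) = 4424 / 1000 * (x * L\<^sup>2 / U)" by simp
    also have "\<dots> \<le> 4424 / 1000 * E" using EU by (rule mult_left_mono) simp
    finally show ?thesis by (rule order_trans[OF v])
  qed
  moreover have "cmod Ht \<le> 2131 / 1000 * E" "cmod Hb \<le> 2131 / 1000 * E"
  proof -
    have H: "2131 / 1000 * x * L\<^sup>2 / u \<le> 2131 / 1000 * E" if "u = U" for u
    proof -
      have "2131 / 1000 * x * L\<^sup>2 / u = 2131 / 1000 * (x * L\<^sup>2 / U)" using that by simp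
      also have "\<dots> \<le> 2131 / 1000 * E" using EU by (rule mult_left_mono) simp
      finally show ?thesis .
    qed
    show "cmod Ht \<le> 2131 / 1000 * E" using U0 by (intro order_trans[OF ht] H) simp
    show "cmod Hb \<le> 2131 / 1000 * E" using U0 by (intro order_trans[OF hb] H) simp
  qed
  moreover have "cmod p * (cmod r + cmod (S U - S T)) \<le> 2 * pi * (215 / 1000 * E)"
    unfolding np using r sh Lx E36 by (intro mult_left_mono) auto
  ultimately have "cmod p * cmod (of_real (chebyshev_psi x) - (of_real x - S T)) \<le> 8866 / 1000 * E + 2 * pi * (215 / 1000 * E)"
    using w EL unfolding norm_mult by linarith
  \<comment> \<open>8.866 = 4.424 (Perron) + 2 * 2.131 (horizontal sides) + 0.18 (left side);
      0.215 = 12.6 / 60 (shift from U to T) + 17 / 3600 (residue at 0, rounded up)\<close>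
  also have "\<dots> \<le> 2 * pi * (1478 / 1000 * E) + 2 * pi * (215 / 1000 * E)"
  \<comment> \<open>Using only \<open>pi > 3\<close>: \<open>8.866 \<le> 6 * 1.478\<close>, and
    1.478 + 0.215 stays below 2.\<close>
  proof -
    have "6 * (1478 / 1000 * E) \<le> 2 * pi * (1478 / 1000 * E)" using pi_gt3 E36 by (intro mult_right_mono) auto
    then show ?thesis using E36 by simp
  qed
  also have "\<dots> < 2 * pi * (2 * E)" using E36 by (simp add: distrib_left[symmetric])
  finally have "cmod (of_real (chebyshev_psi x) - (of_real x - S T)) < 2 * E" unfolding np by simp
  then show ?thesis unfolding S_def E_def L_def by (simp add: mult_ac)
qed

theorem theorem2p1:
  fixes x T :: real
  assumes "x > exp 60"
    and "\<exists>k::int. odd k \<and> x = of_int k / 2"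
    and "50 < T" "T < x"
    and "\<And>\<rho>. \<rho> \<noteq> 1 \<Longrightarrow> riemann_zeta \<rho> = 0 \<Longrightarrow> Im \<rho> \<noteq> T"
  shows "cmod (of_real (chebyshev_psi x) -
           (of_real x - (\<Sum>\<rho> | \<rho> \<in> nontrivial_zeros \<and> \<bar>Im \<rho>\<bar> < T.
              of_int (zorder riemann_zeta \<rho>) * (of_real x powr \<rho> / \<rho>))))
         < 2 * x * (ln x)\<^sup>2 / T"
proof -
  obtain k :: int where k: "odd k" "x = of_int k / 2" using assms(2) by blast
  then obtain m where m: "k = 2 * m + 1" by (auto elim: oddE)
  have "x > 0" using assms(3,4) by simp
  then have "m \<ge> 0" using k(2) m by simp
  then have "x = real (nat m) + 1 / 2" using k(2) m by (simp add: add_divide_distrib)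
  moreover have "(\<Sum>\<rho> | \<rho> \<in> nontrivial_zeros \<and> \<bar>Im \<rho>\<bar> < T. of_int (zorder riemann_zeta \<rho>) * (complex_of_real x powr \<rho> / \<rho>)) =
     (\<Sum>\<rho> | \<rho> \<in> nontrivial_zeros \<and> \<bar>Im \<rho>\<bar> < T. of_int (zorder zeta1 \<rho>) * (of_real x powr \<rho> / \<rho>))"
    by (rule sum.cong[OF refl]) (simp add: zorder_riemann_zeta)
  ultimately show ?thesis using explicit_formula_half_odd[of x "nat m" T] assms(1,3,4) by (simp only:)
qed

end
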